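(* Let $G$ be a non-trivial discrete group. For each $i\in\mathbb{N}$ let $\mathcal{H}_i$ be a Hilbert space, $\phi_i\in\mathcal{H}_i$ a unit vector, and $\alpha_i$ an action of $G$ on $\mathcal{M}_i=\mathcal{B}(\mathcal{H}_i)$; for each $g\in G$ let $U_i(g)$ be a unitary on $\mathcal{H}_i$ with $\alpha_{i,g}=\mathrm{Ad}(U_i(g))$. Then $\odot_i\alpha_i$ extends (uniquely) to an action $\alpha=\otimes_i\alpha_i$ of $G$ on the von Neumann algebra $\otimes_i(\mathcal{B}(\mathcal{H}_i),\phi_i)$ if and only if $$\sum_i \bigl(1- |(U_i(g)\phi_i,\phi_i)|\bigr) < \infty \quad \text{for all } g \in G.$$
   Context: $\mathrm{Ad}(U)(T)=UTU^*$. An action of $G$ on a von Neumann algebra $\mathcal{M}$ is a homomorphism $G\to\mathrm{Aut}(\mathcal{M})$. For unit vectors $\phi_i\in\mathcal{H}_i$, $\bigotimes_i^{\phi}\mathcal{H}_i$ (with $\phi=(\phi_i)$) is the completed inductive limit of the spaces $\mathcal{H}_1\otimes\cdots\otimes\mathcal{H}_n$ under the isometries $\psi\mapsto\psi\otimes\phi_{n+1}$. For von Neumann algebras $\mathcal{M}_i\subset\mathcal{B}(\mathcal{H}_i)$, $\odot_i\mathcal{M}_i$ (resp. $\otimes_i(\mathcal{M}_i,\phi_i)$) is the $*$-algebra (resp. von Neumann algebra) on $\bigotimes_i^{\phi}\mathcal{H}_i$ generated by the operators $\otimes_iT_i$ with $T_i\in\mathcal{M}_i$ and $T_i=I_i$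 (the identity on $\mathcal{H}_i$) for all but finitely many $i$. Given actions $\alpha_i$ of $G$ on $\mathcal{M}_i$, $\odot_i\alpha_i$ is the action of $G$ on $\odot_i\mathcal{M}_i$ determined, for every finite $J\subset\mathbb{N}$, by $(\otimes_{i\in J}T_i)\otimes(\otimes_{i\notin J}I_i)\mapsto(\otimes_{i\in J}\alpha_{i,g}(T_i))\otimes(\otimes_{i\notin J}I_i)$. *)

theory Defs
  imports "HOL-Analysis.Analysis" "HOL-Algebra.Bij"
begin

section \<open>Hilbert spaces\<close>

text \<open>
  The Hilbert spaces of an infinite family are unrelated to each other, so vector spaces are records
  with an explicit carrier. The inner product is linear in its first argument.
\<close>

record 'a cspace = "'a partial_object" +
  vadd :: "'a \<Rightarrow> 'a \<Rightarrow> 'a"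
  vzero :: 'a
  vscale :: "complex \<Rightarrow> 'a \<Rightarrow> 'a"
  vinner :: "'a \<Rightarrow> 'a \<Rightarrow> complex"

definition vnorm :: "'a cspace \<Rightarrow> 'a \<Rightarrow> real" where
  "vnorm H x = sqrt (Re (vinner H x x))"

definition vdist :: "'a cspace \<Rightarrow> 'a \<Rightarrow> 'a \<Rightarrow> real" where
  "vdist H x y = vnorm H (vadd H x (vscale H (-1) y))"

definition cauchy_seqs :: "'a cspace \<Rightarrow> (nat \<Rightarrow> 'a) set" where
  "cauchy_seqs P = {s. (\<forall>k. s k \<in> carrier P) \<and>
     (\<forall>e>0. \<exists>N. \<forall>m\<ge>N. \<forall>n\<ge>N. vdist P (s m) (s n) < e)}"

locale inner_product_space =
  fixes H :: "'a cspace"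
  assumes add_closed: "x \<in> carrier H \<Longrightarrow> y \<in> carrier H \<Longrightarrow> vadd H x y \<in> carrier H"
    and zero_closed: "vzero H \<in> carrier H"
    and scale_closed: "x \<in> carrier H \<Longrightarrow> vscale H c x \<in> carrier H"
    and add_assoc: "x \<in> carrier H \<Longrightarrow> y \<in> carrier H \<Longrightarrow> z \<in> carrier H \<Longrightarrow>
      vadd H (vadd H x y) z = vadd H x (vadd H y z)"
    and add_commute: "x \<in> carrier H \<Longrightarrow> y \<in> carrier H \<Longrightarrow> vadd H x y = vadd H y x"
    and add_zero: "x \<in> carrier H \<Longrightarrow> vadd H x (vzero H) = x"
    and add_uminus: "x \<in> carrier H \<Longrightarrow> vadd H x (vscale H (-1) x) = vzero H"
    and scale_one: "x \<in> carrier H \<Longrightarrow> vscale H 1 x = x"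
    and scale_scale: "x \<in> carrier H \<Longrightarrow> vscale H a (vscale H b x) = vscale H (a * b) x"
    and scale_add_right: "x \<in> carrier H \<Longrightarrow> y \<in> carrier H \<Longrightarrow>
      vscale H a (vadd H x y) = vadd H (vscale H a x) (vscale H a y)"
    and scale_add_left: "x \<in> carrier H \<Longrightarrow>
      vscale H (a + b) x = vadd H (vscale H a x) (vscale H b x)"
    and inner_add: "x \<in> carrier H \<Longrightarrow> y \<in> carrier H \<Longrightarrow> z \<in> carrier H \<Longrightarrow>
      vinner H (vadd H x y) z = vinner H x z + vinner H y z"
    and inner_scale: "x \<in> carrier H \<Longrightarrow> y \<in> carrier H \<Longrightarrow>
      vinner H (vscale H a x) y = a * vinner H x y"
    and inner_cnj: "x \<in> carrier H \<Longrightarrow> y \<in> carrier H \<Longrightarrow> vinner H y x = cnj (vinner H x y)"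
    and inner_nonneg: "x \<in> carrier H \<Longrightarrow> 0 \<le> Re (vinner H x x)"
    and inner_definite: "x \<in> carrier H \<Longrightarrow> vinner H x x = 0 \<Longrightarrow> x = vzero H"

locale hilbert_space = inner_product_space +
  assumes complete: "s \<in> cauchy_seqs H \<Longrightarrow>
    \<exists>x\<in>carrier H. (\<lambda>k. vdist H (s k) x) \<longlonglongrightarrow> 0"


section \<open>Bounded operators\<close>

text \<open>Operators are extensional functions, so that equality of operators is equality on the space.\<close>

definition bounded_ops :: "'a cspace \<Rightarrow> 'b cspace \<Rightarrow> ('a \<Rightarrow> 'b) set" where
  "bounded_ops H K = {T \<in> carrier H \<rightarrow>\<^sub>E carrier K.
     (\<forall>x\<in>carrier H. \<forall>y\<in>carrier H. T (vadd H x y) = vadd K (T x) (T y)) \<and>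
     (\<forall>a. \<forall>x\<in>carrier H. T (vscale H a x) = vscale K a (T x)) \<and>
     (\<exists>C. \<forall>x\<in>carrier H. vnorm K (T x) \<le> C * vnorm H x)}"

abbreviation B_of :: "'a cspace \<Rightarrow> ('a \<Rightarrow> 'a) set" where
  "B_of H \<equiv> bounded_ops H H"

definition id_op :: "'a cspace \<Rightarrow> 'a \<Rightarrow> 'a" where
  "id_op H = (\<lambda>x\<in>carrier H. x)"

definition add_op :: "'a cspace \<Rightarrow> ('a \<Rightarrow> 'a) \<Rightarrow> ('a \<Rightarrow> 'a) \<Rightarrow> 'a \<Rightarrow> 'a" where
  "add_op H S T = (\<lambda>x\<in>carrier H. vadd H (S x) (T x))"

definition scale_op :: "'a cspace \<Rightarrow> complex \<Rightarrow> ('a \<Rightarrow> 'a) \<Rightarrow> 'a \<Rightarrow> 'a" where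
  "scale_op H c T = (\<lambda>x\<in>carrier H. vscale H c (T x))"

abbreviation mult_op :: "'a cspace \<Rightarrow> ('a \<Rightarrow> 'a) \<Rightarrow> ('a \<Rightarrow> 'a) \<Rightarrow> 'a \<Rightarrow> 'a" where
  "mult_op H \<equiv> compose (carrier H)"

definition adj_op :: "'a cspace \<Rightarrow> ('a \<Rightarrow> 'a) \<Rightarrow> 'a \<Rightarrow> 'a" where
  "adj_op H T = (THE S. S \<in> B_of H \<and>
     (\<forall>x\<in>carrier H. \<forall>y\<in>carrier H. vinner H (T x) y = vinner H x (S y)))"

definition unitary_op :: "'a cspace \<Rightarrow> ('a \<Rightarrow> 'a) \<Rightarrow> bool" where
  "unitary_op H U \<longleftrightarrow> U \<in> B_of H \<and>
     mult_op H (adj_op H U) U = id_op H \<and> mult_op H U (adj_op H U) = id_op H"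

definition Ad_op :: "'a cspace \<Rightarrow> ('a \<Rightarrow> 'a) \<Rightarrow> ('a \<Rightarrow> 'a) \<Rightarrow> 'a \<Rightarrow> 'a" where
  "Ad_op H U = (\<lambda>T\<in>B_of H. mult_op H U (mult_op H T (adj_op H U)))"


section \<open>Operator algebras and actions\<close>

definition star_algebra :: "'a cspace \<Rightarrow> ('a \<Rightarrow> 'a) set \<Rightarrow> bool" where
  "star_algebra H A \<longleftrightarrow> A \<subseteq> B_of H \<and> (\<lambda>x\<in>carrier H. vzero H) \<in> A \<and>
     (\<forall>S\<in>A. \<forall>T\<in>A. add_op H S T \<in> A \<and> mult_op H S T \<in> A) \<and>
     (\<forall>c. \<forall>T\<in>A. scale_op H c T \<in> A) \<and>
     (\<forall>T\<in>A. adj_op H T \<in> A)"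

definition commutant :: "'a cspace \<Rightarrow> ('a \<Rightarrow> 'a) set \<Rightarrow> ('a \<Rightarrow> 'a) set" where
  "commutant H A = {S \<in> B_of H. \<forall>T\<in>A. mult_op H S T = mult_op H T S}"

definition von_neumann_algebra :: "'a cspace \<Rightarrow> ('a \<Rightarrow> 'a) set \<Rightarrow> bool" where
  "von_neumann_algebra H M \<longleftrightarrow> star_algebra H M \<and> commutant H (commutant H M) = M"

definition generated_star_algebra :: "'a cspace \<Rightarrow> ('a \<Rightarrow> 'a) set \<Rightarrow> ('a \<Rightarrow> 'a) set" where
  "generated_star_algebra H X = \<Inter>{A. star_algebra H A \<and> X \<subseteq> A}"

definition generated_vN_algebra :: "'a cspace \<Rightarrow> ('a \<Rightarrow> 'a) set \<Rightarrow> ('a \<Rightarrow> 'a) set" where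
  "generated_vN_algebra H X = \<Inter>{M. von_neumann_algebra H M \<and> X \<subseteq> M}"

definition star_auto :: "'a cspace \<Rightarrow> ('a \<Rightarrow> 'a) set \<Rightarrow> (('a \<Rightarrow> 'a) \<Rightarrow> 'a \<Rightarrow> 'a) set" where
  "star_auto H A = {\<beta> \<in> Bij A.
     (\<forall>S\<in>A. \<forall>T\<in>A. \<beta> (add_op H S T) = add_op H (\<beta> S) (\<beta> T)) \<and>
     (\<forall>S\<in>A. \<forall>T\<in>A. \<beta> (mult_op H S T) = mult_op H (\<beta> S) (\<beta> T)) \<and>
     (\<forall>c. \<forall>T\<in>A. \<beta> (scale_op H c T) = scale_op H c (\<beta> T)) \<and>
     (\<forall>T\<in>A. \<beta> (adj_op H T) = adj_op H (\<beta> T))}"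

definition star_AutoGroup ::
  "'a cspace \<Rightarrow> ('a \<Rightarrow> 'a) set \<Rightarrow> (('a \<Rightarrow> 'a) \<Rightarrow> 'a \<Rightarrow> 'a) monoid" where
  "star_AutoGroup H A = BijGroup A \<lparr>carrier := star_auto H A\<rparr>"

definition algebra_action ::
  "('g, 'm) monoid_scheme \<Rightarrow> 'a cspace \<Rightarrow> ('a \<Rightarrow> 'a) set \<Rightarrow> ('g \<Rightarrow> ('a \<Rightarrow> 'a) \<Rightarrow> 'a \<Rightarrow> 'a) \<Rightarrow> bool"
  where "algebra_action G H A \<alpha> \<longleftrightarrow> \<alpha> \<in> hom G (star_AutoGroup H A)"


section \<open>Completions\<close>

text \<open>
  The (Hausdorff) completion of a space with a positive semidefinite form: Cauchy sequences modulo
  sequences at distance tending to zero. Vectors of seminorm zero are identified with zero.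
\<close>

definition null_rel :: "'a cspace \<Rightarrow> ((nat \<Rightarrow> 'a) \<times> (nat \<Rightarrow> 'a)) set" where
  "null_rel P = {(s, t). s \<in> cauchy_seqs P \<and> t \<in> cauchy_seqs P \<and>
     (\<lambda>k. vdist P (s k) (t k)) \<longlonglongrightarrow> 0}"

definition completion :: "'a cspace \<Rightarrow> (nat \<Rightarrow> 'a) set cspace" where
  "completion P =
    \<lparr>carrier = cauchy_seqs P // null_rel P,
     vadd = \<lambda>A B. \<Union>s\<in>A. \<Union>t\<in>B. null_rel P `` {\<lambda>k. vadd P (s k) (t k)},
     vzero = null_rel P `` {\<lambda>_. vzero P},
     vscale = \<lambda>c A. \<Union>s\<in>A. null_rel P `` {\<lambda>k. vscale P c (s k)},
     vinner = \<lambda>A B. THE z. \<forall>s\<in>A. \<forall>t\<in>B. (\<lambda>k. vinner P (s k) (t k)) \<longlonglongrightarrow> z\<rparr>"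

definition to_completion :: "'a cspace \<Rightarrow> 'a \<Rightarrow> (nat \<Rightarrow> 'a) set" where
  "to_completion P x = null_rel P `` {\<lambda>_. x}"


section \<open>Finite tensor products\<close>

text \<open>
  The free complex vector space on a set \<open>X\<close> (finitely supported functions on \<open>X\<close>) with the
  sesquilinear form that extends a kernel \<open>\<kappa>\<close> on \<open>X\<close>.
\<close>

definition free_space :: "'b set \<Rightarrow> ('b \<Rightarrow> 'b \<Rightarrow> complex) \<Rightarrow> ('b \<Rightarrow> complex) cspace" where
  "free_space X \<kappa> =
    \<lparr>carrier = {c. finite {x. c x \<noteq> 0} \<and> {x. c x \<noteq> 0} \<subseteq> X},
     vadd = \<lambda>c d x. c x + d x,
     vzero = \<lambda>_. 0,
     vscale = \<lambda>a c x. a * c x,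
     vinner = \<lambda>c d. \<Sum>x | c x \<noteq> 0. \<Sum>y | d y \<noteq> 0. c x * cnj (d y) * \<kappa> x y\<rparr>"

text \<open>
  The Hilbert space tensor product of \<open>H 0, \<dots>, H n\<close>. The form
  \<open>\<Prod>i\<le>n. \<langle>x i, y i\<rangle>\<close> on the free vector space on \<open>H 0 \<times> \<dots> \<times> H n\<close>
  vanishes exactly on the span of the multilinearity relations, so its Hausdorff completion is the
  completion of the algebraic tensor product.
\<close>

type_synonym 'a tensor = "(nat \<Rightarrow> (nat \<Rightarrow> 'a) \<Rightarrow> complex) set"

definition tuples :: "(nat \<Rightarrow> 'a cspace) \<Rightarrow> nat \<Rightarrow> (nat \<Rightarrow> 'a) set" where
  "tuples H n = (\<Pi>\<^sub>E i\<in>{..n}. carrier (H i))"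

definition free_tensor :: "(nat \<Rightarrow> 'a cspace) \<Rightarrow> nat \<Rightarrow> ((nat \<Rightarrow> 'a) \<Rightarrow> complex) cspace" where
  "free_tensor H n = free_space (tuples H n) (\<lambda>x y. \<Prod>i\<le>n. vinner (H i) (x i) (y i))"

definition fin_tensor :: "(nat \<Rightarrow> 'a cspace) \<Rightarrow> nat \<Rightarrow> 'a tensor cspace" where
  "fin_tensor H n = completion (free_tensor H n)"

definition elem_tensor :: "(nat \<Rightarrow> 'a cspace) \<Rightarrow> nat \<Rightarrow> (nat \<Rightarrow> 'a) \<Rightarrow> 'a tensor" where
  "elem_tensor H n x = to_completion (free_tensor H n) (\<lambda>y. if y = x then 1 else 0)"

text \<open>The operator \<open>\<psi> \<mapsto> \<psi> \<otimes> v\<close> for \<open>v \<in> H (n + 1)\<close>.\<close>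

definition tensor_right ::
  "(nat \<Rightarrow> 'a cspace) \<Rightarrow> nat \<Rightarrow> 'a \<Rightarrow> 'a tensor \<Rightarrow> 'a tensor" where
  "tensor_right H n v = (THE V. V \<in> bounded_ops (fin_tensor H n) (fin_tensor H (Suc n)) \<and>
     (\<forall>x\<in>tuples H n. V (elem_tensor H n x) = elem_tensor H (Suc n) (x(Suc n := v))))"


section \<open>Inductive limits\<close>

text \<open>
  The inductive limit of a sequence of inner product spaces \<open>T n\<close> under isometries
  \<open>V n : T n \<rightarrow> T (n + 1)\<close>: the disjoint union modulo eventual equality.
\<close>

definition connecting :: "(nat \<Rightarrow> 'b \<Rightarrow> 'b) \<Rightarrow> nat \<Rightarrow> nat \<Rightarrow> 'b \<Rightarrow> 'b" where
  "connecting V n m = fold V [n..<m]"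

definition ind_lim_rel ::
  "(nat \<Rightarrow> 'b cspace) \<Rightarrow> (nat \<Rightarrow> 'b \<Rightarrow> 'b) \<Rightarrow> ((nat \<times> 'b) \<times> (nat \<times> 'b)) set" where
  "ind_lim_rel T V = {((n, \<psi>), (m, \<xi>)). \<psi> \<in> carrier (T n) \<and> \<xi> \<in> carrier (T m) \<and>
     (\<exists>N\<ge>max n m. connecting V n N \<psi> = connecting V m N \<xi>)}"

definition ind_lim :: "(nat \<Rightarrow> 'b cspace) \<Rightarrow> (nat \<Rightarrow> 'b \<Rightarrow> 'b) \<Rightarrow> (nat \<times> 'b) set cspace" where
  "ind_lim T V =
    \<lparr>carrier = (SIGMA n:UNIV. carrier (T n)) // ind_lim_rel T V,
     vadd = \<lambda>A B. \<Union>(n, \<psi>)\<in>A. \<Union>(m, \<xi>)\<in>B. ind_lim_rel T V ``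
       {(max n m, vadd (T (max n m)) (connecting V n (max n m) \<psi>) (connecting V m (max n m) \<xi>))},
     vzero = ind_lim_rel T V `` {(0, vzero (T 0))},
     vscale = \<lambda>c A. \<Union>(n, \<psi>)\<in>A. ind_lim_rel T V `` {(n, vscale (T n) c \<psi>)},
     vinner = \<lambda>A B. THE z. \<forall>(n, \<psi>)\<in>A. \<forall>(m, \<xi>)\<in>B.
       vinner (T (max n m)) (connecting V n (max n m) \<psi>) (connecting V m (max n m) \<xi>) = z\<rparr>"


section \<open>Infinite tensor products\<close>

type_synonym 'a inf_tensor = "(nat \<Rightarrow> (nat \<times> 'a tensor) set) set"

definition pre_tensor ::
  "(nat \<Rightarrow> 'a cspace) \<Rightarrow> (nat \<Rightarrow> 'a) \<Rightarrow> (nat \<times> 'a tensor) set cspace" where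
  "pre_tensor H \<phi> = ind_lim (fin_tensor H) (\<lambda>n. tensor_right H n (\<phi> (Suc n)))"

definition inf_tensor ::
  "(nat \<Rightarrow> 'a cspace) \<Rightarrow> (nat \<Rightarrow> 'a) \<Rightarrow> 'a inf_tensor cspace" where
  "inf_tensor H \<phi> = completion (pre_tensor H \<phi>)"

definition fin_to_inf ::
  "(nat \<Rightarrow> 'a cspace) \<Rightarrow> (nat \<Rightarrow> 'a) \<Rightarrow> nat \<Rightarrow> 'a tensor \<Rightarrow> 'a inf_tensor" where
  "fin_to_inf H \<phi> n \<psi> = to_completion (pre_tensor H \<phi>)
     (ind_lim_rel (fin_tensor H) (\<lambda>n. tensor_right H n (\<phi> (Suc n))) `` {(n, \<psi>)})"

text \<open>Infinite elementary tensors \<open>\<Otimes>i. x i\<close>, where \<open>x i = \<phi> i\<close> for almost all \<open>i\<close>.\<close>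

definition elem_seqs :: "(nat \<Rightarrow> 'a cspace) \<Rightarrow> (nat \<Rightarrow> 'a) \<Rightarrow> (nat \<Rightarrow> 'a) set" where
  "elem_seqs H \<phi> = {x. (\<forall>i. x i \<in> carrier (H i)) \<and> finite {i. x i \<noteq> \<phi> i}}"

definition elem_inf_tensor ::
  "(nat \<Rightarrow> 'a cspace) \<Rightarrow> (nat \<Rightarrow> 'a) \<Rightarrow> (nat \<Rightarrow> 'a) \<Rightarrow> 'a inf_tensor" where
  "elem_inf_tensor H \<phi> x =
     (let n = (LEAST n. \<forall>i>n. x i = \<phi> i)
      in fin_to_inf H \<phi> n (elem_tensor H n (restrict x {..n})))"

text \<open>
  The operator \<open>(\<Otimes>i\<in>J. S i) \<otimes> (\<Otimes>i\<notin>J. I)\<close> for a finite set \<open>J\<close>.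
\<close>

definition tensor_op ::
  "(nat \<Rightarrow> 'a cspace) \<Rightarrow> (nat \<Rightarrow> 'a) \<Rightarrow> nat set \<Rightarrow> (nat \<Rightarrow> 'a \<Rightarrow> 'a) \<Rightarrow> 'a inf_tensor \<Rightarrow> 'a inf_tensor"
  where "tensor_op H \<phi> J S = (THE T. T \<in> B_of (inf_tensor H \<phi>) \<and>
     (\<forall>x\<in>elem_seqs H \<phi>. T (elem_inf_tensor H \<phi> x) =
        elem_inf_tensor H \<phi> (\<lambda>i. if i \<in> J then S i (x i) else x i)))"

definition tensor_ops ::
  "(nat \<Rightarrow> 'a cspace) \<Rightarrow> (nat \<Rightarrow> 'a) \<Rightarrow> (nat \<Rightarrow> ('a \<Rightarrow> 'a) set) \<Rightarrow> ('a inf_tensor \<Rightarrow> 'a inf_tensor) set"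
  where "tensor_ops H \<phi> M = {tensor_op H \<phi> J S |J S. finite J \<and> (\<forall>i\<in>J. S i \<in> M i)}"

definition alg_tensor ::
  "(nat \<Rightarrow> 'a cspace) \<Rightarrow> (nat \<Rightarrow> 'a) \<Rightarrow> (nat \<Rightarrow> ('a \<Rightarrow> 'a) set) \<Rightarrow> ('a inf_tensor \<Rightarrow> 'a inf_tensor) set"
  where "alg_tensor H \<phi> M = generated_star_algebra (inf_tensor H \<phi>) (tensor_ops H \<phi> M)"

definition vN_tensor ::
  "(nat \<Rightarrow> 'a cspace) \<Rightarrow> (nat \<Rightarrow> 'a) \<Rightarrow> (nat \<Rightarrow> ('a \<Rightarrow> 'a) set) \<Rightarrow> ('a inf_tensor \<Rightarrow> 'a inf_tensor) set"
  where "vN_tensor H \<phi> M = generated_vN_algebra (inf_tensor H \<phi>) (tensor_ops H \<phi> M)"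

definition alg_tensor_action ::
  "(nat \<Rightarrow> 'a cspace) \<Rightarrow> (nat \<Rightarrow> 'a) \<Rightarrow> (nat \<Rightarrow> ('a \<Rightarrow> 'a) set) \<Rightarrow>
   (nat \<Rightarrow> 'g \<Rightarrow> ('a \<Rightarrow> 'a) \<Rightarrow> 'a \<Rightarrow> 'a) \<Rightarrow>
   'g \<Rightarrow> ('a inf_tensor \<Rightarrow> 'a inf_tensor) \<Rightarrow> 'a inf_tensor \<Rightarrow> 'a inf_tensor" where
  "alg_tensor_action H \<phi> M \<alpha> g =
     (THE \<beta>. \<beta> \<in> star_auto (inf_tensor H \<phi>) (alg_tensor H \<phi> M) \<and>
        (\<forall>J S. finite J \<and> (\<forall>i\<in>J. S i \<in> M i) \<longrightarrow>
           \<beta> (tensor_op H \<phi> J S) = tensor_op H \<phi> J (\<lambda>i. \<alpha> i g (S i))))"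

definition extends_tensor_action ::
  "('g, 'm) monoid_scheme \<Rightarrow> (nat \<Rightarrow> 'a cspace) \<Rightarrow> (nat \<Rightarrow> 'a) \<Rightarrow> (nat \<Rightarrow> ('a \<Rightarrow> 'a) set) \<Rightarrow>
   (nat \<Rightarrow> 'g \<Rightarrow> ('a \<Rightarrow> 'a) \<Rightarrow> 'a \<Rightarrow> 'a) \<Rightarrow>
   ('g \<Rightarrow> ('a inf_tensor \<Rightarrow> 'a inf_tensor) \<Rightarrow> 'a inf_tensor \<Rightarrow> 'a inf_tensor) \<Rightarrow> bool" where
  "extends_tensor_action G H \<phi> M \<alpha> \<gamma> \<longleftrightarrow>
     algebra_action G (inf_tensor H \<phi>) (vN_tensor H \<phi> M) \<gamma> \<and>
     (\<forall>g\<in>carrier G. \<forall>T\<in>alg_tensor H \<phi> M. \<gamma> g T = alg_tensor_action H \<phi> M \<alpha> g T)"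

end

theory Submission
  imports Defs
begin

text \<open>
  Let \<open>K\<close> be the infinite tensor product and \<open>\<Omega> = \<Otimes>i. \<phi> i\<close>. Only scalars commute with all elementary
  tensor operators, because on elementary tensors the products of the projections onto
  \<open>\<phi> 0, \<dots>, \<phi> n\<close> are eventually the projection onto \<open>\<Omega>\<close>; so the von Neumann algebra is all of
  \<open>B(K)\<close>. Every automorphism of \<open>B(K)\<close> is implemented by a unitary, and two automorphisms that agree
  on the elementary tensor operators have implementing unitaries that differ by a scalar. This gives
  uniqueness. If \<open>Ad W\<close> extends the product action of \<open>g\<close>, then \<open>W \<Omega>\<close> is fixed by the projections onto
  the vectors \<open>U i g (\<phi> i)\<close>, and pairing \<open>W \<Omega>\<close> with an elementary tensor keeps the products of the
  overlaps \<open>\<bar>\<langle>U i g (\<phi> i), \<phi> i\<rangle>\<bar>\<close> away from zero. Conversely, if the overlaps are summably close to 1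
  then, up to phases, the unitaries \<open>U 0 g \<otimes> \<dots> \<otimes> U n g \<otimes> I\<close> converge strongly to a unitary that
  implements the extension. Positivity of the tensor product form and boundedness of \<open>T \<otimes> I\<close> both
  come from the Schur product theorem for positive semidefinite kernels.
\<close>

section \<open>Spaces with a positive semidefinite form\<close>

text \<open>Elementary tensors span densely but are linearly dependent, so an operator on
  \<open>K\<close> cannot be prescribed on them freely: consistency is an inequality between the
  norms of all linear combinations. In terms of Gram kernels, such an inequality says that a
  difference of two kernels is positive semidefinite, and this is where products of kernels come in.

  The action determines each \<open>U i g\<close> only up to a phase, so the infinite product of the
  \<open>U i g\<close> need not converge and \<open>g\<close> to \<open>U i g\<close> need not be a
  representation. Hence the absolute value in the criterion, the change of phases before the limit,
  and a group law for the extension that is derived from uniqueness of automorphisms and not from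
  the implementing unitaries.

  The criterion is the classical one for infinite products: if \<open>0 <= a i <= 1\<close>, the sum
  of the \<open>1 - a i\<close> converges exactly if the products over some tail stay away from
  zero; finitely many zero overlaps are harmless. No continuity is asked of the extension:
  automorphisms of \<open>B(K)\<close> are spatial in any case, and therefore agreement on
  generators decides.\<close>

abbreviation vminus :: "'a cspace \<Rightarrow> 'a \<Rightarrow> 'a \<Rightarrow> 'a" where
  "vminus H x y \<equiv> vadd H x (vscale H (-1) y)"

definition vlim :: "'a cspace \<Rightarrow> (nat \<Rightarrow> 'a) \<Rightarrow> 'a \<Rightarrow> bool" where
  "vlim H s x \<longleftrightarrow> (\<lambda>k. vdist H (s k) x) \<longlonglongrightarrow> 0"

text \<open>Lists of weighted indices, with repetitions allowed: a sum is then a concatenation and a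
  multiple is a map, and no independence of the vectors has to be tracked.\<close>

primrec lincomb :: "'a cspace \<Rightarrow> ('i \<Rightarrow> 'a) \<Rightarrow> (complex \<times> 'i) list \<Rightarrow> 'a" where
  "lincomb H e [] = vzero H"
| "lincomb H e (p # l) = vadd H (vscale H (fst p) (e (snd p))) (lincomb H e l)"

text \<open>The linear span of the family is dense, not the family itself; the usual name is a total
  family.\<close>

definition vdense :: "'a cspace \<Rightarrow> ('i \<Rightarrow> 'a) \<Rightarrow> 'i set \<Rightarrow> bool" where
  "vdense H e X \<longleftrightarrow> (\<forall>v\<in>carrier H. \<forall>\<epsilon>>0. \<exists>l. snd ` set l \<subseteq> X \<and> vdist H v (lincomb H e l) < \<epsilon>)"

text \<open>Definiteness is left out because the free space on tuples has many null vectors; the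
  completion divides them out.\<close>

locale semi_inner_product_space =
  fixes H :: "'a cspace"
  assumes add_closed [simp]: "x \<in> carrier H \<Longrightarrow> y \<in> carrier H \<Longrightarrow> vadd H x y \<in> carrier H"
    and zero_closed [simp]: "vzero H \<in> carrier H"
    and scale_closed [simp]: "x \<in> carrier H \<Longrightarrow> vscale H c x \<in> carrier H"
    and add_assoc: "x \<in> carrier H \<Longrightarrow> y \<in> carrier H \<Longrightarrow> z \<in> carrier H \<Longrightarrow>
      vadd H (vadd H x y) z = vadd H x (vadd H y z)"
    and add_commute: "x \<in> carrier H \<Longrightarrow> y \<in> carrier H \<Longrightarrow> vadd H x y = vadd H y x"
    and add_zero [simp]: "x \<in> carrier H \<Longrightarrow> vadd H x (vzero H) = x"
    and add_uminus [simp]: "x \<in> carrier H \<Longrightarrow> vadd H x (vscale H (-1) x) = vzero H"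
    and scale_one [simp]: "x \<in> carrier H \<Longrightarrow> vscale H 1 x = x"
    and scale_scale [simp]: "x \<in> carrier H \<Longrightarrow> vscale H a (vscale H b x) = vscale H (a * b) x"
    and scale_add_right: "x \<in> carrier H \<Longrightarrow> y \<in> carrier H \<Longrightarrow>
      vscale H a (vadd H x y) = vadd H (vscale H a x) (vscale H a y)"
    and scale_add_left: "x \<in> carrier H \<Longrightarrow>
      vscale H (a + b) x = vadd H (vscale H a x) (vscale H b x)"
    and inner_add: "x \<in> carrier H \<Longrightarrow> y \<in> carrier H \<Longrightarrow> z \<in> carrier H \<Longrightarrow>
      vinner H (vadd H x y) z = vinner H x z + vinner H y z"
    and inner_scale: "x \<in> carrier H \<Longrightarrow> y \<in> carrier H \<Longrightarrow>
      vinner H (vscale H a x) y = a * vinner H x y"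
    and inner_cnj: "x \<in> carrier H \<Longrightarrow> y \<in> carrier H \<Longrightarrow> vinner H y x = cnj (vinner H x y)"
    and inner_nonneg: "x \<in> carrier H \<Longrightarrow> 0 \<le> Re (vinner H x x)"

sublocale inner_product_space \<subseteq> semi_inner_product_space
  by unfold_locales
    (fact add_closed zero_closed scale_closed add_assoc add_commute add_zero add_uminus scale_one
      scale_scale scale_add_right scale_add_left inner_add inner_scale inner_cnj inner_nonneg)+

context semi_inner_product_space
begin

section \<open>Vector arithmetic with a semidefinite form\<close>

lemma inner_add_right:
  assumes "x \<in> carrier H" "y \<in> carrier H" "z \<in> carrier H"
  shows "vinner H x (vadd H y z) = vinner H x y + vinner H x z"
  using assms inner_cnj[of "vadd H y z" x] inner_cnj[of y x] inner_cnj[of z x]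
  by (simp add: inner_add)

lemma inner_scale_right:
  assumes "x \<in> carrier H" "y \<in> carrier H"
  shows "vinner H x (vscale H a y) = cnj a * vinner H x y"
  using assms inner_cnj[of "vscale H a y" x] inner_cnj[of y x]
  by (simp add: inner_scale)

lemmas inner_simps = inner_add inner_add_right inner_scale inner_scale_right

lemma scale_zero [simp]: "x \<in> carrier H \<Longrightarrow> vscale H 0 x = vzero H"
  using scale_add_left[of x 1 "-1"] by simp

lemma scale_vzero [simp]: "vscale H c (vzero H) = vzero H"
  using scale_scale[of "vzero H" c 0] by simp

lemma zero_add [simp]: "x \<in> carrier H \<Longrightarrow> vadd H (vzero H) x = x"
  using add_commute[of x "vzero H"] by simp

lemma inner_zero [simp]: "x \<in> carrier H \<Longrightarrow> vinner H (vzero H) x = 0"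
  using inner_scale[of x x 0] by simp

lemma inner_zero_right [simp]: "x \<in> carrier H \<Longrightarrow> vinner H x (vzero H) = 0"
  using inner_scale_right[of x x 0] by simp

lemma add_left_commute:
  assumes "x \<in> carrier H" "y \<in> carrier H" "z \<in> carrier H"
  shows "vadd H x (vadd H y z) = vadd H y (vadd H x z)"
  by (metis add_assoc add_commute assms)

lemmas add_ac = add_assoc add_commute add_left_commute

lemma uminus_add [simp]: "x \<in> carrier H \<Longrightarrow> vadd H (vscale H (-1) x) x = vzero H"
  using add_commute[of x "vscale H (-1) x"] by simp

lemma add_uminus_cancel [simp]:
  assumes "x \<in> carrier H" "y \<in> carrier H"
  shows "vadd H (vscale H (-1) x) (vadd H x y) = y" "vadd H x (vadd H (vscale H (-1) x) y) = y"
  using assms by (simp_all flip: add_assoc)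

lemma add_uminus_cancel_right:
  assumes "x \<in> carrier H" "y \<in> carrier H"
  shows "vminus H (vadd H x y) y = x" "vadd H (vminus H x y) y = x"
  using assms by (simp_all add: add_assoc)

section \<open>Norm, distance and the Cauchy-Schwarz inequality\<close>

lemma inner_self: "x \<in> carrier H \<Longrightarrow> vinner H x x = complex_of_real ((vnorm H x)\<^sup>2)"
  using inner_cnj[of x x] inner_nonneg[of x]
  by (auto simp: vnorm_def complex_eq_iff)

lemma vnorm_sq: "x \<in> carrier H \<Longrightarrow> (vnorm H x)\<^sup>2 = Re (vinner H x x)"
  using inner_nonneg[of x] by (simp add: vnorm_def)

lemma vnorm_nonneg [simp]: "x \<in> carrier H \<Longrightarrow> 0 \<le> vnorm H x"
  using inner_nonneg[of x] by (simp add: vnorm_def)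

lemma vnorm_zero [simp]: "vnorm H (vzero H) = 0"
  by (simp add: vnorm_def)

lemma vnorm_scale [simp]: "x \<in> carrier H \<Longrightarrow> vnorm H (vscale H a x) = cmod a * vnorm H x"
proof -
  assume x: "x \<in> carrier H"
  then have "vinner H (vscale H a x) (vscale H a x) = (a * cnj a) * vinner H x x"
    by (simp add: inner_scale inner_scale_right)
  also have "\<dots> = complex_of_real ((cmod a * vnorm H x)\<^sup>2)"
    unfolding inner_self[OF x] complex_norm_square[symmetric] power_mult_distrib by simp
  finally have "(vnorm H (vscale H a x))\<^sup>2 = (cmod a * vnorm H x)\<^sup>2"
    using x by (metis Re_complex_of_real scale_closed vnorm_sq)
  then show ?thesis by (rule power2_eq_imp_eq) (use x in simp_all)
qed

lemma vnorm_add_sq: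
  assumes "x \<in> carrier H" "y \<in> carrier H"
  shows "(vnorm H (vadd H x y))\<^sup>2 = (vnorm H x)\<^sup>2 + (vnorm H y)\<^sup>2 + 2 * Re (vinner H x y)"
  using assms inner_cnj[of x y] by (simp add: vnorm_sq inner_simps)

lemma vdist_sq:
  assumes "x \<in> carrier H" "y \<in> carrier H"
  shows "(vdist H x y)\<^sup>2 = (vnorm H x)\<^sup>2 + (vnorm H y)\<^sup>2 - 2 * Re (vinner H x y)"
  using assms by (simp add: vdist_def vnorm_add_sq inner_simps)

text \<open>The squared norm of \<open>x - s z y\<close>, where \<open>z = vinner H x y\<close>, is
  a nonnegative quadratic polynomial in the real number \<open>s\<close>, and its minimum at
  \<open>s = 1 / Y\<close> gives the bound. If \<open>y\<close> is a null vector, the polynomial is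
  affine and its slope must vanish.\<close>

lemma Cauchy_Schwarz:
  assumes x: "x \<in> carrier H" and y: "y \<in> carrier H"
  shows "cmod (vinner H x y) \<le> vnorm H x * vnorm H y"
proof -
  define z where "z = vinner H x y"
  define X where "X = (vnorm H x)\<^sup>2"
  define Y where "Y = (vnorm H y)\<^sup>2"
  have XY: "X \<ge> 0" "Y \<ge> 0" by (simp_all add: X_def Y_def)
  have *: "0 \<le> X - 2 * s * (cmod z)\<^sup>2 + s\<^sup>2 * (cmod z)\<^sup>2 * Y" for s :: real
  proof -
    have "0 \<le> (vnorm H (vadd H x (vscale H (- complex_of_real s * z) y)))\<^sup>2" by simp
    also have "\<dots> = X + (cmod (complex_of_real s * z))\<^sup>2 * Y - 2 * Re (complex_of_real s * (cnj z * z))"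
      using x y by (simp add: vnorm_add_sq inner_simps X_def Y_def power_mult_distrib mult.assoc
          flip: z_def)
    also have "cnj z * z = complex_of_real ((cmod z)\<^sup>2)"
      using complex_norm_square[of z] by (simp add: mult.commute)
    finally show ?thesis
      by (simp add: norm_mult power_mult_distrib algebra_simps del: of_real_power)
  qed
  have "(cmod z)\<^sup>2 \<le> X * Y"
  proof (cases "Y = 0")
    case True
    show ?thesis
    proof (rule ccontr)
      assume "\<not> ?thesis"
      then have "z \<noteq> 0" using XY True by auto
      \<comment> \<open>This \<open>s\<close> makes the affine function take the value -1.\<close>
      then show False using *[of "(X + 1) / (2 * (cmod z)\<^sup>2)"] True XY by (simp add: field_simps)
    qed
  next
    case False
    then show ?thesis using *[of "1 / Y"] XY by (simp add: field_simps power2_eq_square)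
  qed
  then have "(cmod z)\<^sup>2 \<le> (vnorm H x * vnorm H y)\<^sup>2"
    by (simp add: X_def Y_def power_mult_distrib)
  then show ?thesis
    unfolding z_def by (rule power2_le_imp_le) (use x y in simp_all)
qed

lemma vnorm_triangle:
  assumes "x \<in> carrier H" "y \<in> carrier H"
  shows "vnorm H (vadd H x y) \<le> vnorm H x + vnorm H y"
proof (rule power2_le_imp_le)
  have "Re (vinner H x y) \<le> vnorm H x * vnorm H y"
    using Cauchy_Schwarz[OF assms] complex_Re_le_cmod order_trans by blast
  then show "(vnorm H (vadd H x y))\<^sup>2 \<le> (vnorm H x + vnorm H y)\<^sup>2"
    using assms by (simp add: vnorm_add_sq power2_sum)
qed (use assms in simp)

lemma vdist_nonneg [simp]: "x \<in> carrier H \<Longrightarrow> y \<in> carrier H \<Longrightarrow> 0 \<le> vdist H x y"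
  by (simp add: vdist_def)

lemma vdist_self [simp]: "x \<in> carrier H \<Longrightarrow> vdist H x x = 0"
  by (simp add: vdist_def)

lemma vdist_commute: "x \<in> carrier H \<Longrightarrow> y \<in> carrier H \<Longrightarrow> vdist H x y = vdist H y x"
  by (rule power2_eq_imp_eq) (use inner_cnj[of x y] in \<open>simp_all add: vdist_sq\<close>)

lemma vdist_triangle:
  assumes "x \<in> carrier H" "y \<in> carrier H" "z \<in> carrier H"
  shows "vdist H x z \<le> vdist H x y + vdist H y z"
proof -
  have "vminus H x z = vadd H (vminus H x y) (vminus H y z)"
    using assms by (simp add: add_assoc)
  then show ?thesis using assms vnorm_triangle[of "vminus H x y" "vminus H y z"]
    by (simp add: vdist_def)
qed

lemma vdist_add:
  assumes "x \<in> carrier H" "y \<in> carrier H" "x' \<in> carrier H" "y' \<in> carrier H"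
  shows "vdist H (vadd H x y) (vadd H x' y') \<le> vdist H x x' + vdist H y y'"
proof -
  have "vminus H (vadd H x y) (vadd H x' y') = vadd H (vminus H x x') (vminus H y y')"
    using assms by (simp add: scale_add_right add_ac)
  then show ?thesis using assms vnorm_triangle[of "vminus H x x'" "vminus H y y'"]
    by (simp add: vdist_def)
qed

lemma vdist_scale:
  assumes "x \<in> carrier H" "y \<in> carrier H"
  shows "vdist H (vscale H c x) (vscale H c y) = cmod c * vdist H x y"
proof -
  have "vminus H (vscale H c x) (vscale H c y) = vscale H c (vminus H x y)"
    using assms by (simp add: scale_add_right)
  then show ?thesis using assms by (simp add: vdist_def)
qed

lemma vdist_zero [simp]: "x \<in> carrier H \<Longrightarrow> vdist H x (vzero H) = vnorm H x"
  by (simp add: vdist_def)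

lemma vnorm_diff_le:
  assumes "x \<in> carrier H" "y \<in> carrier H"
  shows "\<bar>vnorm H x - vnorm H y\<bar> \<le> vdist H x y"
  using vdist_triangle[of x y "vzero H"] vdist_triangle[of y x "vzero H"] assms
  by (simp add: vdist_commute[of y x] abs_le_iff)

lemma inner_diff_le:
  assumes "x \<in> carrier H" "y \<in> carrier H" "x' \<in> carrier H" "y' \<in> carrier H"
  shows "cmod (vinner H x y - vinner H x' y') \<le> vdist H x x' * vnorm H y + vnorm H x' * vdist H y y'"
proof -
  have "vinner H x y - vinner H x' y' = vinner H (vminus H x x') y + vinner H x' (vminus H y y')"
    using assms by (simp add: inner_simps)
  also have "cmod \<dots> \<le> cmod (vinner H (vminus H x x') y) + cmod (vinner H x' (vminus H y y'))"
    by (rule norm_triangle_ineq)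
  finally show ?thesis
    using assms Cauchy_Schwarz[of "vminus H x x'" y] Cauchy_Schwarz[of x' "vminus H y y'"]
    by (simp add: vdist_def)
qed

section \<open>Convergence in norm and Cauchy sequences\<close>

lemma vlim_const [simp]: "x \<in> carrier H \<Longrightarrow> vlim H (\<lambda>_. x) x"
  by (simp add: vlim_def)

lemma vlim_vdist:
  assumes "vlim H s x" "vlim H t y"
    and s: "\<And>k. s k \<in> carrier H" and t: "\<And>k. t k \<in> carrier H"
    and xy: "x \<in> carrier H" "y \<in> carrier H"
  shows "(\<lambda>k. vdist H (s k) (t k)) \<longlonglongrightarrow> vdist H x y"
proof (rule LIMSEQ_I)
  fix r :: real assume "r > 0"
  have "(\<lambda>k. vdist H (s k) x + vdist H (t k) y) \<longlonglongrightarrow> 0 + 0"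
    using assms unfolding vlim_def by (intro tendsto_add)
  from LIMSEQ_D[OF this \<open>r > 0\<close>] obtain N
    where N: "vdist H (s k) x + vdist H (t k) y < r" if "k \<ge> N" for k
    by force
  have "\<bar>vdist H (s k) (t k) - vdist H x y\<bar> \<le> vdist H (s k) x + vdist H (t k) y" for k
    using vdist_triangle[of "s k" x "t k"] vdist_triangle[of x y "t k"]
      vdist_triangle[of x "s k" y] vdist_triangle[of "s k" "t k" y] s[of k] t[of k] xy
    by (simp add: vdist_commute[of x "s k"] vdist_commute[of y "t k"])
  then show "\<exists>N. \<forall>k\<ge>N. norm (vdist H (s k) (t k) - vdist H x y) < r"
    using N by (metis le_less_trans real_norm_def)
qed

lemma vlim_inner:
  assumes "vlim H s x" "vlim H t y"
    and s: "\<And>k. s k \<in> carrier H" and t: "\<And>k. t k \<in> carrier H"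
    and xy: "x \<in> carrier H" "y \<in> carrier H"
  shows "(\<lambda>k. vinner H (s k) (t k)) \<longlonglongrightarrow> vinner H x y"
proof -
  have "(\<lambda>k. vdist H (s k) x * (vdist H (t k) y + vnorm H y) + vnorm H x * vdist H (t k) y) \<longlonglongrightarrow>
      0 * (0 + vnorm H y) + vnorm H x * 0"
    using assms unfolding vlim_def by (intro tendsto_intros)
  then have A: "(\<lambda>k. vdist H (s k) x * (vdist H (t k) y + vnorm H y) + vnorm H x * vdist H (t k) y)
      \<longlonglongrightarrow> 0" by simp
  have "cmod (vinner H (s k) (t k) - vinner H x y)
      \<le> vdist H (s k) x * (vdist H (t k) y + vnorm H y) + vnorm H x * vdist H (t k) y" for k
    using inner_diff_le[of "s k" "t k" x y] vnorm_diff_le[of "t k" y] s[of k] t[of k] xy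
      mult_left_mono[of "vnorm H (t k)" "vdist H (t k) y + vnorm H y" "vdist H (s k) x"]
    by (simp add: abs_le_iff)
  then have "(\<lambda>k. vinner H (s k) (t k) - vinner H x y) \<longlonglongrightarrow> 0"
    by (intro Lim_null_comparison[OF always_eventually A]) auto
  then show ?thesis by (simp add: LIM_zero_iff)
qed

lemma vlim_norm:
  assumes "vlim H s x" "\<And>k. s k \<in> carrier H" "x \<in> carrier H"
  shows "(\<lambda>k. vnorm H (s k)) \<longlonglongrightarrow> vnorm H x"
  using vlim_vdist[OF assms(1) vlim_const, of "vzero H"] assms by simp

lemma vlim_squeeze:
  assumes "\<And>k. vdist H (s k) x \<le> f k" "f \<longlonglongrightarrow> 0" "\<And>k. s k \<in> carrier H" "x \<in> carrier H"
  shows "vlim H s x"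
  unfolding vlim_def
  by (rule tendsto_sandwich[OF always_eventually always_eventually tendsto_const assms(2)])
    (use assms in auto)

lemma vlim_add:
  assumes "vlim H s x" "vlim H t y"
    and "\<And>k. s k \<in> carrier H" "\<And>k. t k \<in> carrier H" "x \<in> carrier H" "y \<in> carrier H"
  shows "vlim H (\<lambda>k. vadd H (s k) (t k)) (vadd H x y)"
proof (rule vlim_squeeze)
  show "(\<lambda>k. vdist H (s k) x + vdist H (t k) y) \<longlonglongrightarrow> 0"
    using tendsto_add[OF assms(1,2)[unfolded vlim_def]] by simp
qed (use assms in \<open>auto intro: vdist_add\<close>)

lemma vlim_scale:
  assumes "vlim H s x" "\<And>k. s k \<in> carrier H" "x \<in> carrier H"
  shows "vlim H (\<lambda>k. vscale H c (s k)) (vscale H c x)"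
  using tendsto_mult_right_zero[OF assms(1)[unfolded vlim_def], of "cmod c"] assms
  by (simp add: vlim_def vdist_scale)

lemma vlim_imp_cauchy:
  assumes "vlim H s x" "\<And>k. s k \<in> carrier H" "x \<in> carrier H"
  shows "s \<in> cauchy_seqs H"
  unfolding cauchy_seqs_def
proof (intro CollectI conjI allI impI)
  fix e :: real assume "e > 0"
  then obtain N where N: "vdist H (s k) x < e / 2" if "k \<ge> N" for k
    using LIMSEQ_D[OF assms(1)[unfolded vlim_def], of "e / 2"] by force
  have "vdist H (s m) (s n) < e" if "m \<ge> N" "n \<ge> N" for m n
    using N[OF that(1)] N[OF that(2)] vdist_triangle[of "s m" x "s n"] vdist_commute[of "s n" x] assms
    by simp
  then show "\<exists>N. \<forall>m\<ge>N. \<forall>n\<ge>N. vdist H (s m) (s n) < e" by blast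
qed (use assms in auto)

lemma cauchy_closed: "s \<in> cauchy_seqs H \<Longrightarrow> s k \<in> carrier H"
  by (simp add: cauchy_seqs_def)

lemma cauchyI:
  assumes "\<And>k. s k \<in> carrier H"
    and "\<And>e. e > 0 \<Longrightarrow> \<exists>N. \<forall>m\<ge>N. \<forall>n\<ge>m. vdist H (s m) (s n) < e"
  shows "s \<in> cauchy_seqs H"
  unfolding cauchy_seqs_def
proof (intro CollectI conjI allI impI)
  fix e :: real assume "e > 0"
  from assms(2)[OF this] obtain N where N: "\<forall>m\<ge>N. \<forall>n\<ge>m. vdist H (s m) (s n) < e" by blast
  have "vdist H (s m) (s n) < e" if "m \<ge> N" "n \<ge> N" for m n
    using N that vdist_commute[of "s m" "s n"] assms(1) by (metis nle_le)
  then show "\<exists>N. \<forall>m\<ge>N. \<forall>n\<ge>N. vdist H (s m) (s n) < e" by blast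
qed (use assms in auto)


subsection \<open>Linear combinations\<close>

lemma lincomb_closed [simp]:
  "(\<And>x. x \<in> X \<Longrightarrow> e x \<in> carrier H) \<Longrightarrow> snd ` set l \<subseteq> X \<Longrightarrow> lincomb H e l \<in> carrier H"
  by (induction l) auto

lemma lincomb_append:
  "(\<And>x. x \<in> X \<Longrightarrow> e x \<in> carrier H) \<Longrightarrow> snd ` set l \<subseteq> X \<Longrightarrow> snd ` set l' \<subseteq> X \<Longrightarrow>
   lincomb H e (l @ l') = vadd H (lincomb H e l) (lincomb H e l')"
proof (induction l)
  case (Cons p l)
  then show ?case by (simp add: add_assoc lincomb_closed[where X = X])
qed (simp add: lincomb_closed[where X = X])

lemma lincomb_scale:
  "(\<And>x. x \<in> X \<Longrightarrow> e x \<in> carrier H) \<Longrightarrow> snd ` set l \<subseteq> X \<Longrightarrow>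
   lincomb H e (map (\<lambda>(a, x). (c * a, x)) l) = vscale H c (lincomb H e l)"
proof (induction l)
  case (Cons p l)
  then show ?case
    by (simp add: scale_add_right lincomb_closed[where X = X] case_prod_unfold)
qed simp

lemma inner_lincomb_left:
  "(\<And>x. x \<in> X \<Longrightarrow> e x \<in> carrier H) \<Longrightarrow> snd ` set l \<subseteq> X \<Longrightarrow> v \<in> carrier H \<Longrightarrow>
   vinner H (lincomb H e l) v = (\<Sum>p\<leftarrow>l. fst p * vinner H (e (snd p)) v)"
  by (induction l) (auto simp: inner_simps lincomb_closed[where X = X])

lemma inner_lincomb_right:
  "(\<And>x. x \<in> X \<Longrightarrow> e x \<in> carrier H) \<Longrightarrow> snd ` set l \<subseteq> X \<Longrightarrow> v \<in> carrier H \<Longrightarrow>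
   vinner H v (lincomb H e l) = (\<Sum>p\<leftarrow>l. cnj (fst p) * vinner H v (e (snd p)))"
  by (induction l) (auto simp: inner_simps lincomb_closed[where X = X])

end


text \<open>The sesquilinear form that a kernel induces on formal linear combinations. For a Gram
  kernel it is the inner product of the actual combinations (\<open>inner_lincomb\<close>), so norm
  inequalities for all combinations become positivity statements about kernels.\<close>

definition kernel_form ::
  "('i \<Rightarrow> 'i \<Rightarrow> complex) \<Rightarrow> (complex \<times> 'i) list \<Rightarrow> (complex \<times> 'i) list \<Rightarrow> complex" where
  "kernel_form \<kappa> l l' = (\<Sum>p\<leftarrow>l. fst p * (\<Sum>q\<leftarrow>l'. cnj (fst q) * \<kappa> (snd p) (snd q)))"

lemma kernel_form_cong:
  assumes "\<And>x y. x \<in> snd ` set l \<Longrightarrow> y \<in> snd ` set l' \<Longrightarrow> \<kappa> x y = \<kappa>' x y"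
  shows "kernel_form \<kappa> l l' = kernel_form \<kappa>' l l'"
  unfolding kernel_form_def using assms
  by (intro arg_cong[where f = sum_list] map_cong refl arg_cong2[where f = "(*)"]) auto

lemma (in semi_inner_product_space) inner_lincomb:
  assumes "\<And>x. x \<in> X \<Longrightarrow> e x \<in> carrier H" "snd ` set l \<subseteq> X" "snd ` set l' \<subseteq> X"
  shows "vinner H (lincomb H e l) (lincomb H e l') = kernel_form (\<lambda>x y. vinner H (e x) (e y)) l l'"
proof -
  have "vinner H (lincomb H e l) (lincomb H e l')
      = (\<Sum>p\<leftarrow>l. fst p * vinner H (e (snd p)) (lincomb H e l'))"
    using assms by (intro inner_lincomb_left[where X = X] lincomb_closed[where X = X])
  also have "\<dots> = kernel_form (\<lambda>x y. vinner H (e x) (e y)) l l'"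
    unfolding kernel_form_def
    by (intro arg_cong[where f = sum_list] map_cong refl arg_cong2[where f = "(*)"]
        inner_lincomb_right[where X = X]) (use assms in auto)
  finally show ?thesis .
qed


section \<open>Hilbert spaces and bounded operators\<close>

context inner_product_space
begin

lemma vnorm_eq_0: "x \<in> carrier H \<Longrightarrow> vnorm H x = 0 \<Longrightarrow> x = vzero H"
  by (intro inner_definite) (simp_all add: inner_self)

lemma vdist_eq_0: "x \<in> carrier H \<Longrightarrow> y \<in> carrier H \<Longrightarrow> vdist H x y = 0 \<Longrightarrow> x = y"
  using vnorm_eq_0[of "vminus H x y"] add_uminus_cancel_right(2)[of x y] by (simp add: vdist_def)

lemma inner_eqI:
  assumes x: "x \<in> carrier H" and y: "y \<in> carrier H"
    and eq: "\<And>z. z \<in> carrier H \<Longrightarrow> vinner H x z = vinner H y z"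
  shows "x = y"
proof (rule vdist_eq_0[OF x y])
  have "vinner H (vminus H x y) (vminus H x y) = 0"
    using eq[of "vminus H x y"] x y by (simp add: inner_add inner_scale)
  then show "vdist H x y = 0" by (simp add: vdist_def vnorm_def)
qed

lemma vlim_unique:
  assumes "vlim H s x" "vlim H s y" "\<And>k. s k \<in> carrier H" "x \<in> carrier H" "y \<in> carrier H"
  shows "x = y"
proof (rule vdist_eq_0)
  have "(\<lambda>k. vdist H (s k) (s k)) \<longlonglongrightarrow> vdist H x y" using assms by (intro vlim_vdist)
  then show "vdist H x y = 0" using assms LIMSEQ_unique tendsto_const by (simp add: LIMSEQ_const_iff)
qed (use assms in auto)

lemma vdense_seq:
  assumes "vdense H e X" "v \<in> carrier H" "\<And>x. x \<in> X \<Longrightarrow> e x \<in> carrier H"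
  obtains ls where "\<And>k. snd ` set (ls k) \<subseteq> X" "vlim H (\<lambda>k. lincomb H e (ls k)) v"
proof -
  have "\<forall>k. \<exists>l. snd ` set l \<subseteq> X \<and> vdist H v (lincomb H e l) < 1 / Suc k"
    using assms by (simp add: vdense_def)
  then obtain ls where ls: "\<And>k. snd ` set (ls k) \<subseteq> X" "\<And>k. vdist H v (lincomb H e (ls k)) < 1 / Suc k"
    by metis
  have *: "lincomb H e (ls k) \<in> carrier H" for k
    using ls assms(3) by (intro lincomb_closed[where X = X])
  have "vlim H (\<lambda>k. lincomb H e (ls k)) v"
    by (rule vlim_squeeze[OF _ LIMSEQ_Suc[OF lim_1_over_n]])
      (use assms ls * vdist_commute[OF assms(2) *] in \<open>auto intro: less_imp_le\<close>)
  then show thesis using ls(1) that by blast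
qed

lemma vdense_inner_eqI:
  assumes d: "vdense H e X" and e: "\<And>x. x \<in> X \<Longrightarrow> e x \<in> carrier H"
    and v: "v \<in> carrier H" and w: "w \<in> carrier H"
    and eq: "\<And>x. x \<in> X \<Longrightarrow> vinner H v (e x) = vinner H w (e x)"
  shows "v = w"
proof (rule inner_eqI[OF v w])
  fix z assume z: "z \<in> carrier H"
  obtain ls where ls: "\<And>k. snd ` set (ls k) \<subseteq> X" "vlim H (\<lambda>k. lincomb H e (ls k)) z"
    using vdense_seq[OF d z e] by blast
  have *: "lincomb H e (ls k) \<in> carrier H" for k
    using ls e by (intro lincomb_closed[where X = X])
  have "vinner H v (lincomb H e (ls k)) = vinner H w (lincomb H e (ls k))" for k
    using inner_lincomb_right[where X = X and e = e, OF e ls(1) v]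
      inner_lincomb_right[where X = X and e = e, OF e ls(1) w] eq[OF subsetD[OF ls(1)[of k]]]
    by (auto intro!: arg_cong[where f = sum_list] simp: image_iff) (metis snd_conv)
  then have "(\<lambda>k. vinner H w (lincomb H e (ls k))) \<longlonglongrightarrow> vinner H v z"
    using vlim_inner[OF vlim_const ls(2), of v] v z * by simp
  then show "vinner H v z = vinner H w z"
    using vlim_inner[OF vlim_const ls(2), of w] w z * LIMSEQ_unique by blast
qed

end

section \<open>Bounded operators and their extension from total families\<close>

lemma bounded_opsD:
  assumes "T \<in> bounded_ops H K"
  shows "x \<in> carrier H \<Longrightarrow> T x \<in> carrier K"
    "x \<in> carrier H \<Longrightarrow> y \<in> carrier H \<Longrightarrow> T (vadd H x y) = vadd K (T x) (T y)"
    "x \<in> carrier H \<Longrightarrow> T (vscale H a x) = vscale K a (T x)"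
    "T \<in> extensional (carrier H)"
  using assms by (auto simp: bounded_ops_def PiE_iff)

lemma bounded_opsI:
  assumes "T \<in> extensional (carrier H)" "\<And>x. x \<in> carrier H \<Longrightarrow> T x \<in> carrier K"
    "\<And>x y. x \<in> carrier H \<Longrightarrow> y \<in> carrier H \<Longrightarrow> T (vadd H x y) = vadd K (T x) (T y)"
    "\<And>a x. x \<in> carrier H \<Longrightarrow> T (vscale H a x) = vscale K a (T x)"
    "\<And>x. x \<in> carrier H \<Longrightarrow> vnorm K (T x) \<le> C * vnorm H x"
  shows "T \<in> bounded_ops H K"
  unfolding bounded_ops_def PiE_iff using assms by blast

lemma bounded_ops_eqI:
  assumes "S \<in> bounded_ops H K" "T \<in> bounded_ops H K" "\<And>x. x \<in> carrier H \<Longrightarrow> S x = T x"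
  shows "S = T"
  using assms by (meson bounded_opsD(4) extensionalityI)

context
  fixes H :: "'a cspace" and K :: "'b cspace"
  assumes H: "inner_product_space H" and K: "inner_product_space K"
begin

interpretation H: inner_product_space H by (rule H)
interpretation K: inner_product_space K by (rule K)

lemma bounded_ops_bound:
  assumes "T \<in> bounded_ops H K"
  obtains C where "C \<ge> 0" "\<And>x. x \<in> carrier H \<Longrightarrow> vnorm K (T x) \<le> C * vnorm H x"
proof -
  obtain C where C: "\<And>x. x \<in> carrier H \<Longrightarrow> vnorm K (T x) \<le> C * vnorm H x"
    using assms unfolding bounded_ops_def by blast
  have "vnorm K (T x) \<le> max 0 C * vnorm H x" if "x \<in> carrier H" for x
    using C[OF that] mult_right_mono[of C "max 0 C" "vnorm H x"] that by simp
  then show thesis using that[of "max 0 C"] by simp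
qed

lemma bounded_ops_vdist:
  assumes "T \<in> bounded_ops H K"
  obtains C where "C \<ge> 0"
    "\<And>x y. x \<in> carrier H \<Longrightarrow> y \<in> carrier H \<Longrightarrow> vdist K (T x) (T y) \<le> C * vdist H x y"
proof -
  obtain C where C: "C \<ge> 0" "\<And>x. x \<in> carrier H \<Longrightarrow> vnorm K (T x) \<le> C * vnorm H x"
    using bounded_ops_bound[OF assms] by blast
  have "vdist K (T x) (T y) \<le> C * vdist H x y" if "x \<in> carrier H" "y \<in> carrier H" for x y
    using C(2)[of "vminus H x y"] that bounded_opsD(2,3)[OF assms] by (simp add: vdist_def)
  then show thesis using C that by blast
qed

lemma bounded_ops_zero: "T \<in> bounded_ops H K \<Longrightarrow> T (vzero H) = vzero K"
  using bounded_opsD(1)[of T H K "vzero H"] bounded_opsD(3)[of T H K "vzero H" 0] by simp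

lemma bounded_ops_vlim:
  assumes T: "T \<in> bounded_ops H K"
    and s: "vlim H s x" "\<And>k. s k \<in> carrier H" "x \<in> carrier H"
  shows "vlim K (\<lambda>k. T (s k)) (T x)"
proof -
  obtain C where C: "\<And>x y. x \<in> carrier H \<Longrightarrow> y \<in> carrier H \<Longrightarrow> vdist K (T x) (T y) \<le> C * vdist H x y"
    using bounded_ops_vdist[OF T] by blast
  show ?thesis
  proof (rule K.vlim_squeeze)
    show "(\<lambda>k. C * vdist H (s k) x) \<longlonglongrightarrow> 0"
      using tendsto_mult_right_zero[OF s(1)[unfolded vlim_def]] by simp
  qed (use C s bounded_opsD(1)[OF T] in auto)
qed

lemma bounded_ops_lincomb:
  assumes T: "T \<in> bounded_ops H K" and e: "\<And>x. x \<in> X \<Longrightarrow> e x \<in> carrier H"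
  shows "snd ` set l \<subseteq> X \<Longrightarrow> T (lincomb H e l) = lincomb K (\<lambda>x. T (e x)) l"
proof (induction l)
  case (Cons p l)
  then have "lincomb H e l \<in> carrier H" "e (snd p) \<in> carrier H"
    using e by (auto intro: H.lincomb_closed[where X = X])
  then show ?case using Cons bounded_opsD[OF T] by simp
qed (simp add: bounded_ops_zero[OF T])

text \<open>Boundedness gives continuity, so the values on a total family suffice. This is the
  uniqueness half of the definite descriptions in \<open>tensor_right\<close> and
  \<open>tensor_op\<close>.\<close>

lemma bounded_ops_dense_eqI:
  assumes S: "S \<in> bounded_ops H K" and T: "T \<in> bounded_ops H K" and d: "vdense H e X"
    and e: "\<And>x. x \<in> X \<Longrightarrow> e x \<in> carrier H" and eq: "\<And>x. x \<in> X \<Longrightarrow> S (e x) = T (e x)"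
  shows "S = T"
proof (rule bounded_ops_eqI[OF S T])
  fix v assume v: "v \<in> carrier H"
  obtain ls where ls: "\<And>k. snd ` set (ls k) \<subseteq> X" "vlim H (\<lambda>k. lincomb H e (ls k)) v"
    using H.vdense_seq[OF d v e] by blast
  have *: "lincomb H e (ls k) \<in> carrier H" for k
    using ls e by (intro H.lincomb_closed[where X = X])
  have "lincomb K (\<lambda>x. S (e x)) l = lincomb K (\<lambda>x. T (e x)) l" if "snd ` set l \<subseteq> X" for l
    using that eq by (induction l) auto
  then have "S (lincomb H e (ls k)) = T (lincomb H e (ls k))" for k
    using ls(1)[of k] bounded_ops_lincomb[where e = e and X = X, OF S e]
      bounded_ops_lincomb[where e = e and X = X, OF T e] by simp
  then have "vlim K (\<lambda>k. T (lincomb H e (ls k))) (S v)"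
    using bounded_ops_vlim[OF S ls(2) * v] by simp
  then show "S v = T v"
    using bounded_ops_vlim[OF T ls(2) * v] bounded_opsD(1)[OF S] bounded_opsD(1)[OF T] * v
    by (intro K.vlim_unique) auto
qed

end

text \<open>The vectors \<open>e x\<close> may be linearly dependent; sending \<open>e x\<close> to
  \<open>f x\<close> is consistent because \<open>bound\<close> controls every formal combination,
  so that a vanishing combination is sent to zero. The extension is the closure of the graph of this
  assignment: the estimate on differences makes it single-valued, completeness of \<open>K\<close>
  makes it everywhere defined.\<close>

lemma bounded_extension:
  fixes e :: "'i \<Rightarrow> 'a"
  assumes H: "inner_product_space H" and K: "hilbert_space K"
    and d: "vdense H e X" and e: "\<And>x. x \<in> X \<Longrightarrow> e x \<in> carrier H"
    and f: "\<And>x. x \<in> X \<Longrightarrow> f x \<in> carrier K" and C: "C \<ge> 0"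
    and bound: "\<And>l. snd ` set l \<subseteq> X \<Longrightarrow> vnorm K (lincomb K f l) \<le> C * vnorm H (lincomb H e l)"
  shows "\<exists>T\<in>bounded_ops H K. (\<forall>x\<in>X. T (e x) = f x) \<and>
    (\<forall>v\<in>carrier H. vnorm K (T v) \<le> C * vnorm H v)"
proof -
  interpret H: inner_product_space H by (rule H)
  interpret K: hilbert_space K by (rule K)
  let ?E = "lincomb H e" and ?F = "lincomb K f"
  have E [simp]: "snd ` set l \<subseteq> X \<Longrightarrow> ?E l \<in> carrier H" for l
    using e by (intro H.lincomb_closed[where X = X])
  have F [simp]: "snd ` set l \<subseteq> X \<Longrightarrow> ?F l \<in> carrier K" for l
    using f by (intro K.lincomb_closed[where X = X])
  define neg :: "(complex \<times> 'i) list \<Rightarrow> (complex \<times> 'i) list" where "neg = map (\<lambda>(a, x). (-1 * a, x))"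
  have snd_map: "snd ` set (map (\<lambda>(a, x). (c * a, x)) l) = snd ` set l"
    for l :: "(complex \<times> 'i) list" and c by force
  \<comment> \<open>A difference of combinations is again a combination, with the second list
    negated and appended, so \<open>bound\<close> yields a Lipschitz estimate.\<close>
  have bd: "vdist K (?F l) (?F l') \<le> C * vdist H (?E l) (?E l')"
    if "snd ` set l \<subseteq> X" "snd ` set l' \<subseteq> X" for l l'
  proof -
    have n: "snd ` set (neg l') \<subseteq> X" using that(2) unfolding neg_def snd_map .
    have "?F (l @ neg l') = vminus K (?F l) (?F l')"
      using K.lincomb_append[where X = X and e = f, OF f that(1) n]
        K.lincomb_scale[where X = X and e = f and c = "-1", OF f that(2)] by (simp add: neg_def)
    moreover have "?E (l @ neg l') = vminus H (?E l) (?E l')"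
      using H.lincomb_append[where X = X and e = e, OF e that(1) n]
        H.lincomb_scale[where X = X and e = e and c = "-1", OF e that(2)] by (simp add: neg_def)
    ultimately show ?thesis using bound[of "l @ neg l'"] that n by (simp add: vdist_def image_Un)
  qed
  define Gr where "Gr v w \<longleftrightarrow> v \<in> carrier H \<and> w \<in> carrier K \<and> (\<exists>ls. (\<forall>k. snd ` set (ls k) \<subseteq> X) \<and>
      vlim H (\<lambda>k. ?E (ls k)) v \<and> vlim K (\<lambda>k. ?F (ls k)) w)" for v w
  have Gr_bd: "vdist K w w' \<le> C * vdist H v v'" if "Gr v w" "Gr v' w'" for v w v' w'
  proof -
    obtain ls ls' where l: "\<And>k. snd ` set (ls k) \<subseteq> X" "vlim H (\<lambda>k. ?E (ls k)) v" "vlim K (\<lambda>k. ?F (ls k)) w"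
      "\<And>k. snd ` set (ls' k) \<subseteq> X" "vlim H (\<lambda>k. ?E (ls' k)) v'" "vlim K (\<lambda>k. ?F (ls' k)) w'"
      and c: "v \<in> carrier H" "v' \<in> carrier H" "w \<in> carrier K" "w' \<in> carrier K"
      using \<open>Gr v w\<close> \<open>Gr v' w'\<close> unfolding Gr_def by blast
    have "(\<lambda>k. vdist K (?F (ls k)) (?F (ls' k))) \<longlonglongrightarrow> vdist K w w'"
      using l c by (intro K.vlim_vdist) auto
    moreover have "(\<lambda>k. C * vdist H (?E (ls k)) (?E (ls' k))) \<longlonglongrightarrow> C * vdist H v v'"
      using l c by (intro tendsto_mult_left H.vlim_vdist) auto
    ultimately show ?thesis by (rule LIMSEQ_le) (use bd l in blast)
  qed
  have Gr_ex: "\<exists>w. Gr v w" if v: "v \<in> carrier H" for v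
  proof -
    obtain ls where ls: "\<And>k. snd ` set (ls k) \<subseteq> X" "vlim H (\<lambda>k. ?E (ls k)) v"
      using H.vdense_seq[OF d v e] by blast
    have Ec: "(\<lambda>k. ?E (ls k)) \<in> cauchy_seqs H" using ls v by (intro H.vlim_imp_cauchy) auto
    have "(\<lambda>k. ?F (ls k)) \<in> cauchy_seqs K"
    proof (rule K.cauchyI)
      fix r :: real assume r: "r > 0"
      \<comment> \<open>\<open>C + 1\<close> instead of \<open>C\<close>, which may be zero.\<close>
      then have "r / (C + 1) > 0" using C by simp
      then obtain N where N: "\<forall>m\<ge>N. \<forall>n\<ge>N. vdist H (?E (ls m)) (?E (ls n)) < r / (C + 1)"
        using Ec unfolding cauchy_seqs_def by blast
      have "vdist K (?F (ls m)) (?F (ls n)) < r" if "m \<ge> N" "n \<ge> m" for m n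
      proof -
        have "vdist K (?F (ls m)) (?F (ls n)) \<le> C * vdist H (?E (ls m)) (?E (ls n))" using bd ls by blast
        also have "\<dots> \<le> C * (r / (C + 1))"
          using N that C by (intro mult_left_mono) (auto intro: less_imp_le)
        also have "\<dots> < r" using C r by (simp add: field_simps)
        finally show ?thesis .
      qed
      then show "\<exists>N. \<forall>m\<ge>N. \<forall>n\<ge>m. vdist K (?F (ls m)) (?F (ls n)) < r" by blast
    qed (use ls in auto)
    then obtain w where "w \<in> carrier K" "vlim K (\<lambda>k. ?F (ls k)) w"
      using K.complete unfolding vlim_def by blast
    then show ?thesis using ls v unfolding Gr_def by blast
  qed
  define T where "T = (\<lambda>v\<in>carrier H. SOME w. Gr v w)"
  have GrT: "Gr v (T v)" if "v \<in> carrier H" for v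
    using someI_ex[OF Gr_ex[OF that]] that by (simp add: T_def)
  have Gr_T: "T v = w" if "Gr v w" for v w
  proof -
    have v: "v \<in> carrier H" using that by (simp add: Gr_def)
    have "vdist K (T v) w \<le> C * vdist H v v" using Gr_bd[OF GrT[OF v] that] .
    moreover have "T v \<in> carrier K" "w \<in> carrier K" using that GrT[OF v] by (auto simp: Gr_def)
    ultimately show ?thesis
      using v K.vdist_nonneg[of "T v" w] by (intro K.vdist_eq_0 antisym[of _ 0]) simp_all
  qed
  have Tc: "T v \<in> carrier K" if "v \<in> carrier H" for v using GrT[OF that] by (simp add: Gr_def)
  have Tadd: "T (vadd H v v') = vadd K (T v) (T v')" if c: "v \<in> carrier H" "v' \<in> carrier H" for v v'
  proof (rule Gr_T)
    obtain ls ls' where l: "\<And>k. snd ` set (ls k) \<subseteq> X" "vlim H (\<lambda>k. ?E (ls k)) v" "vlim K (\<lambda>k. ?F (ls k)) (T v)"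
      "\<And>k. snd ` set (ls' k) \<subseteq> X" "vlim H (\<lambda>k. ?E (ls' k)) v'" "vlim K (\<lambda>k. ?F (ls' k)) (T v')"
      using GrT[OF c(1)] GrT[OF c(2)] unfolding Gr_def by blast
    have "vlim H (\<lambda>k. ?E (ls k @ ls' k)) (vadd H v v')"
      using H.vlim_add[OF l(2,5)] l c
      by (simp add: H.lincomb_append[where X = X and e = e, OF e l(1) l(4)])
    moreover have "vlim K (\<lambda>k. ?F (ls k @ ls' k)) (vadd K (T v) (T v'))"
      using K.vlim_add[OF l(3,6)] l c Tc
      by (simp add: K.lincomb_append[where X = X and e = f, OF f l(1) l(4)])
    moreover have "snd ` set (ls k @ ls' k) \<subseteq> X" for k using l(1,4)[of k] by auto
    ultimately show "Gr (vadd H v v') (vadd K (T v) (T v'))"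
      unfolding Gr_def using c Tc by (intro conjI exI[of _ "\<lambda>k. ls k @ ls' k"]) auto
  qed
  have Tscale: "T (vscale H a v) = vscale K a (T v)" if c: "v \<in> carrier H" for a v
  proof (rule Gr_T)
    obtain ls where l: "\<And>k. snd ` set (ls k) \<subseteq> X" "vlim H (\<lambda>k. ?E (ls k)) v" "vlim K (\<lambda>k. ?F (ls k)) (T v)"
      using GrT[OF c(1)] unfolding Gr_def by blast
    let ?ls = "\<lambda>k. map (\<lambda>(b, x). (a * b, x)) (ls k)"
    have s: "snd ` set (?ls k) \<subseteq> X" for k using l(1)[of k] unfolding snd_map .
    have "vlim H (\<lambda>k. ?E (?ls k)) (vscale H a v)"
      using H.vlim_scale[OF l(2)] l c
      by (simp add: H.lincomb_scale[where X = X and e = e, OF e l(1)])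
    moreover have "vlim K (\<lambda>k. ?F (?ls k)) (vscale K a (T v))"
      using K.vlim_scale[OF l(3)] l c Tc
      by (simp add: K.lincomb_scale[where X = X and e = f, OF f l(1)])
    ultimately show "Gr (vscale H a v) (vscale K a (T v))"
      unfolding Gr_def using c Tc s by (intro conjI exI[of _ ?ls] allI) auto
  qed
  have Tzero: "T (vzero H) = vzero K" using Tscale[of "vzero H" 0] Tc by simp
  have Tbd: "vnorm K (T v) \<le> C * vnorm H v" if "v \<in> carrier H" for v
    using Gr_bd[OF GrT[OF that] GrT[OF H.zero_closed]] that Tc by (simp add: Tzero)
  have "T \<in> bounded_ops H K"
    by (rule bounded_opsI[where C = C])
      (auto simp: Tc Tadd Tscale Tbd, simp add: T_def)
  moreover have "T (e x) = f x" if "x \<in> X" for x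
  proof (rule Gr_T)
    have "?E [(1, x)] = e x" "?F [(1, x)] = f x" using e f that by simp_all
    then show "Gr (e x) (f x)" unfolding Gr_def using e f that
      by (intro conjI exI[of _ "\<lambda>_. [(1, x)]"]) auto
  qed
  ultimately show ?thesis using Tbd by blast
qed


section \<open>Completions\<close>

context semi_inner_product_space
begin

abbreviation "Hc \<equiv> completion H"

abbreviation cclass :: "(nat \<Rightarrow> 'a) \<Rightarrow> (nat \<Rightarrow> 'a) set" where
  "cclass s \<equiv> null_rel H `` {s}"

lemma null_rel_iff:
  "(s, t) \<in> null_rel H \<longleftrightarrow> s \<in> cauchy_seqs H \<and> t \<in> cauchy_seqs H \<and>
     (\<lambda>k. vdist H (s k) (t k)) \<longlonglongrightarrow> 0"
  by (simp add: null_rel_def)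

lemma null_rel_squeeze:
  assumes "s \<in> cauchy_seqs H" "t \<in> cauchy_seqs H" "\<And>k. vdist H (s k) (t k) \<le> f k" "f \<longlonglongrightarrow> 0"
  shows "(s, t) \<in> null_rel H"
  unfolding null_rel_iff using assms
  by (auto intro!: tendsto_sandwich[OF always_eventually always_eventually tendsto_const assms(4)]
      simp: cauchy_closed)

lemma equiv_null_rel: "equiv (cauchy_seqs H) (null_rel H)"
proof (rule equivI)
  show "null_rel H \<subseteq> cauchy_seqs H \<times> cauchy_seqs H" by (auto simp: null_rel_iff)
  show "refl_on (cauchy_seqs H) (null_rel H)"
    by (auto simp: refl_on_def null_rel_iff cauchy_closed)
  show "sym (null_rel H)"
    by (auto simp: sym_def null_rel_iff vdist_commute cauchy_closed)
  show "trans (null_rel H)"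
  proof (rule transI)
    fix s t u assume *: "(s, t) \<in> null_rel H" "(t, u) \<in> null_rel H"
    then have "(\<lambda>k. vdist H (s k) (t k) + vdist H (t k) (u k)) \<longlonglongrightarrow> 0"
      using tendsto_add[of "\<lambda>k. vdist H (s k) (t k)" 0 _ "\<lambda>k. vdist H (t k) (u k)" 0]
      by (simp add: null_rel_iff)
    with * show "(s, u) \<in> null_rel H"
      by (intro null_rel_squeeze[of s u "\<lambda>k. vdist H (s k) (t k) + vdist H (t k) (u k)"])
        (auto simp: null_rel_iff cauchy_closed intro: vdist_triangle)
  qed
qed

lemma cauchy_add:
  assumes "s \<in> cauchy_seqs H" "t \<in> cauchy_seqs H"
  shows "(\<lambda>k. vadd H (s k) (t k)) \<in> cauchy_seqs H"
proof (rule cauchyI)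
  fix e :: real assume "e > 0"
  then have e: "e / 2 > 0" by simp
  obtain N where N: "\<And>m n. m \<ge> N \<Longrightarrow> n \<ge> N \<Longrightarrow> vdist H (s m) (s n) < e / 2"
    using assms(1) e unfolding cauchy_seqs_def by blast
  obtain M where M: "\<And>m n. m \<ge> M \<Longrightarrow> n \<ge> M \<Longrightarrow> vdist H (t m) (t n) < e / 2"
    using assms(2) e unfolding cauchy_seqs_def by blast
  have "vdist H (vadd H (s m) (t m)) (vadd H (s n) (t n)) < e" if "m \<ge> max N M" "n \<ge> m" for m n
    using N[of m n] M[of m n] that vdist_add[of "s m" "t m" "s n" "t n"] assms
    by (simp add: cauchy_closed)
  then show "\<exists>N. \<forall>m\<ge>N. \<forall>n\<ge>m. vdist H (vadd H (s m) (t m)) (vadd H (s n) (t n)) < e" by blast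
qed (use assms in \<open>simp add: cauchy_closed\<close>)

lemma cauchy_scale:
  assumes "s \<in> cauchy_seqs H"
  shows "(\<lambda>k. vscale H c (s k)) \<in> cauchy_seqs H"
proof (rule cauchyI)
  fix e :: real assume "e > 0"
  then have e: "e / (cmod c + 1) > 0" by (simp add: add_nonneg_pos)
  obtain N where N: "\<And>m n. m \<ge> N \<Longrightarrow> n \<ge> N \<Longrightarrow> vdist H (s m) (s n) < e / (cmod c + 1)"
    using assms(1) e unfolding cauchy_seqs_def by blast
  have "vdist H (vscale H c (s m)) (vscale H c (s n)) < e" if "m \<ge> N" "n \<ge> m" for m n
  proof -
    have "vdist H (vscale H c (s m)) (vscale H c (s n)) \<le> cmod c * (e / (cmod c + 1))"
      using N[of m n] that assms by (simp add: cauchy_closed vdist_scale mult_left_mono less_imp_le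
          del: times_divide_eq_right)
    also have "\<dots> < e" using \<open>e > 0\<close> by (simp add: field_simps add_pos_nonneg)
    finally show ?thesis .
  qed
  then show "\<exists>N. \<forall>m\<ge>N. \<forall>n\<ge>m. vdist H (vscale H c (s m)) (vscale H c (s n)) < e" by blast
qed (use assms in \<open>simp add: cauchy_closed\<close>)

lemma cauchy_const: "x \<in> carrier H \<Longrightarrow> (\<lambda>_. x) \<in> cauchy_seqs H"
  by (simp add: cauchy_seqs_def)

lemma cauchy_bounded:
  assumes "s \<in> cauchy_seqs H"
  obtains B where "\<And>k. vnorm H (s k) \<le> B"
proof -
  obtain N where N: "\<forall>m\<ge>N. \<forall>n\<ge>N. vdist H (s m) (s n) < 1"
    using assms unfolding cauchy_seqs_def using zero_less_one by blast
  have "vnorm H (s k) \<le> Max ((\<lambda>j. vnorm H (s j)) ` {..N}) + 1" for k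
  proof (cases "k \<le> N")
    case True
    then have "vnorm H (s k) \<le> Max ((\<lambda>j. vnorm H (s j)) ` {..N})" by (intro Max_ge) auto
    then show ?thesis by simp
  next
    case False
    then have "vnorm H (s k) \<le> vnorm H (s N) + 1"
      using N[rule_format, of k N] vnorm_diff_le[of "s k" "s N"] assms by (simp add: cauchy_closed abs_le_iff)
    also have "vnorm H (s N) \<le> Max ((\<lambda>j. vnorm H (s j)) ` {..N})" by (intro Max_ge) auto
    finally show ?thesis by simp
  qed
  then show thesis by (rule that)
qed

lemma cclass_eq_iff:
  "s \<in> cauchy_seqs H \<Longrightarrow> t \<in> cauchy_seqs H \<Longrightarrow> cclass s = cclass t \<longleftrightarrow> (s, t) \<in> null_rel H"
  using eq_equiv_class_iff[OF equiv_null_rel] by blast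

lemma cclass_closed: "s \<in> cauchy_seqs H \<Longrightarrow> cclass s \<in> carrier Hc"
  by (simp add: completion_def quotientI)

lemma completion_cases:
  assumes "A \<in> carrier Hc"
  obtains s where "s \<in> cauchy_seqs H" "A = cclass s"
  using assms by (auto simp: completion_def elim: quotientE)

lemma cclass_add:
  assumes "s \<in> cauchy_seqs H" "t \<in> cauchy_seqs H"
  shows "vadd Hc (cclass s) (cclass t) = cclass (\<lambda>k. vadd H (s k) (t k))"
proof -
  let ?f = "\<lambda>s t. cclass (\<lambda>k. vadd H (s k) (t k))"
  have "congruent2 (null_rel H) (null_rel H) ?f"
  proof (rule congruent2I')
    fix s s' t t' assume *: "(s, s') \<in> null_rel H" "(t, t') \<in> null_rel H"
    then have "(\<lambda>k. vdist H (s k) (s' k) + vdist H (t k) (t' k)) \<longlonglongrightarrow> 0"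
      using tendsto_add[of "\<lambda>k. vdist H (s k) (s' k)" 0 _ "\<lambda>k. vdist H (t k) (t' k)" 0]
      by (simp add: null_rel_iff)
    then have "((\<lambda>k. vadd H (s k) (t k)), (\<lambda>k. vadd H (s' k) (t' k))) \<in> null_rel H"
      using * by (intro null_rel_squeeze[where f = "\<lambda>k. vdist H (s k) (s' k) + vdist H (t k) (t' k)"])
        (auto simp: null_rel_iff cauchy_closed cauchy_add intro: vdist_add)
    then show "?f s t = ?f s' t'" by (intro equiv_class_eq[OF equiv_null_rel])
  qed
  from UN_equiv_class2[OF equiv_null_rel equiv_null_rel this assms] show ?thesis
    by (simp add: completion_def)
qed

lemma cclass_scale:
  assumes "s \<in> cauchy_seqs H"
  shows "vscale Hc c (cclass s) = cclass (\<lambda>k. vscale H c (s k))"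
proof -
  let ?f = "\<lambda>s. cclass (\<lambda>k. vscale H c (s k))"
  have "?f respects null_rel H"
  proof (rule congruentI)
    fix s s' assume *: "(s, s') \<in> null_rel H"
    then have "((\<lambda>k. vscale H c (s k)), (\<lambda>k. vscale H c (s' k))) \<in> null_rel H"
      by (auto simp: null_rel_iff cauchy_closed cauchy_scale vdist_scale intro: tendsto_mult_right_zero)
    then show "?f s = ?f s'" by (intro equiv_class_eq[OF equiv_null_rel])
  qed
  from UN_equiv_class[OF equiv_null_rel this assms] show ?thesis
    by (simp add: completion_def)
qed

lemma cclass_zero: "vzero Hc = cclass (\<lambda>_. vzero H)"
  by (simp add: completion_def)

lemma cauchy_inner_convergent:
  assumes s: "s \<in> cauchy_seqs H" and t: "t \<in> cauchy_seqs H"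
  shows "convergent (\<lambda>k. vinner H (s k) (t k))"
proof -
  obtain B where B: "\<And>k. vnorm H (s k) \<le> B" using cauchy_bounded[OF s] by blast
  obtain B' where B': "\<And>k. vnorm H (t k) \<le> B'" using cauchy_bounded[OF t] by blast
  have pos: "0 \<le> B" "0 \<le> B'"
    using B[of 0] B'[of 0] s t vnorm_nonneg[of "s 0"] vnorm_nonneg[of "t 0"]
    by (simp_all add: cauchy_closed del: vnorm_nonneg)
  have "Cauchy (\<lambda>k. vinner H (s k) (t k))"
  proof (rule metric_CauchyI)
    fix e :: real assume "e > 0"
    \<comment> \<open>The estimate below comes to \<open>d * B' + B * d = e - d\<close>; the added 1
      leaves room for strictness and avoids a zero denominator.\<close>
    define d where "d = e / (B + B' + 1)"
    have d: "d > 0" using \<open>e > 0\<close> pos by (simp add: d_def)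
    obtain N where N: "\<And>m n. m \<ge> N \<Longrightarrow> n \<ge> N \<Longrightarrow> vdist H (s m) (s n) < d"
      using s d unfolding cauchy_seqs_def by blast
    obtain M where M: "\<And>m n. m \<ge> M \<Longrightarrow> n \<ge> M \<Longrightarrow> vdist H (t m) (t n) < d"
      using t d unfolding cauchy_seqs_def by blast
    have "dist (vinner H (s m) (t m)) (vinner H (s n) (t n)) < e" if "m \<ge> max N M" "n \<ge> max N M" for m n
    proof -
      have "dist (vinner H (s m) (t m)) (vinner H (s n) (t n))
          \<le> vdist H (s m) (s n) * vnorm H (t m) + vnorm H (s n) * vdist H (t m) (t n)"
        unfolding dist_norm by (intro inner_diff_le) (use s t in \<open>auto simp: cauchy_closed\<close>)
      also have "\<dots> \<le> d * B' + B * d"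
        using N[of m n] M[of m n] B B' that d pos s t
        by (intro add_mono mult_mono) (auto simp: cauchy_closed)
      also have "\<dots> = (B + B' + 1) * d - d" by (simp add: algebra_simps)
      also have "\<dots> = e - d" using pos by (simp add: d_def)
      also have "\<dots> < e" using d by simp
      finally show ?thesis .
    qed
    then show "\<exists>M. \<forall>m\<ge>M. \<forall>n\<ge>M. dist (vinner H (s m) (t m)) (vinner H (s n) (t n)) < e" by blast
  qed
  then show ?thesis by (simp add: Cauchy_convergent_iff)
qed

lemma null_rel_inner_diff:
  assumes s: "(s, s') \<in> null_rel H" and t: "(t, t') \<in> null_rel H"
  shows "(\<lambda>k. vinner H (s k) (t k) - vinner H (s' k) (t' k)) \<longlonglongrightarrow> 0"
proof -
  have c: "s k \<in> carrier H" "s' k \<in> carrier H" "t k \<in> carrier H" "t' k \<in> carrier H" for k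
    using s t by (auto simp: null_rel_iff cauchy_closed)
  obtain B where B: "\<And>k. vnorm H (s' k) \<le> B"
    using s cauchy_bounded unfolding null_rel_iff by blast
  obtain B' where B': "\<And>k. vnorm H (t k) \<le> B'"
    using t cauchy_bounded unfolding null_rel_iff by blast
  have "(\<lambda>k. vdist H (s k) (s' k) * B' + B * vdist H (t k) (t' k)) \<longlonglongrightarrow> 0 * B' + B * 0"
    using s t unfolding null_rel_iff by (intro tendsto_intros) auto
  then have A: "(\<lambda>k. vdist H (s k) (s' k) * B' + B * vdist H (t k) (t' k)) \<longlonglongrightarrow> 0" by simp
  have "cmod (vinner H (s k) (t k) - vinner H (s' k) (t' k))
      \<le> vdist H (s k) (s' k) * B' + B * vdist H (t k) (t' k)" for k
    using inner_diff_le[of "s k" "t k" "s' k" "t' k"] c[of k]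
      mult_left_mono[OF B'[of k], of "vdist H (s k) (s' k)"]
      mult_right_mono[OF B[of k], of "vdist H (t k) (t' k)"] by simp
  then show ?thesis by (intro Lim_null_comparison[OF always_eventually A]) auto
qed

text \<open>The limit exists along one pair of representatives, and passing to equivalent ones
  changes the sequence by a null sequence; this justifies the definite description in
  \<open>completion\<close>.\<close>

lemma cclass_inner:
  assumes s: "s \<in> cauchy_seqs H" and t: "t \<in> cauchy_seqs H"
  shows "(\<lambda>k. vinner H (s k) (t k)) \<longlonglongrightarrow> vinner Hc (cclass s) (cclass t)"
proof -
  obtain z where z: "(\<lambda>k. vinner H (s k) (t k)) \<longlonglongrightarrow> z"
    using cauchy_inner_convergent[OF s t] by (auto simp: convergent_def)
  have "(THE z. \<forall>s\<in>cclass s. \<forall>t\<in>cclass t. (\<lambda>k. vinner H (s k) (t k)) \<longlonglongrightarrow> z) = z"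
  proof (rule the_equality)
    show "\<forall>s\<in>cclass s. \<forall>t\<in>cclass t. (\<lambda>k. vinner H (s k) (t k)) \<longlonglongrightarrow> z"
    proof (intro ballI)
      fix s' t' assume "s' \<in> cclass s" "t' \<in> cclass t"
      then have "(\<lambda>k. vinner H (s k) (t k) - vinner H (s' k) (t' k)) \<longlonglongrightarrow> 0"
        using null_rel_inner_diff by simp
      from tendsto_diff[OF z this] show "(\<lambda>k. vinner H (s' k) (t' k)) \<longlonglongrightarrow> z" by simp
    qed
  next
    fix w assume "\<forall>s\<in>cclass s. \<forall>t\<in>cclass t. (\<lambda>k. vinner H (s k) (t k)) \<longlonglongrightarrow> w"
    moreover have "s \<in> cclass s" "t \<in> cclass t" using s t by (simp_all add: null_rel_iff cauchy_closed)
    ultimately have "(\<lambda>k. vinner H (s k) (t k)) \<longlonglongrightarrow> w" by blast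
    then show "w = z" using z LIMSEQ_unique by blast
  qed
  then show ?thesis using z by (simp add: completion_def)
qed

text \<open>Every axiom but definiteness passes to limits of representatives. Definiteness is
  produced by the quotient: a class of norm zero is represented by a sequence whose distance to the
  zero sequence tends to zero.\<close>

lemma completion_inner_product_space: "inner_product_space Hc"
proof -
  note cl = cclass_add cclass_scale cclass_zero cclass_closed cauchy_add cauchy_scale
    cauchy_const[OF zero_closed] cauchy_closed
  show ?thesis
  proof
    fix A B assume A: "A \<in> carrier Hc" and B: "B \<in> carrier Hc"
    then obtain s t where s: "s \<in> cauchy_seqs H" "A = cclass s" and t: "t \<in> cauchy_seqs H" "B = cclass t"
      by (metis completion_cases)
    show "vadd Hc A B \<in> carrier Hc" by (simp add: s t cl)
    show "vadd Hc A B = vadd Hc B A" by (simp add: s t cl add_commute)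
    show "vscale Hc a (vadd Hc A B)
        = vadd Hc (vscale Hc a A) (vscale Hc a B)" for a
      by (simp add: s t cl scale_add_right)
    show "vinner Hc (vscale Hc a A) B = a * vinner Hc A B" for a
    proof (rule LIMSEQ_unique)
      show "(\<lambda>k. vinner H (vscale H a (s k)) (t k)) \<longlonglongrightarrow>
          vinner Hc (vscale Hc a A) B"
        using cclass_inner[OF cauchy_scale[OF s(1)] t(1)] by (simp add: s t cl)
      show "(\<lambda>k. vinner H (vscale H a (s k)) (t k)) \<longlonglongrightarrow> a * vinner Hc A B"
        using tendsto_mult_left[OF cclass_inner[OF s(1) t(1)], of a]
        by (simp add: s t cauchy_closed inner_scale)
    qed
    show "vinner Hc B A = cnj (vinner Hc A B)"
    proof (rule LIMSEQ_unique)
      show "(\<lambda>k. vinner H (t k) (s k)) \<longlonglongrightarrow> vinner Hc B A"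
        using cclass_inner[OF t(1) s(1)] by (simp add: s t)
      show "(\<lambda>k. vinner H (t k) (s k)) \<longlonglongrightarrow> cnj (vinner Hc A B)"
        using tendsto_cnj[OF cclass_inner[OF s(1) t(1)]] s t
        by (simp add: inner_cnj[of "s _" "t _"] cauchy_closed)
    qed
  next
    fix A B C assume A: "A \<in> carrier Hc" and B: "B \<in> carrier Hc"
      and C: "C \<in> carrier Hc"
    then obtain s t u where s: "s \<in> cauchy_seqs H" "A = cclass s" and t: "t \<in> cauchy_seqs H" "B = cclass t"
      and u: "u \<in> cauchy_seqs H" "C = cclass u"
      by (metis completion_cases)
    show "vadd Hc (vadd Hc A B) C = vadd Hc A (vadd Hc B C)"
      by (simp add: s t u cl add_assoc)
    show "vinner Hc (vadd Hc A B) C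
        = vinner Hc A C + vinner Hc B C"
    proof (rule LIMSEQ_unique)
      show "(\<lambda>k. vinner H (vadd H (s k) (t k)) (u k)) \<longlonglongrightarrow>
          vinner Hc (vadd Hc A B) C"
        using cclass_inner[OF cauchy_add[OF s(1) t(1)] u(1)] by (simp add: s t u cl)
      show "(\<lambda>k. vinner H (vadd H (s k) (t k)) (u k)) \<longlonglongrightarrow>
          vinner Hc A C + vinner Hc B C"
        using tendsto_add[OF cclass_inner[OF s(1) u(1)] cclass_inner[OF t(1) u(1)]]
        by (simp add: s t u cauchy_closed inner_add)
    qed
  next
    fix A assume A: "A \<in> carrier Hc"
    then obtain s where s: "s \<in> cauchy_seqs H" "A = cclass s" by (metis completion_cases)
    show "vscale Hc c A \<in> carrier Hc" for c by (simp add: s cl)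
    show "vadd Hc A (vzero Hc) = A" by (simp add: s cl)
    show "vadd Hc A (vscale Hc (- 1) A) = vzero Hc"
      by (simp add: s cl)
    show "vscale Hc 1 A = A" by (simp add: s cl)
    show "vscale Hc a (vscale Hc b A) = vscale Hc (a * b) A" for a b
      by (simp add: s cl)
    show "vscale Hc (a + b) A
        = vadd Hc (vscale Hc a A) (vscale Hc b A)" for a b
      by (simp add: s cl scale_add_left)
    have "(\<lambda>k. Re (vinner H (s k) (s k))) \<longlonglongrightarrow> Re (vinner Hc A A)"
      using tendsto_Re[OF cclass_inner[OF s(1) s(1)]] by (simp add: s)
    then show "0 \<le> Re (vinner Hc A A)"
      by (rule LIMSEQ_le_const) (use s in \<open>simp add: inner_nonneg cauchy_closed\<close>)
    assume "vinner Hc A A = 0"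
    then have "(\<lambda>k. Re (vinner H (s k) (s k))) \<longlonglongrightarrow> 0"
      using tendsto_Re[OF cclass_inner[OF s(1) s(1)]] by (simp add: s)
    from tendsto_real_sqrt[OF this] have "(\<lambda>k. vdist H (s k) (vzero H)) \<longlonglongrightarrow> 0"
      using s by (simp add: cauchy_closed flip: vnorm_def)
    then have "(s, \<lambda>_. vzero H) \<in> null_rel H" using s by (simp add: null_rel_iff cl)
    then show "A = vzero Hc"
      using s cauchy_const[OF zero_closed] by (simp add: cclass_zero cclass_eq_iff)
  qed (simp add: cl)
qed

section \<open>The canonical map into the completion, density and completeness\<close>

lemma cclass_vdist:
  assumes s: "s \<in> cauchy_seqs H" and t: "t \<in> cauchy_seqs H"
  shows "(\<lambda>k. vdist H (s k) (t k)) \<longlonglongrightarrow> vdist Hc (cclass s) (cclass t)"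
  using tendsto_real_sqrt[OF tendsto_Re[OF cclass_inner[OF cauchy_add[OF s cauchy_scale[OF t, of "-1"]]
        cauchy_add[OF s cauchy_scale[OF t, of "-1"]]]]]
  by (simp add: vdist_def vnorm_def cclass_add cclass_scale s t cauchy_scale)

lemma to_completion_closed [simp]: "x \<in> carrier H \<Longrightarrow> to_completion H x \<in> carrier Hc"
  by (simp add: to_completion_def cclass_closed cauchy_const)

lemma to_completion_add:
  "x \<in> carrier H \<Longrightarrow> y \<in> carrier H \<Longrightarrow>
   to_completion H (vadd H x y) = vadd Hc (to_completion H x) (to_completion H y)"
  by (simp add: to_completion_def cclass_add cauchy_const)

lemma to_completion_scale:
  "x \<in> carrier H \<Longrightarrow> to_completion H (vscale H c x) = vscale Hc c (to_completion H x)"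
  by (simp add: to_completion_def cclass_scale cauchy_const)

lemma to_completion_zero: "to_completion H (vzero H) = vzero Hc"
  by (simp add: to_completion_def cclass_zero)

lemma to_completion_inner:
  assumes "x \<in> carrier H" "y \<in> carrier H"
  shows "vinner Hc (to_completion H x) (to_completion H y) = vinner H x y"
  using cclass_inner[OF cauchy_const[OF assms(1)] cauchy_const[OF assms(2)]]
  by (simp add: to_completion_def LIMSEQ_const_iff)

lemma to_completion_vdist:
  assumes "x \<in> carrier H" "y \<in> carrier H"
  shows "vdist Hc (to_completion H x) (to_completion H y) = vdist H x y"
  using cclass_vdist[OF cauchy_const[OF assms(1)] cauchy_const[OF assms(2)]]
  by (simp add: to_completion_def LIMSEQ_const_iff)

lemma to_completion_lincomb:
  assumes e: "\<And>x. x \<in> X \<Longrightarrow> e x \<in> carrier H"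
  shows "snd ` set l \<subseteq> X \<Longrightarrow>
    to_completion H (lincomb H e l) = lincomb Hc (\<lambda>x. to_completion H (e x)) l"
proof (induction l)
  case (Cons p l)
  then have "lincomb H e l \<in> carrier H" "e (snd p) \<in> carrier H"
    using e by (auto intro: lincomb_closed[where X = X])
  then show ?case using Cons by (simp add: to_completion_add to_completion_scale)
qed (simp add: to_completion_zero)

lemma cclass_approx:
  assumes s: "s \<in> cauchy_seqs H" and "\<epsilon> > 0"
  obtains N where "\<And>k. k \<ge> N \<Longrightarrow> vdist Hc (cclass s) (to_completion H (s k)) < \<epsilon>"
proof -
  obtain N where N: "\<And>m n. m \<ge> N \<Longrightarrow> n \<ge> N \<Longrightarrow> vdist H (s m) (s n) < \<epsilon> / 2"
    using s \<open>\<epsilon> > 0\<close> unfolding cauchy_seqs_def by (smt (verit, best) half_gt_zero mem_Collect_eq)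
  have "vdist Hc (cclass s) (to_completion H (s k)) < \<epsilon>" if "k \<ge> N" for k
  proof -
    have "(\<lambda>j. vdist H (s j) (s k)) \<longlonglongrightarrow> vdist Hc (cclass s) (to_completion H (s k))"
      unfolding to_completion_def by (rule cclass_vdist) (use s in \<open>auto simp: cauchy_const cauchy_closed\<close>)
    then have "vdist Hc (cclass s) (to_completion H (s k)) \<le> \<epsilon> / 2"
      by (rule LIMSEQ_le_const2) (use N that in \<open>auto intro!: exI[of _ N] less_imp_le\<close>)
    then show ?thesis using \<open>\<epsilon> > 0\<close> by simp
  qed
  then show thesis by (rule that)
qed

lemma completion_approx:
  assumes "A \<in> carrier Hc" "\<epsilon> > 0"
  obtains x where "x \<in> carrier H" "vdist Hc A (to_completion H x) < \<epsilon>"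
proof -
  obtain s where s: "s \<in> cauchy_seqs H" "A = cclass s" using assms(1) by (rule completion_cases)
  obtain N where "\<And>k. k \<ge> N \<Longrightarrow> vdist Hc (cclass s) (to_completion H (s k)) < \<epsilon>"
    using cclass_approx[OF s(1) assms(2)] by blast
  then show thesis using that[of "s N"] s cauchy_closed by blast
qed

lemma completion_vdense:
  assumes d: "vdense H e X" and e: "\<And>x. x \<in> X \<Longrightarrow> e x \<in> carrier H"
  shows "vdense Hc (\<lambda>x. to_completion H (e x)) X"
  unfolding vdense_def
proof (intro ballI allI impI)
  fix A :: "(nat \<Rightarrow> 'a) set" and \<epsilon> :: real
  assume A: "A \<in> carrier Hc" and "\<epsilon> > 0"
  interpret C: inner_product_space "completion H" by (rule completion_inner_product_space)
  have e2: "\<epsilon> / 2 > 0" using \<open>\<epsilon> > 0\<close> by simp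
  obtain x where x: "x \<in> carrier H" "vdist Hc A (to_completion H x) < \<epsilon> / 2"
    using completion_approx[OF A e2] by blast
  obtain l where l: "snd ` set l \<subseteq> X" "vdist H x (lincomb H e l) < \<epsilon> / 2"
    using d x(1) e2 unfolding vdense_def by blast
  have c: "lincomb H e l \<in> carrier H" using e l(1) by (intro lincomb_closed[where X = X])
  have "vdist Hc A (to_completion H (lincomb H e l)) < \<epsilon>"
    using C.vdist_triangle[of A "to_completion H x" "to_completion H (lincomb H e l)"] x l A c
    by (simp add: to_completion_vdist)
  then show "\<exists>l. snd ` set l \<subseteq> X \<and>
      vdist Hc A (lincomb Hc (\<lambda>x. to_completion H (e x)) l) < \<epsilon>"
    using l(1) to_completion_lincomb[OF e l(1)] by auto
qed

text \<open>Given a Cauchy sequence of classes, pick \<open>p k\<close> in \<open>H\<close> within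
  \<open>1 / Suc k\<close> of the k-th class. Then \<open>p\<close> is a Cauchy sequence in
  \<open>H\<close>, and its class is the limit.\<close>

theorem completion_hilbert_space: "hilbert_space Hc"
proof -
  interpret C: inner_product_space "completion H" by (rule completion_inner_product_space)
  show ?thesis
  proof (unfold_locales)
    fix A assume A: "A \<in> cauchy_seqs Hc"
    have "\<forall>k. \<exists>x. x \<in> carrier H \<and> vdist Hc (A k) (to_completion H x) < 1 / Suc k"
      using completion_approx[OF C.cauchy_closed[OF A]] by (metis of_nat_0_less_iff zero_less_Suc zero_less_divide_1_iff)
    then obtain p where p: "\<And>k. p k \<in> carrier H"
      "\<And>k. vdist Hc (A k) (to_completion H (p k)) < 1 / Suc k" by metis
    have small: "\<exists>N. \<forall>k\<ge>N. 1 / Suc k < r" if "r > 0" for r :: real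
      using LIMSEQ_D[OF LIMSEQ_Suc[OF lim_1_over_n[where 'a = real]] that] by auto
    have pC: "p \<in> cauchy_seqs H"
    proof (rule cauchyI)
      fix e :: real assume e: "e > 0"
      then have e3: "e / 3 > 0" by simp
      obtain N where N: "\<And>m n. m \<ge> N \<Longrightarrow> n \<ge> N \<Longrightarrow> vdist Hc (A m) (A n) < e / 3"
        using A e3 unfolding cauchy_seqs_def by blast
      obtain M where M: "\<forall>k\<ge>M. 1 / Suc k < e / 3" using small[OF e3] by blast
      have "vdist H (p m) (p n) < e" if "m \<ge> max N M" "n \<ge> m" for m n
      proof -
        let ?p = "\<lambda>k. to_completion H (p k)"
        have c: "?p k \<in> carrier Hc" "A k \<in> carrier Hc" for k
          using p C.cauchy_closed[OF A] by auto
        have "vdist H (p m) (p n) = vdist Hc (?p m) (?p n)"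
          using p by (simp add: to_completion_vdist)
        also have "\<dots> \<le> vdist Hc (?p m) (A m) + (vdist Hc (A m) (A n)
            + vdist Hc (A n) (?p n))"
          using C.vdist_triangle[of "?p m" "A m" "?p n"] C.vdist_triangle[of "A m" "A n" "?p n"] c by force
        also have "\<dots> < e / 3 + (e / 3 + e / 3)"
          using p(2)[of m] p(2)[of n] M[rule_format, of m] M[rule_format, of n] N[of m n] that
            C.vdist_commute[OF c(1)[of m] c(2)[of m]] by (intro add_strict_mono) auto
        finally show ?thesis by simp
      qed
      then show "\<exists>N. \<forall>m\<ge>N. \<forall>n\<ge>m. vdist H (p m) (p n) < e" by blast
    qed (use p in auto)
    have "vlim Hc A (cclass p)"
      unfolding vlim_def
    proof (rule LIMSEQ_I)
      fix r :: real assume "r > 0"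
      then have r2: "r / 2 > 0" by simp
      obtain N where N: "\<And>k. k \<ge> N \<Longrightarrow> vdist Hc (cclass p) (to_completion H (p k)) < r / 2"
        using cclass_approx[OF pC r2] by blast
      obtain M where M: "\<forall>k\<ge>M. 1 / Suc k < r / 2" using small[OF r2] by blast
      have "norm (vdist Hc (A k) (cclass p) - 0) < r" if "k \<ge> max N M" for k
      proof -
        have c: "A k \<in> carrier Hc" "to_completion H (p k) \<in> carrier Hc"
          "cclass p \<in> carrier Hc"
          using p(1) C.cauchy_closed[OF A] cclass_closed[OF pC] by auto
        then show ?thesis
          using C.vdist_triangle[OF c(1,2,3)] C.vdist_commute[OF c(2,3)] N[of k] p(2)[of k]
            M[rule_format, of k] that by simp
      qed
      then show "\<exists>N. \<forall>k\<ge>N. norm (vdist Hc (A k) (cclass p) - 0) < r" by blast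
    qed
    then show "\<exists>x\<in>carrier Hc. (\<lambda>k. vdist Hc (A k) x) \<longlonglongrightarrow> 0"
      using cclass_closed[OF pC] unfolding vlim_def by blast
  qed
qed

end


section \<open>Positive semidefinite kernels\<close>

text \<open>Positivity is stated for real parts, so hermitian symmetry is a clause of its own. Lists
  may repeat a point, which amounts to adding its coefficients.\<close>

definition psd_kernel :: "('i \<Rightarrow> 'i \<Rightarrow> complex) \<Rightarrow> 'i set \<Rightarrow> bool" where
  "psd_kernel \<kappa> X \<longleftrightarrow> (\<forall>x\<in>X. \<forall>y\<in>X. \<kappa> y x = cnj (\<kappa> x y)) \<and>
     (\<forall>l. snd ` set l \<subseteq> X \<longrightarrow> 0 \<le> Re (kernel_form \<kappa> l l))"

lemma kernel_form_Nil [simp]: "kernel_form \<kappa> [] l = 0" "kernel_form \<kappa> l [] = 0"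
  by (simp_all add: kernel_form_def)

lemma cnj_sum_list: "cnj (\<Sum>x\<leftarrow>l. f x) = (\<Sum>x\<leftarrow>l. cnj (f x))"
  by (induction l) simp_all

lemma kernel_form_one: "kernel_form (\<lambda>x y. 1) l l' = (\<Sum>p\<leftarrow>l. fst p) * cnj (\<Sum>p\<leftarrow>l'. fst p)"
  by (simp add: kernel_form_def sum_list_mult_const cnj_sum_list)

lemma kernel_form_Cons_Cons:
  "kernel_form \<kappa> ((t, a) # l) ((t, a) # l) = t * cnj t * \<kappa> a a
     + t * (\<Sum>q\<leftarrow>l. cnj (fst q) * \<kappa> a (snd q)) + cnj t * (\<Sum>p\<leftarrow>l. fst p * \<kappa> (snd p) a)
     + kernel_form \<kappa> l l"
  by (simp add: kernel_form_def distrib_left sum_list_addf sum_list_const_mult algebra_simps)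

lemma kernel_form_add:
  "kernel_form (\<lambda>x y. \<kappa> x y + \<kappa>' x y) l l' = kernel_form \<kappa> l l' + kernel_form \<kappa>' l l'"
  by (simp add: kernel_form_def distrib_left sum_list_addf)

lemma kernel_form_scale: "kernel_form (\<lambda>x y. c * \<kappa> x y) l l' = c * kernel_form \<kappa> l l'"
  by (simp add: kernel_form_def sum_list_const_mult mult.left_commute)

lemma snd_set_map_coeff: "snd ` set (map (\<lambda>(c, x). (f c x, x)) l) = snd ` set l"
  by (induction l) auto

text \<open>A factor \<open>f x * cnj (f y)\<close> is absorbed into the coefficients. In the Schur
  product theorem this handles the rank one correction that separates a kernel from its Schur
  complement.\<close>

lemma kernel_form_rank_one:
  "kernel_form (\<lambda>x y. f x * cnj (f y) * \<kappa> x y) l l'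
     = kernel_form \<kappa> (map (\<lambda>(c, x). (c * f x, x)) l) (map (\<lambda>(c, x). (c * f x, x)) l')"
proof -
  have *: "fst p * (\<Sum>q\<leftarrow>l'. cnj (fst q) * (f (snd p) * cnj (f (snd q)) * \<kappa> (snd p) (snd q)))
      = fst p * f (snd p) * (\<Sum>q\<leftarrow>l'. cnj (fst q * f (snd q)) * \<kappa> (snd p) (snd q))" for p
    unfolding mult.assoc sum_list_const_mult[symmetric]
    by (simp add: mult_ac)
  show ?thesis
    unfolding kernel_form_def * by (simp add: o_def case_prod_unfold)
qed

lemma psd_kernel_herm: "psd_kernel \<kappa> X \<Longrightarrow> x \<in> X \<Longrightarrow> y \<in> X \<Longrightarrow> \<kappa> y x = cnj (\<kappa> x y)"
  unfolding psd_kernel_def by blast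

lemma psd_kernel_pos: "psd_kernel \<kappa> X \<Longrightarrow> snd ` set l \<subseteq> X \<Longrightarrow> 0 \<le> Re (kernel_form \<kappa> l l)"
  unfolding psd_kernel_def by blast

lemma psd_kernel_diag:
  assumes "psd_kernel \<kappa> X" "x \<in> X"
  obtains d where "d \<ge> 0" "\<kappa> x x = complex_of_real d"
proof -
  have "Im (\<kappa> x x) = 0" using psd_kernel_herm[OF assms(1,2,2)] by (simp add: complex_eq_iff)
  moreover have "0 \<le> Re (\<kappa> x x)"
    using psd_kernel_pos[OF assms(1), of "[(1, x)]"] assms(2) by (simp add: kernel_form_def)
  ultimately show thesis using that[of "Re (\<kappa> x x)"] by (simp add: complex_eq_iff)
qed

text \<open>Positivity of the form on the two points \<open>a\<close> and \<open>y\<close>: with a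
  zero diagonal entry at \<open>a\<close>, a nonzero off-diagonal entry could be scaled until it
  outweighs \<open>\<kappa> y y\<close>.\<close>

lemma psd_kernel_zero:
  assumes k: "psd_kernel \<kappa> X" and a: "a \<in> X" and y: "y \<in> X" and 0: "\<kappa> a a = 0"
  shows "\<kappa> a y = 0"
proof (rule ccontr)
  assume nz: "\<kappa> a y \<noteq> 0"
  define z where "z = \<kappa> a y"
  define N where "N = Re (\<kappa> y y)"
  \<comment> \<open>Chosen so that the two cross terms contribute \<open>- 2 * (N + 1)\<close>,
    against the single diagonal term \<open>N\<close>.\<close>
  define s where "s = (N + 1) / (cmod z)\<^sup>2"
  define t where "t = - complex_of_real s * cnj z"
  have tz: "t * z = - complex_of_real (N + 1)"
  proof -
    have "t * z = - complex_of_real s * (z * cnj z)" by (simp add: t_def)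
    also have "\<dots> = - complex_of_real (s * (cmod z)\<^sup>2)"
      unfolding complex_norm_square[symmetric] by simp
    also have "s * (cmod z)\<^sup>2 = N + 1" using nz by (simp add: s_def z_def)
    finally show ?thesis .
  qed
  have "0 \<le> Re (kernel_form \<kappa> [(t, a), (1, y)] [(t, a), (1, y)])"
    using psd_kernel_pos[OF k] a y by simp
  also have "kernel_form \<kappa> [(t, a), (1, y)] [(t, a), (1, y)] = t * z + cnj (t * z) + \<kappa> y y"
    using psd_kernel_herm[OF k a y] by (simp add: kernel_form_def 0 z_def algebra_simps)
  also have "Re \<dots> = - N - 2" by (simp add: tz N_def)
  finally have "N \<le> -2" by simp
  then show False
    using psd_kernel_diag[OF k y] by (metis N_def Re_complex_of_real neg_0_le_iff_le
      le_minus_iff not_numeral_le_zero order_trans)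
qed

text \<open>If \<open>\<kappa> a a = 0\<close>, division by zero makes the correction term vanish, as it should.\<close>

definition schur_complement :: "('i \<Rightarrow> 'i \<Rightarrow> complex) \<Rightarrow> 'i \<Rightarrow> 'i \<Rightarrow> 'i \<Rightarrow> complex" where
  "schur_complement \<kappa> a x y = \<kappa> x y - \<kappa> x a * \<kappa> a y / \<kappa> a a"

text \<open>Subtracting the correction clears row and column \<open>a\<close>. If
  \<open>\<kappa> a a = 0\<close> there is no correction, and row and column vanish already by
  \<open>psd_kernel_zero\<close>.\<close>

lemma schur_complement_zero:
  assumes k: "psd_kernel \<kappa> X" and "a \<in> X" "x \<in> X"
  shows "schur_complement \<kappa> a a x = 0" "schur_complement \<kappa> a x a = 0"
  using psd_kernel_zero[OF assms] psd_kernel_herm[OF assms] by (auto simp: schur_complement_def)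

text \<open>One step of Gaussian elimination at \<open>a\<close>, multiplied entrywise by
  \<open>\<mu>\<close>: the rank one part becomes a form of \<open>\<mu>\<close> with changed
  coefficients. The identity survives \<open>d = 0\<close>, where division by zero and
  \<open>inverse 0\<close> both give zero.\<close>

lemma kernel_form_schur:
  assumes k: "psd_kernel \<kappa> X" and a: "a \<in> X" and d: "\<kappa> a a = complex_of_real d"
    and l: "snd ` set l \<subseteq> X"
  shows "kernel_form (\<lambda>x y. \<kappa> x y * \<mu> x y) l l = kernel_form (\<lambda>x y. schur_complement \<kappa> a x y * \<mu> x y) l l
    + complex_of_real (inverse d) *
      kernel_form \<mu> (map (\<lambda>(c, x). (c * \<kappa> x a, x)) l) (map (\<lambda>(c, x). (c * \<kappa> x a, x)) l)"
  unfolding kernel_form_rank_one[symmetric] kernel_form_scale[symmetric] kernel_form_add[symmetric]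
proof (rule kernel_form_cong)
  fix x y assume "x \<in> snd ` set l" "y \<in> snd ` set l"
  then have "\<kappa> a y = cnj (\<kappa> y a)" using psd_kernel_herm[OF k, of y a] a l by auto
  then show "\<kappa> x y * \<mu> x y = schur_complement \<kappa> a x y * \<mu> x y
      + complex_of_real (inverse d) * (\<kappa> x a * cnj (\<kappa> y a) * \<mu> x y)"
    by (simp add: schur_complement_def d field_simps)
qed

text \<open>Completing the square: among all coefficients for an adjoined point \<open>a\<close>,
  the value \<open>t = - s / d\<close> minimises the form of \<open>\<kappa>\<close>, and the
  minimum is the form of the Schur complement.\<close>

lemma psd_schur_complement:
  assumes k: "psd_kernel \<kappa> X" and a: "a \<in> X"
  shows "psd_kernel (schur_complement \<kappa> a) X"
proof -
  obtain d where d: "d \<ge> 0" "\<kappa> a a = complex_of_real d" using psd_kernel_diag[OF k a] .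
  show ?thesis
    unfolding psd_kernel_def
  proof (intro conjI ballI allI impI)
    fix x y assume "x \<in> X" "y \<in> X"
    then show "schur_complement \<kappa> a y x = cnj (schur_complement \<kappa> a x y)"
      using psd_kernel_herm[OF k, of x y] psd_kernel_herm[OF k, of x a] psd_kernel_herm[OF k, of a y] a
      by (simp add: schur_complement_def d mult.commute)
  next
    fix l :: "(complex \<times> 'a) list" assume l: "snd ` set l \<subseteq> X"
    show "0 \<le> Re (kernel_form (schur_complement \<kappa> a) l l)"
    proof (cases "d = 0")
      case True
      then have "schur_complement \<kappa> a = \<kappa>" by (intro ext) (simp add: schur_complement_def d)
      then show ?thesis using psd_kernel_pos[OF k l] by simp
    next
      case False
      define s where "s = (\<Sum>p\<leftarrow>l. fst p * \<kappa> (snd p) a)"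
      define t where "t = - s / complex_of_real d"
      have s': "(\<Sum>q\<leftarrow>l. cnj (fst q) * \<kappa> a (snd q)) = cnj s"
        unfolding s_def cnj_sum_list
      proof (intro arg_cong[where f = sum_list] map_cong refl)
        fix q assume "q \<in> set l"
        then have "\<kappa> a (snd q) = cnj (\<kappa> (snd q) a)" using psd_kernel_herm[OF k, of "snd q" a] a l by auto
        then show "cnj (fst q) * \<kappa> a (snd q) = cnj (fst q * \<kappa> (snd q) a)" by simp
      qed
      have one: "kernel_form (\<lambda>x y. 1) (map (\<lambda>(c, x). (c * \<kappa> x a, x)) l) (map (\<lambda>(c, x). (c * \<kappa> x a, x)) l)
          = s * cnj s"
        by (simp add: kernel_form_one s_def o_def case_prod_unfold)
      have "kernel_form \<kappa> l l = kernel_form (schur_complement \<kappa> a) l l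
          + complex_of_real (inverse d) * (s * cnj s)"
        using kernel_form_schur[OF k a d(2) l, of "\<lambda>x y. 1"] unfolding one by simp
      then have "kernel_form \<kappa> ((t, a) # l) ((t, a) # l) = kernel_form (schur_complement \<kappa> a) l l"
        unfolding kernel_form_Cons_Cons s' s_def[symmetric] d using False
        by (simp add: t_def field_simps)
      then show ?thesis using psd_kernel_pos[OF k, of "(t, a) # l"] a l by simp
    qed
  qed
qed

text \<open>Elimination, point by point along the list. The Schur complement at the first point
  \<open>a\<close> has zero row and column there, so its form is that of the shorter list, even if
  \<open>a\<close> occurs again; the rank one part is a form of \<open>\<mu>\<close>. The kernel
  changes in each step, so the induction runs over all kernels.\<close>

theorem schur_product:
  assumes k1: "psd_kernel \<kappa> X" and k2: "psd_kernel \<mu> X"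
  shows "psd_kernel (\<lambda>x y. \<kappa> x y * \<mu> x y) X"
proof -
  have "0 \<le> Re (kernel_form (\<lambda>x y. \<kappa> x y * \<mu> x y) l l)"
    if "psd_kernel \<kappa> X" "snd ` set l \<subseteq> X" for l \<kappa>
    using that
  proof (induction l arbitrary: \<kappa>)
    case (Cons p l)
    obtain c a where p: "p = (c, a)" by (cases p)
    have a: "a \<in> X" and l: "snd ` set l \<subseteq> X" using Cons.prems(2) p by auto
    obtain d where d: "d \<ge> 0" "\<kappa> a a = complex_of_real d" using psd_kernel_diag[OF Cons.prems(1) a] .
    let ?S = "\<lambda>x y. schur_complement \<kappa> a x y * \<mu> x y"
    let ?m = "map (\<lambda>(c, x). (c * \<kappa> x a, x)) (p # l)"
    have "kernel_form ?S (p # l) (p # l) = kernel_form ?S l l"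
    proof -
      have *: "schur_complement \<kappa> a a (snd q) = 0 \<and> schur_complement \<kappa> a (snd q) a = 0"
        if "q \<in> set l" for q
        using schur_complement_zero[OF Cons.prems(1) a, of "snd q"] l that by auto
      have "(\<Sum>q\<leftarrow>l. cnj (fst q) * ?S a (snd q)) = 0" "(\<Sum>p\<leftarrow>l. fst p * ?S (snd p) a) = 0"
        using * by (simp_all cong: map_cong)
      then show ?thesis
        unfolding p kernel_form_Cons_Cons using schur_complement_zero[OF Cons.prems(1) a a] by simp
    qed
    then have "Re (kernel_form (\<lambda>x y. \<kappa> x y * \<mu> x y) (p # l) (p # l))
        = Re (kernel_form ?S l l) + inverse d * Re (kernel_form \<mu> ?m ?m)"
      using kernel_form_schur[OF Cons.prems(1) a d(2) Cons.prems(2), of \<mu>]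
      by (simp del: list.map of_real_inverse)
    moreover have "0 \<le> Re (kernel_form ?S l l)"
      using Cons.IH[OF psd_schur_complement[OF Cons.prems(1) a] l] .
    moreover have "snd ` set ?m \<subseteq> X" using Cons.prems(2) unfolding snd_set_map_coeff .
    then have "0 \<le> Re (kernel_form \<mu> ?m ?m)" by (rule psd_kernel_pos[OF k2])
    ultimately show ?case using d(1) by simp
  qed simp
  moreover have "\<kappa> y x * \<mu> y x = cnj (\<kappa> x y * \<mu> x y)" if "x \<in> X" "y \<in> X" for x y
    using psd_kernel_herm[OF k1 that] psd_kernel_herm[OF k2 that] by simp
  ultimately show ?thesis using k1 unfolding psd_kernel_def[of "\<lambda>x y. _ x y * _ x y"] by blast
qed

lemma psd_kernel_one: "psd_kernel (\<lambda>x y. 1) X"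
  by (simp add: psd_kernel_def kernel_form_one)

lemma psd_kernel_prod:
  assumes "finite I" "\<And>i. i \<in> I \<Longrightarrow> psd_kernel (\<kappa> i) X"
  shows "psd_kernel (\<lambda>x y. \<Prod>i\<in>I. \<kappa> i x y) X"
  using assms
proof (induction I rule: finite_induct)
  case (insert i I)
  then show ?case using schur_product[of "\<kappa> i" X "\<lambda>x y. \<Prod>i\<in>I. \<kappa> i x y"] by simp
qed (simp add: psd_kernel_one)

lemma (in semi_inner_product_space) psd_kernel_inner:
  assumes "\<And>x. x \<in> X \<Longrightarrow> f x \<in> carrier H"
  shows "psd_kernel (\<lambda>x y. vinner H (f x) (f y)) X"
  unfolding psd_kernel_def
proof (intro conjI ballI allI impI)
  fix l :: "(complex \<times> 'b) list" assume "snd ` set l \<subseteq> X"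
  then show "0 \<le> Re (kernel_form (\<lambda>x y. vinner H (f x) (f y)) l l)"
    using inner_lincomb[where X = X and e = f, OF assms, of l l, symmetric] assms
    by (simp add: inner_nonneg lincomb_closed[where X = X])
qed (intro inner_cnj assms)

subsection \<open>The Hilbert space of a kernel\<close>

context
  fixes \<kappa> :: "'i \<Rightarrow> 'i \<Rightarrow> complex" and X :: "'i set"
  assumes k: "psd_kernel \<kappa> X"
begin

private abbreviation (input) "F \<equiv> free_space X \<kappa>"

lemma free_space_carrier: "c \<in> carrier F \<longleftrightarrow> finite {x. c x \<noteq> 0} \<and> {x. c x \<noteq> 0} \<subseteq> X"
  by (simp add: free_space_def)

lemma free_space_inner:
  assumes "finite A" "{x. c x \<noteq> 0} \<subseteq> A" "finite B" "{x. d x \<noteq> 0} \<subseteq> B"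
  shows "vinner F c d = (\<Sum>x\<in>A. \<Sum>y\<in>B. c x * cnj (d y) * \<kappa> x y)"
proof -
  have "vinner F c d = (\<Sum>x | c x \<noteq> 0. \<Sum>y | d y \<noteq> 0. c x * cnj (d y) * \<kappa> x y)"
    by (simp add: free_space_def)
  also have "\<dots> = (\<Sum>x | c x \<noteq> 0. \<Sum>y\<in>B. c x * cnj (d y) * \<kappa> x y)"
    by (intro sum.cong refl sum.mono_neutral_left) (use assms in auto)
  also have "\<dots> = (\<Sum>x\<in>A. \<Sum>y\<in>B. c x * cnj (d y) * \<kappa> x y)"
    by (intro sum.mono_neutral_left) (use assms in auto)
  finally show ?thesis .
qed

text \<open>Enumerating the support by a distinct list carries positivity from lists, where
  \<open>psd_kernel\<close> states it, to finitely supported functions.\<close>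

lemma free_space_lincomb:
  assumes c: "c \<in> carrier F"
  obtains l where "snd ` set l \<subseteq> X" "c = lincomb F (\<lambda>x y. if y = x then 1 else 0) l"
    "vinner F c c = kernel_form \<kappa> l l"
proof -
  obtain xs where xs: "distinct xs" "set xs = {x. c x \<noteq> 0}"
    using c finite_distinct_list by (metis free_space_carrier)
  define l where "l = map (\<lambda>x. (c x, x)) xs"
  have l: "snd ` set l \<subseteq> X" using c xs by (auto simp: l_def free_space_carrier)
  have *: "lincomb F (\<lambda>x y. if y = x then 1 else 0) m y = (\<Sum>p\<leftarrow>m. fst p * (if y = snd p then 1 else 0))"
    for m :: "(complex \<times> 'i) list" and y
    by (induction m) (simp_all add: free_space_def)
  have "lincomb F (\<lambda>x y. if y = x then 1 else 0) l y = c y" for y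
  proof -
    have "lincomb F (\<lambda>x y. if y = x then 1 else 0) l y = (\<Sum>x\<leftarrow>xs. c x * (if y = x then 1 else 0))"
      unfolding * by (simp add: l_def o_def)
    also have "\<dots> = (\<Sum>x\<in>set xs. c x * (if y = x then 1 else 0))"
      using xs(1) by (rule sum_list_distinct_conv_sum_set)
    also have "\<dots> = c y" by (simp add: if_distrib[of "(*) _"] cong: if_cong) (use xs(2) in auto)
    finally show ?thesis .
  qed
  moreover have "vinner F c c = kernel_form \<kappa> l l"
    using xs
    by (simp add: free_space_def kernel_form_def l_def o_def sum_list_distinct_conv_sum_set
        sum_distrib_left mult.assoc)
  ultimately show thesis using that l by (metis ext)
qed

lemma free_space_semi_inner_product_space: "semi_inner_product_space F"
proof
  note fs = free_space_carrier
  have fin: "finite {x. c x + d x \<noteq> 0} \<and> {x. c x + d x \<noteq> 0} \<subseteq> X"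
    if "c \<in> carrier F" "d \<in> carrier F" for c d :: "'i \<Rightarrow> complex"
  proof
    have *: "{x. c x + d x \<noteq> 0} \<subseteq> {x. c x \<noteq> 0} \<union> {x. d x \<noteq> 0}" by auto
    show "finite {x. c x + d x \<noteq> 0}" using that unfolding fs by (intro finite_subset[OF *]) auto
    show "{x. c x + d x \<noteq> 0} \<subseteq> X" using that * unfolding fs by blast
  qed
  show "vadd F c d \<in> carrier F" if "c \<in> carrier F" "d \<in> carrier F" for c d
    using fin[OF that] by (simp add: free_space_def)
  show "vzero F \<in> carrier F" by (simp add: free_space_def)
  show "vscale F a c \<in> carrier F" if "c \<in> carrier F" for a c
    using that by (auto simp: free_space_def)
  show "vinner F (vadd F c c') d = vinner F c d + vinner F c' d"
    if "c \<in> carrier F" "c' \<in> carrier F" "d \<in> carrier F" for c c' d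
  proof -
    let ?A = "{x. c x \<noteq> 0} \<union> {x. c' x \<noteq> 0}" and ?B = "{x. d x \<noteq> 0}"
    have A: "finite ?A" "finite ?B" using that by (auto simp: fs)
    have "vadd F c c' = (\<lambda>x. c x + c' x)" by (simp add: free_space_def)
    moreover have "{x. c x + c' x \<noteq> 0} \<subseteq> ?A" by auto
    ultimately show ?thesis
      using A by (simp add: free_space_inner[of ?A _ ?B] distrib_left distrib_right sum.distrib
          del: Un_iff)
  qed
  show "vinner F (vscale F a c) d = a * vinner F c d"
    if "c \<in> carrier F" "d \<in> carrier F" for a c d
  proof -
    let ?A = "{x. c x \<noteq> 0}" and ?B = "{x. d x \<noteq> 0}"
    have A: "finite ?A" "finite ?B" using that by (auto simp: fs)
    have "vscale F a c = (\<lambda>x. a * c x)" by (simp add: free_space_def)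
    moreover have "{x. a * c x \<noteq> 0} \<subseteq> ?A" by auto
    ultimately show ?thesis
      using A by (simp add: free_space_inner[of ?A _ ?B] sum_distrib_left mult.assoc)
  qed
  show "vinner F d c = cnj (vinner F c d)" if "c \<in> carrier F" "d \<in> carrier F" for c d
  proof -
    let ?A = "{x. c x \<noteq> 0}" and ?B = "{x. d x \<noteq> 0}"
    have A: "finite ?A" "finite ?B" "?A \<subseteq> X" "?B \<subseteq> X" using that by (auto simp: fs)
    have "vinner F d c = (\<Sum>x\<in>?A. \<Sum>y\<in>?B. d y * cnj (c x) * \<kappa> y x)"
      using A by (simp add: free_space_inner[of ?B _ ?A]) (rule sum.swap)
    also have "\<dots> = (\<Sum>x\<in>?A. \<Sum>y\<in>?B. cnj (c x * cnj (d y) * \<kappa> x y))"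
    proof (intro sum.cong refl)
      fix x y assume "x \<in> ?A" "y \<in> ?B"
      then have "\<kappa> y x = cnj (\<kappa> x y)" using A by (intro psd_kernel_herm[OF k]) auto
      then show "d y * cnj (c x) * \<kappa> y x = cnj (c x * cnj (d y) * \<kappa> x y)" by (simp add: mult_ac)
    qed
    also have "\<dots> = cnj (vinner F c d)"
      using A by (simp add: free_space_inner[of ?A _ ?B])
    finally show ?thesis .
  qed
  show "0 \<le> Re (vinner F c c)" if "c \<in> carrier F" for c
    using free_space_lincomb[OF that] psd_kernel_pos[OF k] by metis
qed (auto simp: free_space_def algebra_simps)

lemma free_space_delta:
  assumes "x \<in> X"
  shows "(\<lambda>y. if y = x then 1 else 0) \<in> carrier F"
  using assms by (auto simp: free_space_carrier)

lemma free_space_delta_inner: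
  "vinner F (\<lambda>y. if y = a then 1 else 0) (\<lambda>y. if y = b then 1 else 0) = \<kappa> a b"
  by (simp add: free_space_inner[of "{a}" _ "{b}"])

text \<open>The Kolmogorov construction: a positive semidefinite kernel is the Gram kernel of a
  total family in a Hilbert space. For the product kernel this gives the finite tensor products, and
  all facts about them below rest on these four statements.\<close>

lemma free_space_completion:
  fixes e defines "e \<equiv> \<lambda>x. to_completion F (\<lambda>y. if y = x then 1 else 0)"
  shows "hilbert_space (completion F)" "x \<in> X \<Longrightarrow> e x \<in> carrier (completion F)"
    "x \<in> X \<Longrightarrow> y \<in> X \<Longrightarrow> vinner (completion F) (e x) (e y) = \<kappa> x y"
    "vdense (completion F) e X"
proof -
  interpret S: semi_inner_product_space F by (rule free_space_semi_inner_product_space)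
  show "hilbert_space (completion F)" by (rule S.completion_hilbert_space)
  show "x \<in> X \<Longrightarrow> e x \<in> carrier (completion F)"
    by (simp add: e_def free_space_delta)
  show "x \<in> X \<Longrightarrow> y \<in> X \<Longrightarrow> vinner (completion F) (e x) (e y) = \<kappa> x y"
    by (simp add: e_def S.to_completion_inner free_space_delta free_space_delta_inner)
  have "vdense F (\<lambda>x y. if y = x then 1 else 0) X"
    unfolding vdense_def using free_space_lincomb S.vdist_self by metis
  then show "vdense (completion F) e X"
    unfolding e_def by (rule S.completion_vdense) (rule free_space_delta)
qed

end


section \<open>Isometries\<close>

definition isometry_op :: "'a cspace \<Rightarrow> 'b cspace \<Rightarrow> ('a \<Rightarrow> 'b) \<Rightarrow> bool" where
  "isometry_op H K V \<longleftrightarrow> V \<in> bounded_ops H K \<and>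
     (\<forall>x\<in>carrier H. \<forall>y\<in>carrier H. vinner K (V x) (V y) = vinner H x y)"

lemma isometry_opD:
  assumes "isometry_op H K V"
  shows "V \<in> bounded_ops H K"
    "x \<in> carrier H \<Longrightarrow> y \<in> carrier H \<Longrightarrow> vinner K (V x) (V y) = vinner H x y"
    "x \<in> carrier H \<Longrightarrow> vnorm K (V x) = vnorm H x"
  using assms by (auto simp: isometry_op_def vnorm_def)

lemma isometry_op_vdist:
  assumes H: "inner_product_space H" and V: "isometry_op H K V" and xy: "x \<in> carrier H" "y \<in> carrier H"
  shows "vdist K (V x) (V y) = vdist H x y"
proof -
  interpret H: inner_product_space H by (rule H)
  show ?thesis
    using isometry_opD(3)[OF V, of "vminus H x y"] bounded_opsD(2,3)[OF isometry_opD(1)[OF V]] xy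
    by (simp add: vdist_def)
qed

lemma isometry_opI:
  assumes H: "inner_product_space H" and V: "V \<in> extensional (carrier H)"
    "\<And>x. x \<in> carrier H \<Longrightarrow> V x \<in> carrier K"
    "\<And>x y. x \<in> carrier H \<Longrightarrow> y \<in> carrier H \<Longrightarrow> V (vadd H x y) = vadd K (V x) (V y)"
    "\<And>a x. x \<in> carrier H \<Longrightarrow> V (vscale H a x) = vscale K a (V x)"
    "\<And>x y. x \<in> carrier H \<Longrightarrow> y \<in> carrier H \<Longrightarrow> vinner K (V x) (V y) = vinner H x y"
  shows "isometry_op H K V"
proof -
  have "vnorm K (V x) \<le> 1 * vnorm H x" if "x \<in> carrier H" for x
    using V(5)[OF that that] by (simp add: vnorm_def)
  then have "V \<in> bounded_ops H K" using V by (intro bounded_opsI[where C = 1])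
  then show ?thesis using V(5) by (simp add: isometry_op_def)
qed

text \<open>Equal Gram kernels mean equal norms of all linear combinations, so
  \<open>bounded_extension\<close> applies with constant 1; preservation of inner products extends
  from combinations by density.\<close>

lemma isometric_extension:
  assumes H: "inner_product_space H" and K: "hilbert_space K"
    and d: "vdense H e X" and e: "\<And>x. x \<in> X \<Longrightarrow> e x \<in> carrier H"
    and f: "\<And>x. x \<in> X \<Longrightarrow> f x \<in> carrier K"
    and eq: "\<And>x y. x \<in> X \<Longrightarrow> y \<in> X \<Longrightarrow> vinner K (f x) (f y) = vinner H (e x) (e y)"
  shows "\<exists>V. isometry_op H K V \<and> (\<forall>x\<in>X. V (e x) = f x)"
proof -
  interpret H: inner_product_space H by (rule H)
  interpret K: hilbert_space K by (rule K)
  have inn: "vinner K (lincomb K f l) (lincomb K f l') = vinner H (lincomb H e l) (lincomb H e l')"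
    if l: "snd ` set l \<subseteq> X" and l': "snd ` set l' \<subseteq> X" for l l'
  proof -
    have "kernel_form (\<lambda>x y. vinner K (f x) (f y)) l l' = kernel_form (\<lambda>x y. vinner H (e x) (e y)) l l'"
      by (rule kernel_form_cong) (rule eq[OF subsetD[OF l] subsetD[OF l']])
    then show ?thesis
      using H.inner_lincomb[where X = X and e = e, OF e l l']
        K.inner_lincomb[where X = X and e = f, OF f l l'] by simp
  qed
  have "vnorm K (lincomb K f l) \<le> 1 * vnorm H (lincomb H e l)" if "snd ` set l \<subseteq> X" for l
    using inn[OF that that] by (simp add: vnorm_def)
  from bounded_extension[where e = e and X = X and f = f and C = 1, OF H K d e f _ this] obtain V
    where V: "V \<in> bounded_ops H K" "\<And>x. x \<in> X \<Longrightarrow> V (e x) = f x" by auto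
  have Vl: "V (lincomb H e l) = lincomb K f l" if "snd ` set l \<subseteq> X" for l
  proof -
    have "lincomb K (\<lambda>x. V (e x)) l = lincomb K f l" using that V(2) by (induction l) auto
    then show ?thesis
      using bounded_ops_lincomb[OF H K.inner_product_space_axioms V(1), where e = e and X = X, OF e that]
      by simp
  qed
  have "vinner K (V v) (V w) = vinner H v w" if v: "v \<in> carrier H" and w: "w \<in> carrier H" for v w
  proof -
    obtain ls where ls: "\<And>k. snd ` set (ls k) \<subseteq> X" "vlim H (\<lambda>k. lincomb H e (ls k)) v"
      using H.vdense_seq[OF d v e] by blast
    obtain ms where ms: "\<And>k. snd ` set (ms k) \<subseteq> X" "vlim H (\<lambda>k. lincomb H e (ms k)) w"
      using H.vdense_seq[OF d w e] by blast
    have c: "lincomb H e (ls k) \<in> carrier H" "lincomb H e (ms k) \<in> carrier H" for k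
      by (rule H.lincomb_closed[where X = X, OF e ls(1)], assumption)
        (rule H.lincomb_closed[where X = X, OF e ms(1)], assumption)
    note lim = bounded_ops_vlim[OF H K.inner_product_space_axioms V(1)]
    have "(\<lambda>k. vinner K (V (lincomb H e (ls k))) (V (lincomb H e (ms k)))) \<longlonglongrightarrow> vinner K (V v) (V w)"
      using c v w bounded_opsD(1)[OF V(1)] by (intro K.vlim_inner lim ls(2) ms(2)) auto
    then have "(\<lambda>k. vinner H (lincomb H e (ls k)) (lincomb H e (ms k))) \<longlonglongrightarrow> vinner K (V v) (V w)"
      using ls(1) ms(1) by (simp add: Vl inn)
    moreover have "(\<lambda>k. vinner H (lincomb H e (ls k)) (lincomb H e (ms k))) \<longlonglongrightarrow> vinner H v w"
      using c v w by (intro H.vlim_inner ls(2) ms(2)) auto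
    ultimately show ?thesis by (rule LIMSEQ_unique)
  qed
  then show ?thesis using V unfolding isometry_op_def by blast
qed


section \<open>Adjoints and unitaries\<close>

definition rank_one :: "'a cspace \<Rightarrow> 'a \<Rightarrow> 'a \<Rightarrow> 'a \<Rightarrow> 'a" where
  "rank_one H x y = (\<lambda>v\<in>carrier H. vscale H (vinner H v y) x)"

context hilbert_space
begin

text \<open>The representing vector minimises \<open>\<parallel>x\<parallel>\<^sup>2 - 2 Re (f x)\<close>.\<close>

theorem Riesz_representation:
  assumes add: "\<And>x y. x \<in> carrier H \<Longrightarrow> y \<in> carrier H \<Longrightarrow> f (vadd H x y) = f x + f y"
    and scale: "\<And>a x. x \<in> carrier H \<Longrightarrow> f (vscale H a x) = a * f x"
    and bound: "\<And>x. x \<in> carrier H \<Longrightarrow> cmod (f x) \<le> C * vnorm H x"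
  shows "\<exists>y\<in>carrier H. \<forall>x\<in>carrier H. f x = vinner H x y"
proof -
  define q where "q x = (vnorm H x)\<^sup>2 - 2 * Re (f x)" for x
  \<comment> \<open>With \<open>n = vnorm H x\<close>, the value \<open>q x\<close> is at least
    \<open>n^2 - 2 * C * n\<close>, and completing the square bounds this below.\<close>
  have q_ge: "- C\<^sup>2 \<le> q x" if "x \<in> carrier H" for x
  proof -
    have "0 \<le> (vnorm H x - C)\<^sup>2" by simp
    moreover have "Re (f x) \<le> C * vnorm H x"
      using bound[OF that] complex_Re_le_cmod order_trans by blast
    ultimately show ?thesis unfolding q_def power2_diff by (simp add: mult.commute)
  qed
  define m where "m = Inf (q ` carrier H)"
  have bdd: "bdd_below (q ` carrier H)" using q_ge by (auto intro!: bdd_belowI)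
  have m_le: "m \<le> q x" if "x \<in> carrier H" for x
    unfolding m_def using bdd that by (intro cInf_lower) auto
  \<comment> \<open>Parallelogram law: \<open>q\<close> is at least \<open>m\<close> at the
    midpoint, so two near-minimisers are close together and a minimising sequence is Cauchy.\<close>
  have par: "(vdist H x y)\<^sup>2 \<le> 2 * (q x - m) + 2 * (q y - m)"
    if c: "x \<in> carrier H" "y \<in> carrier H" for x y
  proof -
    let ?h = "vscale H (1/2) (vadd H x y)"
    have "(vnorm H ?h)\<^sup>2 = (vnorm H (vadd H x y))\<^sup>2 / 4"
      using c by (simp add: power_mult_distrib power2_eq_square)
    moreover have "Re (f ?h) = (Re (f x) + Re (f y)) / 2" using c by (simp add: add scale)
    ultimately have "(vdist H x y)\<^sup>2 = 2 * q x + 2 * q y - 4 * q ?h"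
      using c by (simp add: q_def vdist_sq vnorm_add_sq field_simps)
    then show ?thesis using m_le[of ?h] c by simp
  qed
  have "\<exists>x\<in>carrier H. q x < m + 1 / Suc k" for k
  proof -
    have "Inf (q ` carrier H) < m + 1 / Suc k" by (simp add: m_def)
    then show ?thesis using cInf_lessD[of "q ` carrier H"] zero_closed by blast
  qed
  then obtain s where s: "\<And>k. s k \<in> carrier H" "\<And>k. q (s k) < m + 1 / Suc k" by metis
  have "s \<in> cauchy_seqs H"
  proof (rule cauchyI)
    fix e :: real assume e: "e > 0"
    then obtain N where N: "1 / Suc N < e\<^sup>2 / 4"
      using nat_approx_posE[of "e\<^sup>2 / 4"] by (metis zero_less_divide_iff zero_less_numeral zero_less_power)
    have "vdist H (s i) (s j) < e" if "i \<ge> N" "j \<ge> i" for i j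
    proof (rule power2_less_imp_less)
      have "1 / Suc i \<le> 1 / Suc N" "1 / Suc j \<le> 1 / Suc N" using that by (simp_all add: field_simps)
      then show "(vdist H (s i) (s j))\<^sup>2 < e\<^sup>2"
        using par[OF s(1) s(1), of i j] s(2)[of i] s(2)[of j] N by simp
    qed (use e in simp)
    then show "\<exists>N. \<forall>i\<ge>N. \<forall>j\<ge>i. vdist H (s i) (s j) < e" by blast
  qed (rule s(1))
  then obtain y where y: "y \<in> carrier H" "vlim H s y" using complete unfolding vlim_def by blast
  have "(\<lambda>k. f (s k) - f y) \<longlonglongrightarrow> 0"
  proof (rule Lim_null_comparison[OF always_eventually])
    show "(\<lambda>k. C * vdist H (s k) y) \<longlonglongrightarrow> 0"
      using y(2) unfolding vlim_def by (rule tendsto_mult_right_zero)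
    have "f (s k) - f y = f (vminus H (s k) y)" for k using s y by (simp add: add scale)
    then show "\<forall>k. norm (f (s k) - f y) \<le> C * vdist H (s k) y"
      using bound s y by (simp add: vdist_def)
  qed
  then have "(\<lambda>k. f (s k)) \<longlonglongrightarrow> f y" by (simp add: LIM_zero_iff)
  then have "(\<lambda>k. q (s k)) \<longlonglongrightarrow> q y"
    unfolding q_def by (intro tendsto_intros vlim_norm y s)
  moreover have "(\<lambda>k. m + 1 / Suc k) \<longlonglongrightarrow> m + 0"
    by (intro tendsto_add tendsto_const LIMSEQ_Suc[OF lim_1_over_n])
  ultimately have "q y \<le> m" using s(2) by (intro LIMSEQ_le[of "\<lambda>k. q (s k)"]) (auto intro: less_imp_le)
  have "f z = vinner H z y" if z: "z \<in> carrier H" for z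
  proof (rule ccontr)
    assume "f z \<noteq> vinner H z y"
    define w where "w = f z - vinner H z y"
    \<comment> \<open>Moving from \<open>y\<close> by \<open>t z\<close> changes \<open>q\<close> by
      \<open>- r * (cmod w)^2 * (2 - r * (vnorm H z)^2)\<close>. This \<open>r\<close> keeps
      \<open>r * (vnorm H z)^2\<close> below 1, so \<open>q\<close> would drop below its
      minimum.\<close>
    define r where "r = 1 / ((vnorm H z)\<^sup>2 + 1)"
    define t where "t = complex_of_real r * cnj w"
    have w: "cmod w > 0" using \<open>f z \<noteq> vinner H z y\<close> by (simp add: w_def)
    have pos: "(vnorm H z)\<^sup>2 + 1 > 0" by (simp add: add_nonneg_pos)
    then have r: "r > 0" "r * (vnorm H z)\<^sup>2 < 1" by (simp_all add: r_def)
    have "q y \<le> q (vadd H y (vscale H t z))"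
      using \<open>q y \<le> m\<close> m_le[of "vadd H y (vscale H t z)"] y z by simp
    also have "\<dots> = q y + (cmod t)\<^sup>2 * (vnorm H z)\<^sup>2 - 2 * Re (t * w)"
    proof -
      have "Re (cnj t * vinner H y z) = Re (t * vinner H z y)"
        using inner_cnj[OF z y(1)] by simp
      then show ?thesis using y z
        by (simp add: q_def vnorm_add_sq inner_simps add scale w_def power_mult_distrib algebra_simps)
    qed
    also have "t * w = complex_of_real (r * (cmod w)\<^sup>2)"
      using complex_norm_square[of w] by (simp add: t_def mult_ac)
    also have "(cmod t)\<^sup>2 = r\<^sup>2 * (cmod w)\<^sup>2" using r by (simp add: t_def norm_mult power_mult_distrib)
    finally have "2 * (r * (cmod w)\<^sup>2) \<le> (r * (cmod w)\<^sup>2) * (r * (vnorm H z)\<^sup>2)"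
      by (simp add: power2_eq_square mult_ac)
    moreover have "(r * (cmod w)\<^sup>2) * (r * (vnorm H z)\<^sup>2) \<le> (r * (cmod w)\<^sup>2) * 1"
      using r w by (intro mult_left_mono) auto
    moreover have "r * (cmod w)\<^sup>2 > 0" using r w by simp
    ultimately show False by simp
  qed
  then show ?thesis using y by blast
qed

lemma adjoint_exists:
  assumes T: "T \<in> B_of H"
  shows "\<exists>S\<in>B_of H. \<forall>x\<in>carrier H. \<forall>y\<in>carrier H. vinner H (T x) y = vinner H x (S y)"
proof -
  obtain C where C: "C \<ge> 0" "\<And>x. x \<in> carrier H \<Longrightarrow> vnorm H (T x) \<le> C * vnorm H x"
    using bounded_ops_bound[OF inner_product_space_axioms inner_product_space_axioms T] by blast
  note TD = bounded_opsD[OF T]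
  have "\<exists>z\<in>carrier H. \<forall>x\<in>carrier H. vinner H (T x) y = vinner H x z" if y: "y \<in> carrier H" for y
  proof (rule Riesz_representation[where C = "C * vnorm H y"])
    fix x assume x: "x \<in> carrier H"
    have "cmod (vinner H (T x) y) \<le> vnorm H (T x) * vnorm H y" using TD x y by (intro Cauchy_Schwarz)
    also have "\<dots> \<le> C * vnorm H x * vnorm H y" using C x y by (intro mult_right_mono) auto
    finally show "cmod (vinner H (T x) y) \<le> C * vnorm H y * vnorm H x" by (simp add: mult_ac)
  qed (use TD y in \<open>auto simp: inner_simps\<close>)
  then obtain S' where S': "\<And>y. y \<in> carrier H \<Longrightarrow> S' y \<in> carrier H"
    "\<And>x y. x \<in> carrier H \<Longrightarrow> y \<in> carrier H \<Longrightarrow> vinner H (T x) y = vinner H x (S' y)"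
    by metis
  define S where "S = restrict S' (carrier H)"
  have S: "S y \<in> carrier H" "x \<in> carrier H \<Longrightarrow> vinner H x (S y) = vinner H (T x) y" if "y \<in> carrier H" for x y
    using S' that by (auto simp: S_def)
  have S2: "vinner H (S y) x = vinner H y (T x)" if "x \<in> carrier H" "y \<in> carrier H" for x y
    using S[OF that(2)] inner_cnj[of x "S y"] inner_cnj[of "T x" y] TD(1) that by simp
  have "S \<in> B_of H"
  proof (rule bounded_opsI[where C = C])
    show "S \<in> extensional (carrier H)" by (simp add: S_def)
    show "S x \<in> carrier H" if "x \<in> carrier H" for x using S that by simp
    show "S (vadd H x y) = vadd H (S x) (S y)" if "x \<in> carrier H" "y \<in> carrier H" for x y
      by (rule inner_eqI) (use that S S2 TD in \<open>auto simp: inner_simps\<close>)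
    show "S (vscale H a x) = vscale H a (S x)" if "x \<in> carrier H" for a x
      by (rule inner_eqI) (use that S S2 TD in \<open>auto simp: inner_simps\<close>)
    show "vnorm H (S y) \<le> C * vnorm H y" if y: "y \<in> carrier H" for y
    proof (cases "vnorm H (S y) = 0")
      case False
      have "vnorm H (S y) * vnorm H (S y) = Re (vinner H (T (S y)) y)"
        using S[OF y] y vnorm_sq[of "S y"] by (simp add: power2_eq_square)
      also have "\<dots> \<le> vnorm H (T (S y)) * vnorm H y"
        using Cauchy_Schwarz[of "T (S y)" y] complex_Re_le_cmod S y TD(1) order_trans by blast
      also have "\<dots> \<le> (C * vnorm H (S y)) * vnorm H y" using C S y by (intro mult_right_mono) auto
      finally have "vnorm H (S y) * vnorm H (S y) \<le> vnorm H (S y) * (C * vnorm H y)"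
        by (simp add: mult_ac)
      moreover have "vnorm H (S y) > 0" using False vnorm_nonneg[OF S(1)[OF y]] by linarith
      ultimately show ?thesis by (simp add: mult_le_cancel_left_pos)
    qed (use C y in simp)
  qed
  then show ?thesis using S by (intro bexI[of _ S]) auto
qed

lemma adj_opI:
  assumes T: "T \<in> B_of H" and S: "S \<in> B_of H"
    and eq: "\<And>x y. x \<in> carrier H \<Longrightarrow> y \<in> carrier H \<Longrightarrow> vinner H (T x) y = vinner H x (S y)"
  shows "adj_op H T = S"
  unfolding adj_op_def
proof (rule the_equality)
  fix S' assume S': "S' \<in> B_of H \<and> (\<forall>x\<in>carrier H. \<forall>y\<in>carrier H. vinner H (T x) y = vinner H x (S' y))"
  then have B: "S' \<in> B_of H" by blast
  show "S' = S"
  proof (rule bounded_ops_eqI)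
    fix y assume y: "y \<in> carrier H"
    show "S' y = S y"
    proof (rule inner_eqI)
      fix z assume z: "z \<in> carrier H"
      have "vinner H z (S' y) = vinner H z (S y)" using S' eq y z by metis
      then show "vinner H (S' y) z = vinner H (S y) z"
        using inner_cnj[of z "S' y"] inner_cnj[of z "S y"] bounded_opsD(1)[OF S y] bounded_opsD(1)[OF B y] z
        by simp
    qed (rule bounded_opsD(1)[OF B y] bounded_opsD(1)[OF S y])+
  qed (use S B in auto)
qed (use S eq in auto)

lemma adj_op:
  assumes T: "T \<in> B_of H"
  shows adj_op_closed [simp]: "adj_op H T \<in> B_of H"
    and inner_adj_right: "x \<in> carrier H \<Longrightarrow> y \<in> carrier H \<Longrightarrow> vinner H x (adj_op H T y) = vinner H (T x) y"
    and inner_adj_left: "x \<in> carrier H \<Longrightarrow> y \<in> carrier H \<Longrightarrow> vinner H (adj_op H T x) y = vinner H x (T y)"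
proof -
  obtain S where S: "S \<in> B_of H" "\<And>x y. x \<in> carrier H \<Longrightarrow> y \<in> carrier H \<Longrightarrow> vinner H (T x) y = vinner H x (S y)"
    using adjoint_exists[OF T] by blast
  note * = adj_opI[OF T S]
  show "adj_op H T \<in> B_of H" by (simp add: * S)
  show r: "vinner H x (adj_op H T y) = vinner H (T x) y" if "x \<in> carrier H" "y \<in> carrier H" for x y
    using that by (simp add: * S)
  show "x \<in> carrier H \<Longrightarrow> y \<in> carrier H \<Longrightarrow> vinner H (adj_op H T x) y = vinner H x (T y)"
    using r[of y x] inner_cnj[of y "adj_op H T x"] inner_cnj[of "T y" x] bounded_opsD(1)[OF T]
      bounded_opsD(1)[OF \<open>adj_op H T \<in> B_of H\<close>] by simp
qed

section \<open>The algebra of bounded operators, its unitaries and their conjugations\<close>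

lemma op_closed [simp]: "T \<in> B_of H \<Longrightarrow> x \<in> carrier H \<Longrightarrow> T x \<in> carrier H"
  by (rule bounded_opsD(1))

lemma op_add: "T \<in> B_of H \<Longrightarrow> x \<in> carrier H \<Longrightarrow> y \<in> carrier H \<Longrightarrow> T (vadd H x y) = vadd H (T x) (T y)"
  by (rule bounded_opsD(2))

lemma op_scale: "T \<in> B_of H \<Longrightarrow> x \<in> carrier H \<Longrightarrow> T (vscale H a x) = vscale H a (T x)"
  by (rule bounded_opsD(3))

lemma op_vlim:
  "T \<in> B_of H \<Longrightarrow> vlim H s x \<Longrightarrow> (\<And>k. s k \<in> carrier H) \<Longrightarrow> x \<in> carrier H \<Longrightarrow> vlim H (\<lambda>k. T (s k)) (T x)"
  by (rule bounded_ops_vlim[OF inner_product_space_axioms inner_product_space_axioms])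

lemma op_bound:
  assumes "T \<in> B_of H"
  obtains C where "C \<ge> 0" "\<And>x. x \<in> carrier H \<Longrightarrow> vnorm H (T x) \<le> C * vnorm H x"
  using bounded_ops_bound[OF inner_product_space_axioms inner_product_space_axioms assms] by blast

lemma op_eqI: "S \<in> B_of H \<Longrightarrow> T \<in> B_of H \<Longrightarrow> (\<And>x. x \<in> carrier H \<Longrightarrow> S x = T x) \<Longrightarrow> S = T"
  by (rule bounded_ops_eqI)

lemma op_apply [simp]:
  assumes "x \<in> carrier H"
  shows "id_op H x = x" "add_op H S T x = vadd H (S x) (T x)" "scale_op H c T x = vscale H c (T x)"
    "mult_op H S T x = S (T x)" "rank_one H v w x = vscale H (vinner H x w) v"
  using assms by (simp_all add: id_op_def add_op_def scale_op_def compose_def rank_one_def)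

lemma id_op_closed [simp]: "id_op H \<in> B_of H"
  by (rule bounded_opsI[where C = 1]) (auto simp: id_op_def)

lemma zero_op_closed [simp]: "(\<lambda>x\<in>carrier H. vzero H) \<in> B_of H"
  by (rule bounded_opsI[where C = 0]) auto

lemma add_op_closed [simp]:
  assumes "S \<in> B_of H" "T \<in> B_of H"
  shows "add_op H S T \<in> B_of H"
proof -
  obtain C where C: "\<And>x. x \<in> carrier H \<Longrightarrow> vnorm H (S x) \<le> C * vnorm H x" using op_bound[OF assms(1)] by blast
  obtain D where D: "\<And>x. x \<in> carrier H \<Longrightarrow> vnorm H (T x) \<le> D * vnorm H x" using op_bound[OF assms(2)] by blast
  show ?thesis
  proof (rule bounded_opsI[where C = "C + D"])
    show "vnorm H (add_op H S T x) \<le> (C + D) * vnorm H x" if "x \<in> carrier H" for x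
      using vnorm_triangle[of "S x" "T x"] C[OF that] D[OF that] assms that by (simp add: distrib_right)
  qed (use assms in \<open>auto simp: op_add op_scale scale_add_right add_ac, auto simp: add_op_def\<close>)
qed

lemma scale_op_closed [simp]:
  assumes "T \<in> B_of H"
  shows "scale_op H c T \<in> B_of H"
proof -
  obtain D where D: "\<And>x. x \<in> carrier H \<Longrightarrow> vnorm H (T x) \<le> D * vnorm H x" using op_bound[OF assms] by blast
  show ?thesis
  proof (rule bounded_opsI[where C = "cmod c * D"])
    show "vnorm H (scale_op H c T x) \<le> cmod c * D * vnorm H x" if "x \<in> carrier H" for x
      using mult_left_mono[OF D[OF that], of "cmod c"] assms that by (simp add: mult.assoc)
  qed (use assms in \<open>auto simp: op_add op_scale scale_add_right mult.commute, auto simp: scale_op_def\<close>)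
qed

lemma mult_op_closed [simp]:
  assumes "S \<in> B_of H" "T \<in> B_of H"
  shows "mult_op H S T \<in> B_of H"
proof -
  obtain C where C: "C \<ge> 0" "\<And>x. x \<in> carrier H \<Longrightarrow> vnorm H (S x) \<le> C * vnorm H x" using op_bound[OF assms(1)] by blast
  obtain D where D: "\<And>x. x \<in> carrier H \<Longrightarrow> vnorm H (T x) \<le> D * vnorm H x" using op_bound[OF assms(2)] by blast
  show ?thesis
  proof (rule bounded_opsI[where C = "C * D"])
    show "vnorm H (mult_op H S T x) \<le> C * D * vnorm H x" if "x \<in> carrier H" for x
      using C(2)[of "T x"] mult_left_mono[OF D[OF that] C(1)] assms that by (simp add: mult.assoc)
  qed (use assms in \<open>auto simp: op_add op_scale\<close>)
qed

lemma rank_one_closed [simp]: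
  assumes "x \<in> carrier H" "y \<in> carrier H"
  shows "rank_one H x y \<in> B_of H"
proof (rule bounded_opsI[where C = "vnorm H x * vnorm H y"])
  show "vnorm H (rank_one H x y v) \<le> vnorm H x * vnorm H y * vnorm H v" if "v \<in> carrier H" for v
    using mult_right_mono[OF Cauchy_Schwarz[OF that assms(2)], of "vnorm H x"] assms that
    by (simp add: mult_ac)
qed (use assms in \<open>auto simp: inner_simps scale_add_left, auto simp: rank_one_def\<close>)

lemma adj_rank_one: "x \<in> carrier H \<Longrightarrow> y \<in> carrier H \<Longrightarrow> adj_op H (rank_one H x y) = rank_one H y x"
  by (rule adj_opI) (auto simp: inner_simps inner_cnj[of _ x] mult.commute)

lemma adj_adj [simp]: "T \<in> B_of H \<Longrightarrow> adj_op H (adj_op H T) = T"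
  by (rule adj_opI) (auto simp: inner_adj_left)

lemma star_algebra_B: "star_algebra H (B_of H)"
  by (simp add: star_algebra_def)

lemma unitaryI:
  assumes iso: "isometry_op H H U" and surj: "\<And>y. y \<in> carrier H \<Longrightarrow> \<exists>x\<in>carrier H. U x = y"
  shows "unitary_op H U"
proof -
  have U: "U \<in> B_of H" by (rule isometry_opD(1)[OF iso])
  have 1: "adj_op H U (U x) = x" if "x \<in> carrier H" for x
    by (rule inner_eqI) (use U that isometry_opD(2)[OF iso] in \<open>auto simp: inner_adj_left\<close>)
  have 2: "U (adj_op H U y) = y" if y: "y \<in> carrier H" for y
    using surj[OF y] 1 by auto
  show ?thesis
    unfolding unitary_op_def using U 1 2 by (intro conjI op_eqI) auto
qed

lemma unitaryD:
  assumes "unitary_op H U"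
  shows unitary_closed: "U \<in> B_of H"
    and unitary_adj_left: "x \<in> carrier H \<Longrightarrow> adj_op H U (U x) = x"
    and unitary_adj_right: "x \<in> carrier H \<Longrightarrow> U (adj_op H U x) = x"
    and unitary_inner: "x \<in> carrier H \<Longrightarrow> y \<in> carrier H \<Longrightarrow> vinner H (U x) (U y) = vinner H x y"
    and unitary_norm: "x \<in> carrier H \<Longrightarrow> vnorm H (U x) = vnorm H x"
    and unitary_isometry: "isometry_op H H U"
    and unitary_adj: "unitary_op H (adj_op H U)"
proof -
  show U: "U \<in> B_of H" using assms by (simp add: unitary_op_def)
  show l: "adj_op H U (U x) = x" if "x \<in> carrier H" for x
    using assms op_apply(4)[OF that, of "adj_op H U" U] op_apply(1)[OF that] by (simp add: unitary_op_def)
  show r: "U (adj_op H U x) = x" if "x \<in> carrier H" for x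
    using assms op_apply(4)[OF that, of U "adj_op H U"] op_apply(1)[OF that] by (simp add: unitary_op_def)
  show i: "vinner H (U x) (U y) = vinner H x y" if "x \<in> carrier H" "y \<in> carrier H" for x y
    using inner_adj_right[OF U, of x "U y"] l U that by simp
  then show "x \<in> carrier H \<Longrightarrow> vnorm H (U x) = vnorm H x" by (simp add: vnorm_def)
  show "isometry_op H H U" using U i by (simp add: isometry_op_def)
  show "unitary_op H (adj_op H U)" using assms U by (simp add: unitary_op_def)
qed

lemma Ad_op_apply: "T \<in> B_of H \<Longrightarrow> x \<in> carrier H \<Longrightarrow> U \<in> B_of H \<Longrightarrow> Ad_op H U T x = U (T (adj_op H U x))"
  by (simp add: Ad_op_def)

lemma Ad_op_closed [simp]: "T \<in> B_of H \<Longrightarrow> U \<in> B_of H \<Longrightarrow> Ad_op H U T \<in> B_of H"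
  by (simp add: Ad_op_def)

lemma Ad_op_inverse:
  assumes "unitary_op H U" "T \<in> B_of H"
  shows "Ad_op H (adj_op H U) (Ad_op H U T) = T"
  by (rule op_eqI) (use assms in \<open>auto simp: Ad_op_apply unitaryD\<close>)

lemma Ad_op_star_auto:
  assumes U: "unitary_op H U"
  shows "Ad_op H U \<in> star_auto H (B_of H)"
proof -
  note UD = unitaryD[OF U]
  have "bij_betw (Ad_op H U) (B_of H) (B_of H)"
    by (rule bij_betw_byWitness[where f' = "Ad_op H (adj_op H U)"])
      (use UD(1) Ad_op_inverse[OF U] Ad_op_inverse[OF UD(7)] in auto)
  then have "Ad_op H U \<in> Bij (B_of H)" by (simp add: Bij_def Ad_op_def)
  moreover have "Ad_op H U (adj_op H T) = adj_op H (Ad_op H U T)" if T: "T \<in> B_of H" for T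
  proof (rule adj_opI[symmetric])
    fix x y assume c: "x \<in> carrier H" "y \<in> carrier H"
    have "vinner H (Ad_op H U T x) y = vinner H (T (adj_op H U x)) (adj_op H U y)"
      using c T UD(1) by (simp add: Ad_op_apply inner_adj_right[OF UD(1)])
    also have "\<dots> = vinner H (adj_op H U x) (adj_op H T (adj_op H U y))"
      using c T UD(1) by (simp add: inner_adj_right[OF T])
    also have "\<dots> = vinner H x (Ad_op H U (adj_op H T) y)"
      using c T UD(1) by (simp add: Ad_op_apply inner_adj_left[OF UD(1)])
    finally show "vinner H (Ad_op H U T x) y = vinner H x (Ad_op H U (adj_op H T) y)" .
  qed (use T UD(1) in auto)
  ultimately show ?thesis
    unfolding star_auto_def
    by (auto intro!: op_eqI simp: UD Ad_op_apply op_add op_scale)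
qed

end


section \<open>Automorphisms of the algebra of all bounded operators\<close>

lemma star_autoD:
  assumes "\<beta> \<in> star_auto H A"
  shows "S \<in> A \<Longrightarrow> \<beta> S \<in> A" "inj_on \<beta> A" "\<beta> ` A = A" "\<beta> \<in> extensional A"
    "S \<in> A \<Longrightarrow> T \<in> A \<Longrightarrow> \<beta> (add_op H S T) = add_op H (\<beta> S) (\<beta> T)"
    "S \<in> A \<Longrightarrow> T \<in> A \<Longrightarrow> \<beta> (mult_op H S T) = mult_op H (\<beta> S) (\<beta> T)"
    "T \<in> A \<Longrightarrow> \<beta> (scale_op H c T) = scale_op H c (\<beta> T)"
    "T \<in> A \<Longrightarrow> \<beta> (adj_op H T) = adj_op H (\<beta> T)"
  using assms by (auto simp: star_auto_def Bij_def bij_betw_def)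

context hilbert_space
begin

text \<open>
  The unitary sends \<open>T \<xi>\<close> to \<open>\<beta> T \<eta>\<close>, where \<open>\<eta>\<close> is a unit vector in the range of the image of
  the rank one projection onto \<open>\<xi>\<close>.
\<close>

theorem star_auto_spatial:
  assumes b: "\<beta> \<in> star_auto H (B_of H)" and xi: "\<xi> \<in> carrier H" "vnorm H \<xi> = 1"
  shows "\<exists>W. unitary_op H W \<and> (\<forall>T\<in>B_of H. \<forall>x\<in>carrier H. \<beta> T (W x) = W (T x))"
proof -
  note bD = star_autoD[OF b]
  have xx: "vinner H \<xi> \<xi> = 1" using inner_self[OF xi(1)] xi(2) by simp
  define p where "p = rank_one H \<xi> \<xi>"
  define q where "q = \<beta> p"
  let ?Z = "\<lambda>x\<in>carrier H. vzero H"
  have p: "p \<in> B_of H" using xi by (simp add: p_def)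
  have q: "q \<in> B_of H" unfolding q_def by (rule bD(1)[OF p])
  have "mult_op H p p = p" by (rule op_eqI) (use xi xx in \<open>auto simp: p_def inner_simps\<close>)
  then have qq: "q (q x) = q x" if "x \<in> carrier H" for x
    using bD(6)[OF p p] op_apply(4)[OF that, of q q] by (simp add: q_def)
  have "adj_op H q = q" using bD(8)[OF p] xi by (simp add: q_def p_def adj_rank_one)
  then have q_sym: "vinner H (q x) y = vinner H x (q y)" if "x \<in> carrier H" "y \<in> carrier H" for x y
    using inner_adj_left[OF q that] by simp
  have Z: "scale_op H 0 T = ?Z" if "T \<in> B_of H" for T by (rule op_eqI) (use that in auto)
  have "\<beta> ?Z = ?Z" using bD(7)[OF zero_op_closed, of 0] by (simp only: Z zero_op_closed bD(1))
  have "p \<noteq> ?Z"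
  proof
    assume "p = ?Z"
    then have "p \<xi> = vzero H" using xi by simp
    then have "\<xi> = vzero H" using xi xx by (simp add: p_def)
    then show False using xi(2) by simp
  qed
  then have "q \<noteq> ?Z" using bD(2) \<open>\<beta> ?Z = ?Z\<close> p by (metis inj_on_def q_def zero_op_closed)
  then obtain v where v: "v \<in> carrier H" "q v \<noteq> vzero H"
    using op_eqI[OF q zero_op_closed] by auto
  define n where "n = vnorm H (q v)"
  have n: "n > 0" using vnorm_eq_0[of "q v"] vnorm_nonneg[of "q v"] v q unfolding n_def
    by (metis op_closed order_le_less)
  define \<eta> where "\<eta> = vscale H (complex_of_real (1 / n)) (q v)"
  have eta: "\<eta> \<in> carrier H" "vnorm H \<eta> = 1" "q \<eta> = \<eta>"
    using v q n qq by (simp_all add: \<eta>_def op_scale n_def norm_divide)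
  have ee: "vinner H \<eta> \<eta> = 1" using inner_self[OF eta(1)] eta(2) by simp
  \<comment> \<open>\<open>p T p\<close> is the multiple of \<open>p\<close> by the scalar
    \<open>vinner H (T \<xi>) \<xi>\<close>. This identity is transported by \<open>\<beta>\<close>
    and evaluated at \<open>\<eta>\<close>, which \<open>q\<close> fixes; so the vector states of
    \<open>\<xi>\<close> and \<open>\<eta>\<close> correspond under \<open>\<beta>\<close>.\<close>
  have state: "vinner H (\<beta> T \<eta>) \<eta> = vinner H (T \<xi>) \<xi>" if T: "T \<in> B_of H" for T
  proof -
    have "mult_op H p (mult_op H T p) = scale_op H (vinner H (T \<xi>) \<xi>) p"
      by (rule op_eqI) (use T p xi in \<open>auto simp: p_def op_scale inner_simps mult.commute\<close>)
    then have "mult_op H q (mult_op H (\<beta> T) q) = scale_op H (vinner H (T \<xi>) \<xi>) q"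
      using bD(6)[OF p mult_op_closed[OF T p]] bD(6)[OF T p] bD(7)[OF p] by (simp add: q_def)
    then have "q (\<beta> T (q \<eta>)) = vscale H (vinner H (T \<xi>) \<xi>) (q \<eta>)"
      using op_apply(3,4)[OF eta(1)] q bD(1)[OF T] by metis
    then show ?thesis
      using q_sym[of "\<beta> T \<eta>" \<eta>] eta ee bD(1)[OF T] by (simp add: inner_simps)
  qed
  have inn: "vinner H (\<beta> T \<eta>) (\<beta> S \<eta>) = vinner H (T \<xi>) (S \<xi>)" if T: "T \<in> B_of H" and S: "S \<in> B_of H" for T S
  proof -
    have "vinner H (\<beta> T \<eta>) (\<beta> S \<eta>) = vinner H (\<beta> (mult_op H (adj_op H S) T) \<eta>) \<eta>"
      using T S eta bD(1) by (simp add: bD(6,8) inner_adj_left)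
    then show ?thesis using state[of "mult_op H (adj_op H S) T"] T S xi by (simp add: inner_adj_left)
  qed
  \<comment> \<open>\<open>rank_one H x \<xi>\<close> is one operator that takes
    \<open>\<xi>\<close> to \<open>x\<close>. Any other gives the same vector, since by
    \<open>inn\<close> the distances between the vectors \<open>\<beta> T \<eta>\<close> depend only
    on the vectors \<open>T \<xi>\<close>.\<close>
  define W where "W = (\<lambda>x\<in>carrier H. \<beta> (rank_one H x \<xi>) \<eta>)"
  have Wc: "W x \<in> carrier H" if "x \<in> carrier H" for x
    using that xi eta bD(1) by (simp add: W_def)
  have Winn: "vinner H (W x) (W y) = vinner H x y" if "x \<in> carrier H" "y \<in> carrier H" for x y
    using that xi xx by (simp add: W_def inn)
  have WT: "\<beta> T \<eta> = W (T \<xi>)" if T: "T \<in> B_of H" for T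
  proof (rule vdist_eq_0)
    have "(vdist H (\<beta> T \<eta>) (W (T \<xi>)))\<^sup>2 = 0"
      using T xi eta xx bD(1) Wc by (simp add: vdist_sq vnorm_sq W_def inn)
    then show "vdist H (\<beta> T \<eta>) (W (T \<xi>)) = 0" by simp
  qed (use T xi eta bD(1) Wc in auto)
  have inter: "\<beta> T (W x) = W (T x)" if T: "T \<in> B_of H" and x: "x \<in> carrier H" for T x
  proof -
    have R: "rank_one H x \<xi> \<in> B_of H" using x xi by simp
    have "\<beta> T (W x) = mult_op H (\<beta> T) (\<beta> (rank_one H x \<xi>)) \<eta>"
      using x eta by (simp add: W_def)
    also have "\<dots> = W (mult_op H T (rank_one H x \<xi>) \<xi>)"
      using bD(6)[OF T R] WT[OF mult_op_closed[OF T R]] by simp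
    also have "\<dots> = W (T x)" using T x xi xx by simp
    finally show ?thesis .
  qed
  have "isometry_op H H W"
  proof (rule isometry_opI)
    fix x y assume c: "x \<in> carrier H" "y \<in> carrier H"
    have "rank_one H (vadd H x y) \<xi> = add_op H (rank_one H x \<xi>) (rank_one H y \<xi>)"
      by (rule op_eqI) (use c xi in \<open>auto simp: scale_add_right\<close>)
    then show "W (vadd H x y) = vadd H (W x) (W y)" using c xi eta by (simp add: W_def bD(5))
  next
    fix a x assume c: "x \<in> carrier H"
    have "rank_one H (vscale H a x) \<xi> = scale_op H a (rank_one H x \<xi>)"
      by (rule op_eqI) (use c xi in \<open>auto simp: mult.commute\<close>)
    then show "W (vscale H a x) = vscale H a (W x)" using c xi eta by (simp add: W_def bD(7))
  qed (auto simp: Wc Winn inner_product_space_axioms, simp add: W_def)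
  then have "unitary_op H W"
  proof (rule unitaryI)
    fix y assume y: "y \<in> carrier H"
    \<comment> \<open>Surjectivity of \<open>\<beta>\<close>: an operator that takes
      \<open>\<eta>\<close> to \<open>y\<close> is the image of some \<open>R\<close>, and then
      \<open>W\<close> takes \<open>R \<xi>\<close> to \<open>y\<close>.\<close>
    then have "rank_one H y \<eta> \<in> \<beta> ` B_of H" using eta bD(3) by simp
    then obtain R where R: "R \<in> B_of H" "\<beta> R = rank_one H y \<eta>" by auto
    then have "W (R \<xi>) = y" using WT[OF R(1)] y eta ee by simp
    then show "\<exists>x\<in>carrier H. W x = y" using R(1) xi by auto
  qed
  then show ?thesis using inter by blast
qed

end


section \<open>Inductive limits\<close>

locale isometric_chain =
  fixes T :: "nat \<Rightarrow> 'b cspace" and V :: "nat \<Rightarrow> 'b \<Rightarrow> 'b"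
  assumes ips: "\<And>n. inner_product_space (T n)"
    and iso: "\<And>n. isometry_op (T n) (T (Suc n)) (V n)"
begin

sublocale T: inner_product_space "T n" for n by (rule ips)

abbreviation "conn \<equiv> connecting V"
abbreviation "rel \<equiv> ind_lim_rel T V"
abbreviation "L \<equiv> ind_lim T V"

definition emb :: "nat \<Rightarrow> 'b \<Rightarrow> (nat \<times> 'b) set" where
  "emb n \<psi> = rel `` {(n, \<psi>)}"

lemma conn_same [simp]: "conn n n \<psi> = \<psi>"
  by (simp add: connecting_def)

lemma conn_Suc: "n \<le> m \<Longrightarrow> conn n (Suc m) \<psi> = V m (conn n m \<psi>)"
  by (simp add: connecting_def)

lemma conn_trans: "n \<le> m \<Longrightarrow> m \<le> N \<Longrightarrow> conn m N (conn n m \<psi>) = conn n N \<psi>"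
  by (rotate_tac, induction N rule: dec_induct) (simp_all add: conn_Suc)

lemma conn:
  assumes "n \<le> m"
  shows conn_closed [simp]: "\<psi> \<in> carrier (T n) \<Longrightarrow> conn n m \<psi> \<in> carrier (T m)"
    and conn_add: "\<psi> \<in> carrier (T n) \<Longrightarrow> \<xi> \<in> carrier (T n) \<Longrightarrow>
      conn n m (vadd (T n) \<psi> \<xi>) = vadd (T m) (conn n m \<psi>) (conn n m \<xi>)"
    and conn_scale: "\<psi> \<in> carrier (T n) \<Longrightarrow> conn n m (vscale (T n) c \<psi>) = vscale (T m) c (conn n m \<psi>)"
    and conn_inner: "\<psi> \<in> carrier (T n) \<Longrightarrow> \<xi> \<in> carrier (T n) \<Longrightarrow>
      vinner (T m) (conn n m \<psi>) (conn n m \<xi>) = vinner (T n) \<psi> \<xi>"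
proof -
  note D = bounded_opsD[OF isometry_opD(1)[OF iso]]
  have c: "\<psi> \<in> carrier (T n) \<Longrightarrow> conn n m \<psi> \<in> carrier (T m)" for \<psi>
    using assms by (induction m rule: dec_induct) (simp_all add: conn_Suc D)
  have c': "\<psi> \<in> carrier (T n) \<Longrightarrow> conn n k \<psi> \<in> carrier (T k)" if "n \<le> k" for \<psi> k
    using that by (induction k rule: dec_induct) (simp_all add: conn_Suc D)
  show "\<psi> \<in> carrier (T n) \<Longrightarrow> conn n m \<psi> \<in> carrier (T m)" by (rule c)
  show "\<psi> \<in> carrier (T n) \<Longrightarrow> \<xi> \<in> carrier (T n) \<Longrightarrow>
      conn n m (vadd (T n) \<psi> \<xi>) = vadd (T m) (conn n m \<psi>) (conn n m \<xi>)"
    using assms by (induction m rule: dec_induct) (simp_all add: conn_Suc D c')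
  show "\<psi> \<in> carrier (T n) \<Longrightarrow> conn n m (vscale (T n) c \<psi>) = vscale (T m) c (conn n m \<psi>)"
    using assms by (induction m rule: dec_induct) (simp_all add: conn_Suc D c')
  show "\<psi> \<in> carrier (T n) \<Longrightarrow> \<xi> \<in> carrier (T n) \<Longrightarrow>
      vinner (T m) (conn n m \<psi>) (conn n m \<xi>) = vinner (T n) \<psi> \<xi>"
    using assms by (induction m rule: dec_induct) (simp_all add: conn_Suc isometry_opD(2)[OF iso] c')
qed

text \<open>Equality at one stage persists at all later ones. In the form with all
  \<open>M >= N\<close>, several such relations can be combined by passing to a maximum.\<close>

lemma rel_iff:
  "((n, \<psi>), (m, \<xi>)) \<in> rel \<longleftrightarrow> \<psi> \<in> carrier (T n) \<and> \<xi> \<in> carrier (T m) \<and>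
     (\<exists>N\<ge>max n m. \<forall>M\<ge>N. conn n M \<psi> = conn m M \<xi>)"
proof -
  have "(\<exists>N\<ge>max n m. conn n N \<psi> = conn m N \<xi>) \<longleftrightarrow> (\<exists>N\<ge>max n m. \<forall>M\<ge>N. conn n M \<psi> = conn m M \<xi>)"
  proof
    assume "\<exists>N\<ge>max n m. conn n N \<psi> = conn m N \<xi>"
    then obtain N where N: "N \<ge> n" "N \<ge> m" "conn n N \<psi> = conn m N \<xi>" by auto
    then have "conn n M \<psi> = conn m M \<xi>" if "M \<ge> N" for M
      using conn_trans[OF N(1) that, of \<psi>] conn_trans[OF N(2) that, of \<xi>] by simp
    then show "\<exists>N\<ge>max n m. \<forall>M\<ge>N. conn n M \<psi> = conn m M \<xi>" using N by (intro exI[of _ N]) auto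
  qed auto
  then show ?thesis by (simp add: ind_lim_rel_def)
qed

lemma equiv_rel: "equiv (SIGMA n:UNIV. carrier (T n)) rel"
proof (rule equivI)
  show "rel \<subseteq> (SIGMA n:UNIV. carrier (T n)) \<times> (SIGMA n:UNIV. carrier (T n))"
    by (auto simp: rel_iff)
  show "refl_on (SIGMA n:UNIV. carrier (T n)) rel" by (auto simp: refl_on_def rel_iff)
  show "sym rel"
  proof (rule symI)
    fix p q assume "(p, q) \<in> rel"
    then show "(q, p) \<in> rel" by (cases p, cases q) (auto simp: ind_lim_rel_def max.commute)
  qed
  show "trans rel"
  proof (rule transI)
    fix p q r assume pq: "(p, q) \<in> rel" and qr: "(q, r) \<in> rel"
    obtain n \<psi> m \<xi> k \<zeta> where p: "p = (n, \<psi>)" "q = (m, \<xi>)" "r = (k, \<zeta>)"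
      by (cases p, cases q, cases r) auto
    obtain N where N: "N \<ge> max n m" "\<forall>M\<ge>N. conn n M \<psi> = conn m M \<xi>" using pq p by (auto simp: rel_iff)
    obtain N' where N': "N' \<ge> max m k" "\<forall>M\<ge>N'. conn m M \<xi> = conn k M \<zeta>" using qr p by (auto simp: rel_iff)
    have "\<forall>M\<ge>max N N'. conn n M \<psi> = conn k M \<zeta>" using N N' by auto
    moreover have "max N N' \<ge> max n k" using N N' by auto
    ultimately have "\<exists>N\<ge>max n k. \<forall>M\<ge>N. conn n M \<psi> = conn k M \<zeta>" by blast
    then show "(p, r) \<in> rel" using pq qr p by (auto simp: rel_iff)
  qed
qed

lemma emb_closed [simp]: "\<psi> \<in> carrier (T n) \<Longrightarrow> emb n \<psi> \<in> carrier L"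
  by (auto simp: emb_def ind_lim_def intro!: quotientI)

lemma emb_conn:
  assumes "n \<le> m" "\<psi> \<in> carrier (T n)"
  shows "emb m (conn n m \<psi>) = emb n \<psi>"
  unfolding emb_def
proof (rule equiv_class_eq[OF equiv_rel])
  show "((m, conn n m \<psi>), (n, \<psi>)) \<in> rel"
    unfolding rel_iff using assms by (auto intro!: exI[of _ m] simp: conn_trans)
qed

text \<open>Representatives can be pushed forward, so finitely many elements are represented at a
  common stage; each axiom for the limit then becomes the same axiom for a single
  \<open>T N\<close>.\<close>

lemma ind_lim_cases:
  assumes "A \<in> carrier L"
  shows "\<exists>n. \<forall>m\<ge>n. \<exists>\<psi>\<in>carrier (T m). A = emb m \<psi>"
proof -
  obtain n \<psi> where "\<psi> \<in> carrier (T n)" "A = emb n \<psi>"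
    using assms by (auto simp: ind_lim_def emb_def elim!: quotientE)
  then show ?thesis using emb_conn conn_closed by metis
qed

lemma emb_add:
  assumes "\<psi> \<in> carrier (T n)" "\<xi> \<in> carrier (T n)"
  shows "vadd L (emb n \<psi>) (emb n \<xi>) = emb n (vadd (T n) \<psi> \<xi>)"
proof -
  define f where "f p q = emb (max (fst p) (fst q)) (vadd (T (max (fst p) (fst q)))
      (conn (fst p) (max (fst p) (fst q)) (snd p)) (conn (fst q) (max (fst p) (fst q)) (snd q)))"
    for p q :: "nat \<times> 'b"
  \<comment> \<open>A sum formed at the maximum of the two stages may be computed at any later one.
    Independence of representatives then follows at a stage where both pairs have become
    equal.\<close>
  have f_eq: "f (n, \<psi>) (m, \<xi>) = emb N (vadd (T N) (conn n N \<psi>) (conn m N \<xi>))"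
    if "\<psi> \<in> carrier (T n)" "\<xi> \<in> carrier (T m)" "N \<ge> n" "N \<ge> m" for n m N \<psi> \<xi>
    using that emb_conn[of "max n m" N "vadd (T (max n m)) (conn n (max n m) \<psi>) (conn m (max n m) \<xi>)"]
    by (simp add: f_def conn_add conn_trans)
  have "congruent2 rel rel f"
  proof (rule congruent2I')
    fix p p' q q' assume pp: "(p, p') \<in> rel" and qq: "(q, q') \<in> rel"
    obtain n \<psi> n' \<psi>' where p: "p = (n, \<psi>)" "p' = (n', \<psi>')" by (cases p, cases p') auto
    obtain m \<xi> m' \<xi>' where q: "q = (m, \<xi>)" "q' = (m', \<xi>')" by (cases q, cases q') auto
    obtain N where N: "N \<ge> max n n'" "\<forall>M\<ge>N. conn n M \<psi> = conn n' M \<psi>'" using pp p by (auto simp: rel_iff)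
    obtain N' where N': "N' \<ge> max m m'" "\<forall>M\<ge>N'. conn m M \<xi> = conn m' M \<xi>'" using qq q by (auto simp: rel_iff)
    have c: "\<psi> \<in> carrier (T n)" "\<xi> \<in> carrier (T m)" "\<psi>' \<in> carrier (T n')" "\<xi>' \<in> carrier (T m')"
      using pp qq p q by (auto simp: rel_iff)
    have "n \<le> max N N'" "n' \<le> max N N'" "m \<le> max N N'" "m' \<le> max N N'" using N N' by auto
    then show "f p q = f p' q'"
      using f_eq[OF c(1,2), of "max N N'"] f_eq[OF c(3,4), of "max N N'"] N N' by (simp add: p q)
  qed
  from UN_equiv_class2[OF equiv_rel equiv_rel this, of "(n, \<psi>)" "(n, \<xi>)"]
  have "(\<Union>p\<in>emb n \<psi>. \<Union>q\<in>emb n \<xi>. f p q) = f (n, \<psi>) (n, \<xi>)" using assms by (simp add: emb_def)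
  then show ?thesis by (simp add: ind_lim_def f_def case_prod_unfold emb_def)
qed

lemma emb_scale:
  assumes "\<psi> \<in> carrier (T n)"
  shows "vscale L c (emb n \<psi>) = emb n (vscale (T n) c \<psi>)"
proof -
  define f where "f p = emb (fst p) (vscale (T (fst p)) c (snd p))" for p :: "nat \<times> 'b"
  have "f respects rel"
  proof (rule congruentI)
    fix p p' assume pp: "(p, p') \<in> rel"
    obtain n \<psi> n' \<psi>' where p: "p = (n, \<psi>)" "p' = (n', \<psi>')" by (cases p, cases p') auto
    obtain N where N: "N \<ge> max n n'" "\<forall>M\<ge>N. conn n M \<psi> = conn n' M \<psi>'" using pp p by (auto simp: rel_iff)
    have c: "\<psi> \<in> carrier (T n)" "\<psi>' \<in> carrier (T n')" using pp p by (auto simp: rel_iff)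
    have "emb N (conn n N (vscale (T n) c \<psi>)) = emb N (conn n' N (vscale (T n') c \<psi>'))"
      using N c by (simp add: conn_scale)
    then show "f p = f p'" using N c by (simp add: p f_def emb_conn)
  qed
  from UN_equiv_class[OF equiv_rel this, of "(n, \<psi>)"]
  have "(\<Union>p\<in>emb n \<psi>. f p) = f (n, \<psi>)" using assms by (simp add: emb_def)
  then show ?thesis by (simp add: ind_lim_def f_def case_prod_unfold emb_def)
qed

lemma emb_inner:
  assumes c: "\<psi> \<in> carrier (T n)" "\<xi> \<in> carrier (T n)"
  shows "vinner L (emb n \<psi>) (emb n \<xi>) = vinner (T n) \<psi> \<xi>"
proof -
  let ?g = "\<lambda>n \<psi> m \<xi>. vinner (T (max n m)) (conn n (max n m) \<psi>) (conn m (max n m) \<xi>)"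
  have g: "?g n' \<psi>' m' \<xi>' = vinner (T n) \<psi> \<xi>" if "(n', \<psi>') \<in> emb n \<psi>" "(m', \<xi>') \<in> emb n \<xi>" for n' m' \<psi>' \<xi>'
  proof -
    have p: "((n, \<psi>), (n', \<psi>')) \<in> rel" and q: "((n, \<xi>), (m', \<xi>')) \<in> rel" using that by (auto simp: emb_def)
    obtain N where N: "N \<ge> max n n'" "\<forall>M\<ge>N. conn n M \<psi> = conn n' M \<psi>'" using p by (auto simp: rel_iff)
    obtain N' where N': "N' \<ge> max n m'" "\<forall>M\<ge>N'. conn n M \<xi> = conn m' M \<xi>'" using q by (auto simp: rel_iff)
    have c': "\<psi>' \<in> carrier (T n')" "\<xi>' \<in> carrier (T m')" using p q by (auto simp: rel_iff)
    define M where "M = max N N'"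
    have M: "M \<ge> N" "M \<ge> N'" "M \<ge> n" "M \<ge> n'" "M \<ge> m'" "M \<ge> max n' m'" using N N' by (auto simp: M_def)
    have "?g n' \<psi>' m' \<xi>' = vinner (T M) (conn n' M \<psi>') (conn m' M \<xi>')"
      using conn_inner[OF M(6), of "conn n' (max n' m') \<psi>'" "conn m' (max n' m') \<xi>'"] c' M
      by (simp add: conn_trans)
    also have "\<dots> = vinner (T M) (conn n M \<psi>) (conn n M \<xi>)" using N N' M by simp
    also have "\<dots> = vinner (T n) \<psi> \<xi>" using c M by (simp add: conn_inner)
    finally show ?thesis .
  qed
  have self: "(n, \<psi>) \<in> emb n \<psi>" "(n, \<xi>) \<in> emb n \<xi>"
    using c by (auto simp: emb_def rel_iff)
  have "(THE z. \<forall>(n', \<psi>')\<in>emb n \<psi>. \<forall>(m, \<xi>')\<in>emb n \<xi>. ?g n' \<psi>' m \<xi>' = z) = vinner (T n) \<psi> \<xi>"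
  proof (rule the_equality)
    show "\<forall>(n', \<psi>')\<in>emb n \<psi>. \<forall>(m, \<xi>')\<in>emb n \<xi>. ?g n' \<psi>' m \<xi>' = vinner (T n) \<psi> \<xi>" using g by blast
    show "z = vinner (T n) \<psi> \<xi>" if "\<forall>(n', \<psi>')\<in>emb n \<psi>. \<forall>(m, \<xi>')\<in>emb n \<xi>. ?g n' \<psi>' m \<xi>' = z" for z
      using bspec[OF bspec[OF that self(1), simplified] self(2)] by simp
  qed
  then show ?thesis by (simp add: ind_lim_def)
qed

lemma emb_zero: "vzero L = emb n (vzero (T n))"
proof -
  have "vzero L = emb 0 (vzero (T 0))" by (simp add: ind_lim_def emb_def)
  also have "\<dots> = emb n (conn 0 n (vscale (T 0) 0 (vzero (T 0))))" by (simp add: emb_conn)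
  also have "conn 0 n (vscale (T 0) 0 (vzero (T 0))) = vzero (T n)"
    unfolding conn_scale[OF le0 T.zero_closed] by simp
  finally show ?thesis .
qed

lemma ind_lim_semi_inner_product_space: "semi_inner_product_space L"
proof
  fix A B assume A: "A \<in> carrier L" and B: "B \<in> carrier L"
  obtain n where n: "\<And>k. k \<ge> n \<Longrightarrow> \<exists>\<psi>\<in>carrier (T k). A = emb k \<psi>" using ind_lim_cases[OF A] by blast
  obtain m where m: "\<And>k. k \<ge> m \<Longrightarrow> \<exists>\<psi>\<in>carrier (T k). B = emb k \<psi>" using ind_lim_cases[OF B] by blast
  obtain N \<psi> \<xi> where *: "\<psi> \<in> carrier (T N)" "\<xi> \<in> carrier (T N)" "A = emb N \<psi>" "B = emb N \<xi>"
    using n[of "max n m"] m[of "max n m"] by auto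
  show "vadd L A B \<in> carrier L" using * by (simp add: emb_add)
  show "vadd L A B = vadd L B A" using * by (simp add: emb_add T.add_commute)
  show "vscale L a (vadd L A B) = vadd L (vscale L a A) (vscale L a B)" for a
    using * by (simp add: emb_add emb_scale T.scale_add_right)
  show "vinner L (vscale L a A) B = a * vinner L A B" for a
    using * by (simp add: emb_inner emb_scale T.inner_scale)
  show "vinner L B A = cnj (vinner L A B)"
    using * T.inner_cnj[of \<psi> N \<xi>] by (simp add: emb_inner)
next
  fix A B C assume A: "A \<in> carrier L" and B: "B \<in> carrier L" and C: "C \<in> carrier L"
  obtain n where n: "\<And>k. k \<ge> n \<Longrightarrow> \<exists>\<psi>\<in>carrier (T k). A = emb k \<psi>" using ind_lim_cases[OF A] by blast
  obtain m where m: "\<And>k. k \<ge> m \<Longrightarrow> \<exists>\<psi>\<in>carrier (T k). B = emb k \<psi>" using ind_lim_cases[OF B] by blast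
  obtain j where j: "\<And>k. k \<ge> j \<Longrightarrow> \<exists>\<psi>\<in>carrier (T k). C = emb k \<psi>" using ind_lim_cases[OF C] by blast
  obtain N where N: "n \<le> N" "m \<le> N" "j \<le> N" by (meson max.cobounded1 max.cobounded2 order_trans)
  obtain \<psi> \<xi> \<zeta> where *: "\<psi> \<in> carrier (T N)" "\<xi> \<in> carrier (T N)" "\<zeta> \<in> carrier (T N)"
    "A = emb N \<psi>" "B = emb N \<xi>" "C = emb N \<zeta>"
    using n[OF N(1)] m[OF N(2)] j[OF N(3)] by blast
  show "vadd L (vadd L A B) C = vadd L A (vadd L B C)" using * by (simp add: emb_add T.add_assoc)
  show "vinner L (vadd L A B) C = vinner L A C + vinner L B C"
    using * by (simp add: emb_add emb_inner T.inner_add)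
next
  fix A assume A: "A \<in> carrier L"
  obtain n where n: "\<And>k. k \<ge> n \<Longrightarrow> \<exists>\<psi>\<in>carrier (T k). A = emb k \<psi>" using ind_lim_cases[OF A] by blast
  then obtain \<psi> where *: "\<psi> \<in> carrier (T n)" "A = emb n \<psi>" by blast
  show "vscale L c A \<in> carrier L" for c using * by (simp add: emb_scale)
  show "vadd L A (vzero L) = A" using * by (simp add: emb_add emb_zero[of n])
  show "vadd L A (vscale L (- 1) A) = vzero L" using * by (simp add: emb_add emb_scale emb_zero[of n])
  show "vscale L 1 A = A" using * by (simp add: emb_scale)
  show "vscale L a (vscale L b A) = vscale L (a * b) A" for a b using * by (simp add: emb_scale)
  show "vscale L (a + b) A = vadd L (vscale L a A) (vscale L b A)" for a b
    using * by (simp add: emb_scale emb_add T.scale_add_left)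
  show "0 \<le> Re (vinner L A A)" using * by (simp add: emb_inner T.inner_nonneg)
qed (simp add: emb_zero[of 0])

lemma emb_vdist:
  "\<psi> \<in> carrier (T n) \<Longrightarrow> \<xi> \<in> carrier (T n) \<Longrightarrow> vdist L (emb n \<psi>) (emb n \<xi>) = vdist (T n) \<psi> \<xi>"
  by (simp add: vdist_def vnorm_def emb_add emb_scale emb_inner)

lemma emb_lincomb:
  assumes e: "\<And>x. x \<in> X \<Longrightarrow> e x \<in> carrier (T n)"
  shows "snd ` set l \<subseteq> X \<Longrightarrow> emb n (lincomb (T n) e l) = lincomb L (\<lambda>x. emb n (e x)) l"
proof (induction l)
  case (Cons p l)
  then have "lincomb (T n) e l \<in> carrier (T n)" "e (snd p) \<in> carrier (T n)"
    using e by (auto intro: T.lincomb_closed[where X = X])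
  then show ?case using Cons by (simp flip: emb_add emb_scale)
qed (simp add: emb_zero[of n])

end


section \<open>Infinite tensor products of Hilbert spaces\<close>

lemma lincomb_map: "lincomb H e (map (\<lambda>(c, x). (c, f x)) l) = lincomb H (\<lambda>x. e (f x)) l"
  by (induction l) auto

lemma lincomb_cong: "(\<And>x. x \<in> snd ` set l \<Longrightarrow> e x = f x) \<Longrightarrow> lincomb H e l = lincomb H f l"
  by (induction l) auto

locale tensor_factors =
  fixes H :: "nat \<Rightarrow> 'a cspace" and \<phi> :: "nat \<Rightarrow> 'a"
  assumes hilbert: "\<And>i. hilbert_space (H i)"
    and phi_closed [simp]: "\<And>i. \<phi> i \<in> carrier (H i)"
    and phi_norm [simp]: "\<And>i. vnorm (H i) (\<phi> i) = 1"
begin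

sublocale H: hilbert_space "H i" for i by (rule hilbert)

lemma phi_inner [simp]: "vinner (H i) (\<phi> i) (\<phi> i) = 1"
  using H.inner_self[of "\<phi> i" i] by simp

text \<open>Each factor is the Gram kernel of the i-th coordinates, and the Schur product theorem
  keeps entrywise products positive. Hence the tensor form on the free space is a semi-inner
  product.\<close>

lemma tensor_kernel_psd:
  "psd_kernel (\<lambda>x y. \<Prod>i\<le>n. vinner (H i) (x i) (y i)) (tuples H n)"
  by (intro psd_kernel_prod H.psd_kernel_inner) (auto simp: tuples_def)

lemma fin_tensor_hilbert: "hilbert_space (fin_tensor H n)"
  using free_space_completion(1)[OF tensor_kernel_psd] by (simp add: fin_tensor_def free_tensor_def)

sublocale F: hilbert_space "fin_tensor H n" for n by (rule fin_tensor_hilbert)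

lemma elem_tensor_closed [simp]: "x \<in> tuples H n \<Longrightarrow> elem_tensor H n x \<in> carrier (fin_tensor H n)"
  using free_space_completion(2)[OF tensor_kernel_psd]
  by (simp add: fin_tensor_def free_tensor_def elem_tensor_def)

lemma elem_tensor_inner:
  "x \<in> tuples H n \<Longrightarrow> y \<in> tuples H n \<Longrightarrow>
   vinner (fin_tensor H n) (elem_tensor H n x) (elem_tensor H n y) = (\<Prod>i\<le>n. vinner (H i) (x i) (y i))"
  using free_space_completion(3)[OF tensor_kernel_psd]
  by (simp add: fin_tensor_def free_tensor_def elem_tensor_def)

lemma elem_tensor_dense: "vdense (fin_tensor H n) (elem_tensor H n) (tuples H n)"
  using free_space_completion(4)[OF tensor_kernel_psd]
  unfolding fin_tensor_def free_tensor_def elem_tensor_def[abs_def] .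

text \<open>Appending \<open>\<phi> (Suc n)\<close> multiplies the kernel by the square of the norm
  of a unit vector, so the Gram kernels agree and an isometric extension exists; density identifies
  it with the operator described in the definition.\<close>

lemma tensor_right:
  shows tensor_right_isometry:
      "isometry_op (fin_tensor H n) (fin_tensor H (Suc n)) (tensor_right H n (\<phi> (Suc n)))"
    and tensor_right_elem: "x \<in> tuples H n \<Longrightarrow>
      tensor_right H n (\<phi> (Suc n)) (elem_tensor H n x) = elem_tensor H (Suc n) (x(Suc n := \<phi> (Suc n)))"
proof -
  let ?f = "\<lambda>x. elem_tensor H (Suc n) (x(Suc n := \<phi> (Suc n)))"
  have t: "x(Suc n := \<phi> (Suc n)) \<in> tuples H (Suc n)" if "x \<in> tuples H n" for x
    using that by (auto simp: tuples_def PiE_iff extensional_def le_Suc_eq)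
  have "vinner (fin_tensor H (Suc n)) (?f x) (?f y)
      = vinner (fin_tensor H n) (elem_tensor H n x) (elem_tensor H n y)"
    if "x \<in> tuples H n" "y \<in> tuples H n" for x y
    using that by (simp add: elem_tensor_inner t)
  from isometric_extension[where e = "elem_tensor H n" and f = ?f,
      OF F.inner_product_space_axioms F.hilbert_space_axioms elem_tensor_dense _ _ this]
  obtain V where V: "isometry_op (fin_tensor H n) (fin_tensor H (Suc n)) V"
    "\<And>x. x \<in> tuples H n \<Longrightarrow> V (elem_tensor H n x) = ?f x" using t by auto
  have "tensor_right H n (\<phi> (Suc n)) = V"
    unfolding tensor_right_def
  proof (rule the_equality)
    fix W assume W: "W \<in> bounded_ops (fin_tensor H n) (fin_tensor H (Suc n)) \<and>
      (\<forall>x\<in>tuples H n. W (elem_tensor H n x) = ?f x)"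
    show "W = V"
      by (rule bounded_ops_dense_eqI[OF F.inner_product_space_axioms F.inner_product_space_axioms
            _ isometry_opD(1)[OF V(1)] elem_tensor_dense]) (use W V in auto)
  qed (use V isometry_opD(1) in auto)
  then show "isometry_op (fin_tensor H n) (fin_tensor H (Suc n)) (tensor_right H n (\<phi> (Suc n)))"
    "x \<in> tuples H n \<Longrightarrow>
      tensor_right H n (\<phi> (Suc n)) (elem_tensor H n x) = elem_tensor H (Suc n) (x(Suc n := \<phi> (Suc n)))"
    using V by auto
qed

sublocale chain: isometric_chain "fin_tensor H" "\<lambda>n. tensor_right H n (\<phi> (Suc n))"
  by unfold_locales (rule tensor_right_isometry)

lemma pre_tensor_semi: "semi_inner_product_space (pre_tensor H \<phi>)"
  unfolding pre_tensor_def by (rule chain.ind_lim_semi_inner_product_space)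

sublocale P: semi_inner_product_space "pre_tensor H \<phi>" by (rule pre_tensor_semi)

abbreviation "K \<equiv> inf_tensor H \<phi>"
abbreviation "e \<equiv> elem_inf_tensor H \<phi>"
abbreviation "E \<equiv> elem_seqs H \<phi>"

lemma inf_tensor_hilbert: "hilbert_space K"
  unfolding inf_tensor_def by (rule P.completion_hilbert_space)

sublocale K: hilbert_space K by (rule inf_tensor_hilbert)

section \<open>Infinite elementary tensors\<close>

lemma elem_seqsD: "x \<in> E \<Longrightarrow> x i \<in> carrier (H i)"
  by (simp add: elem_seqs_def)

lemma elem_seqs_tail:
  assumes "x \<in> E"
  obtains n where "\<forall>i>n. x i = \<phi> i"
  using assms finite_nat_set_iff_bounded_le[of "{i. x i \<noteq> \<phi> i}"] unfolding elem_seqs_def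
  by (metis (mono_tags, lifting) linorder_not_less mem_Collect_eq)

lemma elem_seqsI:
  assumes "\<And>i. x i \<in> carrier (H i)" "\<forall>i>n. x i = \<phi> i"
  shows "x \<in> E"
proof -
  have "{i. x i \<noteq> \<phi> i} \<subseteq> {..n}" using assms(2) by (auto simp: not_less[symmetric])
  then show ?thesis using assms(1) finite_subset unfolding elem_seqs_def by blast
qed

lemma restrict_tuple: "x \<in> E \<Longrightarrow> restrict x {..n} \<in> tuples H n"
  by (auto simp: tuples_def elem_seqsD)

definition pre_elem :: "(nat \<Rightarrow> 'a) \<Rightarrow> (nat \<times> 'a tensor) set" where
  "pre_elem x = (let n = (LEAST n. \<forall>i>n. x i = \<phi> i) in chain.emb n (elem_tensor H n (restrict x {..n})))"

text \<open>Past the least admissible stage the connecting isometries append the vectors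
  \<open>\<phi> i\<close>, which are the coordinates of \<open>x\<close> there. So any later stage
  serves as well, in particular one common to several tensors.\<close>

lemma pre_elem_eq:
  assumes x: "x \<in> E" and N: "\<forall>i>N. x i = \<phi> i"
  shows "pre_elem x = chain.emb N (elem_tensor H N (restrict x {..N}))"
proof -
  define n where "n = (LEAST n. \<forall>i>n. x i = \<phi> i)"
  have n: "\<forall>i>n. x i = \<phi> i" unfolding n_def by (rule LeastI) (rule N)
  have "n \<le> N" unfolding n_def using N by (rule Least_le)
  then have "chain.emb N (elem_tensor H N (restrict x {..N})) = chain.emb n (elem_tensor H n (restrict x {..n}))"
  proof (induction N rule: dec_induct)
    case (step m)
    have "(restrict x {..m})(Suc m := \<phi> (Suc m)) = restrict x {..Suc m}"
      using n step by (auto simp: fun_eq_iff restrict_def)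
    then have "elem_tensor H (Suc m) (restrict x {..Suc m})
        = chain.conn m (Suc m) (elem_tensor H m (restrict x {..m}))"
      using tensor_right_elem[OF restrict_tuple[OF x], of m] by (simp add: chain.conn_Suc)
    then show ?case
      using chain.emb_conn[of m "Suc m" "elem_tensor H m (restrict x {..m})"]
        elem_tensor_closed[OF restrict_tuple[OF x], of m] step(3) by (simp only: le_SucI order_refl)
  qed (rule refl)
  then show ?thesis by (simp add: pre_elem_def flip: n_def)
qed

lemma pre_elem_closed: "x \<in> E \<Longrightarrow> pre_elem x \<in> carrier (pre_tensor H \<phi>)"
  by (simp add: pre_elem_def Let_def pre_tensor_def restrict_tuple)

lemma e_eq: "e x = to_completion (pre_tensor H \<phi>) (pre_elem x)"
  by (simp add: elem_inf_tensor_def fin_to_inf_def pre_elem_def chain.emb_def Let_def)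

lemma e_closed [simp]: "x \<in> E \<Longrightarrow> e x \<in> carrier K"
  by (simp add: e_eq inf_tensor_def pre_elem_closed)

text \<open>Both tensors live at stage \<open>n\<close>, and further factors
  \<open>vinner (H i) (\<phi> i) (\<phi> i)\<close> equal 1. Inner products of elementary tensors
  are computed by this formula throughout, with \<open>n\<close> as large as the purpose at hand
  requires.\<close>

lemma e_inner:
  assumes "x \<in> E" "y \<in> E" "\<forall>i>n. x i = \<phi> i" "\<forall>i>n. y i = \<phi> i"
  shows "vinner K (e x) (e y) = (\<Prod>i\<le>n. vinner (H i) (x i) (y i))"
proof -
  have "vinner K (e x) (e y) = vinner (pre_tensor H \<phi>) (pre_elem x) (pre_elem y)"
    using assms by (simp add: e_eq inf_tensor_def P.to_completion_inner pre_elem_closed)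
  also have "\<dots> = vinner (fin_tensor H n) (elem_tensor H n (restrict x {..n})) (elem_tensor H n (restrict y {..n}))"
    using assms by (simp add: pre_elem_eq pre_tensor_def chain.emb_inner restrict_tuple)
  also have "\<dots> = (\<Prod>i\<le>n. vinner (H i) (x i) (y i))"
    using assms by (simp add: elem_tensor_inner restrict_tuple)
  finally show ?thesis .
qed

lemma e_dense: "vdense K e E"
proof -
  have "vdense (pre_tensor H \<phi>) pre_elem E"
    unfolding vdense_def
  proof (intro ballI allI impI)
    fix A :: "(nat \<times> 'a tensor) set" and \<epsilon> :: real
    assume A: "A \<in> carrier (pre_tensor H \<phi>)" and \<epsilon>: "\<epsilon> > 0"
    obtain n \<psi> where \<psi>: "\<psi> \<in> carrier (fin_tensor H n)" "A = chain.emb n \<psi>"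
      using chain.ind_lim_cases[OF A[unfolded pre_tensor_def]] by blast
    obtain l where l: "snd ` set l \<subseteq> tuples H n"
      "vdist (fin_tensor H n) \<psi> (lincomb (fin_tensor H n) (elem_tensor H n) l) < \<epsilon>"
      using elem_tensor_dense[of n] \<psi>(1) \<epsilon> unfolding vdense_def by blast
    \<comment> \<open>A finite tuple is continued by the tail of \<open>\<phi>\<close>; the
      resulting elementary tensor is the image of the finite one.\<close>
    define ext where "ext x = (\<lambda>i. if i \<le> n then x i else \<phi> i)" for x
    have ext: "ext x \<in> E" if "x \<in> tuples H n" for x
      by (rule elem_seqsI[where n = n]) (use that in \<open>auto simp: ext_def tuples_def\<close>)
    have pre: "pre_elem (ext x) = chain.emb n (elem_tensor H n x)" if x: "x \<in> tuples H n" for x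
    proof -
      have "restrict (ext x) {..n} = x" using x by (auto simp: ext_def tuples_def fun_eq_iff PiE_iff extensional_def)
      then show ?thesis using pre_elem_eq[OF ext[OF x], of n] by (simp add: ext_def)
    qed
    define l' where "l' = map (\<lambda>(c, x). (c, ext x)) l"
    have "snd ` set l' \<subseteq> E" using l(1) ext by (force simp: l'_def)
    moreover have "lincomb (pre_tensor H \<phi>) pre_elem l'
        = chain.emb n (lincomb (fin_tensor H n) (elem_tensor H n) l)"
    proof -
      have "lincomb (pre_tensor H \<phi>) pre_elem l' = lincomb (pre_tensor H \<phi>) (\<lambda>x. chain.emb n (elem_tensor H n x)) l"
        unfolding l'_def lincomb_map by (rule lincomb_cong) (use l(1) pre in blast)
      then show ?thesis
        using chain.emb_lincomb[where e = "elem_tensor H n" and X = "tuples H n", OF elem_tensor_closed l(1)]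
        by (simp add: pre_tensor_def)
    qed
    ultimately show "\<exists>l. snd ` set l \<subseteq> E \<and> vdist (pre_tensor H \<phi>) A (lincomb (pre_tensor H \<phi>) pre_elem l) < \<epsilon>"
      using l \<psi> chain.emb_vdist[of \<psi> n "lincomb (fin_tensor H n) (elem_tensor H n) l"]
        F.lincomb_closed[where X = "tuples H n", OF elem_tensor_closed l(1)]
      by (intro exI[of _ l']) (simp add: pre_tensor_def)
  qed
  from P.completion_vdense[OF this pre_elem_closed] show ?thesis
    by (simp add: inf_tensor_def e_eq[abs_def])
qed

end


section \<open>Elementary tensor operators\<close>

context tensor_factors
begin

abbreviation "tens \<equiv> tensor_op H \<phi>"

definition apply_on :: "nat set \<Rightarrow> (nat \<Rightarrow> 'a \<Rightarrow> 'a) \<Rightarrow> (nat \<Rightarrow> 'a) \<Rightarrow> nat \<Rightarrow> 'a" where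
  "apply_on J S x = (\<lambda>i. if i \<in> J then S i (x i) else x i)"

lemma apply_on_closed [simp]:
  assumes "finite J" "\<And>i. i \<in> J \<Longrightarrow> S i \<in> B_of (H i)" "x \<in> E"
  shows "apply_on J S x \<in> E"
proof -
  have "{i. apply_on J S x i \<noteq> \<phi> i} \<subseteq> J \<union> {i. x i \<noteq> \<phi> i}" by (auto simp: apply_on_def)
  then have "finite {i. apply_on J S x i \<noteq> \<phi> i}"
    using assms by (auto simp: elem_seqs_def intro: finite_subset)
  then show ?thesis
    using assms by (auto simp: elem_seqs_def apply_on_def)
qed

lemma common_tail:
  assumes "finite X" "X \<subseteq> E"
  obtains N where "N \<ge> m" "\<And>x i. x \<in> X \<Longrightarrow> i > N \<Longrightarrow> x i = \<phi> i"
proof -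
  have "\<exists>N\<ge>m. \<forall>x\<in>X. \<forall>i>N. x i = \<phi> i"
    using assms
  proof (induction X rule: finite_induct)
    case (insert x X)
    then obtain N where N: "N \<ge> m" "\<forall>x\<in>X. \<forall>i>N. x i = \<phi> i" by auto
    have "x \<in> E" using insert.prems by simp
    then obtain n where "\<forall>i>n. x i = \<phi> i" by (rule elem_seqs_tail)
    with N show ?case by (intro exI[of _ "max N n"]) auto
  qed auto
  then show thesis using that by blast
qed

lemma tail_pair:
  assumes "x \<in> E" "y \<in> E"
  obtains N where "N \<ge> m" "\<forall>i>N. x i = \<phi> i" "\<forall>i>N. y i = \<phi> i"
proof -
  obtain N where "N \<ge> m" "\<And>z i. z \<in> {x, y} \<Longrightarrow> i > N \<Longrightarrow> z i = \<phi> i"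
    using common_tail[of "{x, y}" m] assms by auto
  then show thesis using that[of N] by blast
qed

text \<open>Let \<open>\<mu>\<close> be \<open>C^2\<close> times the Gram kernel of the j-th
  coordinates minus the same kernel after applying \<open>S\<close>. It is positive because
  \<open>C\<close> bounds \<open>S\<close>, and by the Schur product theorem it stays positive after
  multiplication by the kernel \<open>R\<close> of the other factors. That is the norm inequality
  which \<open>bounded_extension\<close> asks for, with the same constant \<open>C\<close>.\<close>

lemma single_factor_bounded:
  assumes S: "S \<in> B_of (H j)"
  shows "\<exists>T\<in>B_of K. \<forall>x\<in>E. T (e x) = e (x(j := S (x j)))"
proof -
  obtain C where C: "C \<ge> 0" "\<And>v. v \<in> carrier (H j) \<Longrightarrow> vnorm (H j) (S v) \<le> C * vnorm (H j) v"
    using H.op_bound[OF S] by blast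
  have upd: "x(j := S (x j)) \<in> E" if "x \<in> E" for x
  proof -
    have "apply_on {j} (\<lambda>_. S) x \<in> E" using S that by (intro apply_on_closed) auto
    moreover have "apply_on {j} (\<lambda>_. S) x = x(j := S (x j))" by (auto simp: apply_on_def)
    ultimately show ?thesis by simp
  qed
  have "vnorm K (lincomb K (\<lambda>x. e (x(j := S (x j)))) l) \<le> C * vnorm K (lincomb K e l)"
    if l: "snd ` set l \<subseteq> E" for l
  proof (rule power2_le_imp_le)
    \<comment> \<open>\<open>N\<close> lies beyond all tails occurring in \<open>l\<close> and is at
      least \<open>j\<close>, so that the product over \<open>{..N}\<close> computes all inner
      products involved and contains the factor \<open>j\<close>.\<close>
    obtain N where N: "N \<ge> j" "\<And>x i. x \<in> snd ` set l \<Longrightarrow> i > N \<Longrightarrow> x i = \<phi> i"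
      using common_tail[OF _ l, of j] by auto
    define R where "R x y = (\<Prod>i\<in>{..N} - {j}. vinner (H i) (x i) (y i))" for x y
    define \<mu> where "\<mu> x y = complex_of_real (C\<^sup>2) * vinner (H j) (x j) (y j)
        + - 1 * vinner (H j) (S (x j)) (S (y j))" for x y
    have R: "psd_kernel R E"
      unfolding R_def by (intro psd_kernel_prod H.psd_kernel_inner) (auto simp: elem_seqsD)
    have "psd_kernel \<mu> E"
      unfolding psd_kernel_def
    proof (intro conjI ballI allI impI)
      fix x y assume "x \<in> E" "y \<in> E"
      then have "x j \<in> carrier (H j)" "y j \<in> carrier (H j)" by (auto simp: elem_seqsD)
      then show "\<mu> y x = cnj (\<mu> x y)"
        unfolding \<mu>_def using H.inner_cnj[of "x j" j "y j"] H.inner_cnj[of "S (x j)" j "S (y j)"] S by simp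
    next
      fix m :: "(complex \<times> (nat \<Rightarrow> 'a)) list" assume m: "snd ` set m \<subseteq> E"
      let ?v = "lincomb (H j) (\<lambda>x. x j) m"
      have c: "x j \<in> carrier (H j)" if "x \<in> E" for x using that by (rule elem_seqsD)
      have v: "?v \<in> carrier (H j)" using c m by (intro H.lincomb_closed[where X = E]) blast+
      have Sv: "S ?v = lincomb (H j) (\<lambda>x. S (x j)) m"
        by (rule bounded_ops_lincomb[where X = E, OF H.inner_product_space_axioms H.inner_product_space_axioms S])
          (use c m in blast)+
      have "vinner (H j) ?v ?v = kernel_form (\<lambda>x y. vinner (H j) (x j) (y j)) m m"
        using c m by (intro H.inner_lincomb[where X = E and e = "\<lambda>x. x j"]) blast+
      moreover have "vinner (H j) (S ?v) (S ?v) = kernel_form (\<lambda>x y. vinner (H j) (S (x j)) (S (y j))) m m"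
        unfolding Sv using c m H.op_closed[OF S]
        by (intro H.inner_lincomb[where X = E and e = "\<lambda>x. S (x j)"]) blast+
      ultimately have "kernel_form \<mu> m m
          = complex_of_real (C\<^sup>2) * vinner (H j) ?v ?v - vinner (H j) (S ?v) (S ?v)"
        unfolding \<mu>_def kernel_form_add kernel_form_scale by simp
      also have "Re \<dots> = (C * vnorm (H j) ?v)\<^sup>2 - (vnorm (H j) (S ?v))\<^sup>2"
        using v S by (simp add: H.vnorm_sq power_mult_distrib)
      finally show "0 \<le> Re (kernel_form \<mu> m m)"
        using power_mono[OF C(2)[OF v], of 2] v S by simp
    qed
    from psd_kernel_pos[OF schur_product[OF this R] l]
    have "0 \<le> Re (kernel_form (\<lambda>x y. \<mu> x y * R x y) l l)" .
    also have "kernel_form (\<lambda>x y. \<mu> x y * R x y) l l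
        = kernel_form (\<lambda>x y. complex_of_real (C\<^sup>2) * vinner K (e x) (e y)
            + - 1 * vinner K (e (x(j := S (x j)))) (e (y(j := S (y j))))) l l"
    proof (rule kernel_form_cong)
      fix x y assume xy: "x \<in> snd ` set l" "y \<in> snd ` set l"
      then have E: "x \<in> E" "y \<in> E" and t: "\<forall>i>N. x i = \<phi> i" "\<forall>i>N. y i = \<phi> i"
        using l N(2) by blast+
      have t': "\<forall>i>N. (x(j := S (x j))) i = \<phi> i" "\<forall>i>N. (y(j := S (y j))) i = \<phi> i"
        using t N(1) by auto
      have r: "(\<Prod>i\<le>N. f i) = f j * (\<Prod>i\<in>{..N} - {j}. f i)" for f :: "nat \<Rightarrow> complex"
        using N(1) by (intro prod.remove) auto
      have "vinner K (e x) (e y) = vinner (H j) (x j) (y j) * R x y"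
        unfolding e_inner[OF E t] r R_def ..
      moreover have "vinner K (e (x(j := S (x j)))) (e (y(j := S (y j)))) = vinner (H j) (S (x j)) (S (y j)) * R x y"
        unfolding e_inner[OF upd[OF E(1)] upd[OF E(2)] t'] r R_def
        by (intro arg_cong2[where f = "(*)"] prod.cong) auto
      ultimately show "\<mu> x y * R x y = complex_of_real (C\<^sup>2) * vinner K (e x) (e y)
            + - 1 * vinner K (e (x(j := S (x j)))) (e (y(j := S (y j))))"
        unfolding \<mu>_def by (simp add: algebra_simps)
    qed
    also have "\<dots> = complex_of_real (C\<^sup>2) * vinner K (lincomb K e l) (lincomb K e l)
        - vinner K (lincomb K (\<lambda>x. e (x(j := S (x j)))) l) (lincomb K (\<lambda>x. e (x(j := S (x j)))) l)"
      unfolding kernel_form_add kernel_form_scale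
      using K.inner_lincomb[where X = E and e = e, OF e_closed l l]
        K.inner_lincomb[where X = E and e = "\<lambda>x. e (x(j := S (x j)))", OF e_closed[OF upd] l l] by simp
    also have "Re \<dots> = (C * vnorm K (lincomb K e l))\<^sup>2 - (vnorm K (lincomb K (\<lambda>x. e (x(j := S (x j)))) l))\<^sup>2"
      using K.lincomb_closed[where X = E and e = e, OF e_closed l]
        K.lincomb_closed[where X = E and e = "\<lambda>x. e (x(j := S (x j)))", OF e_closed[OF upd] l]
      by (simp add: K.vnorm_sq power_mult_distrib)
    finally show "(vnorm K (lincomb K (\<lambda>x. e (x(j := S (x j)))) l))\<^sup>2 \<le> (C * vnorm K (lincomb K e l))\<^sup>2"
      by simp
    show "0 \<le> C * vnorm K (lincomb K e l)"
      using C K.lincomb_closed[where X = E and e = e, OF e_closed l] by simp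
  qed
  from bounded_extension[where e = e and X = E and f = "\<lambda>x. e (x(j := S (x j)))",
      OF K.inner_product_space_axioms K.hilbert_space_axioms e_dense e_closed e_closed[OF upd] C(1) this]
  show ?thesis by blast
qed

text \<open>Single factors are composed one after the other; distinct factors do not interfere, so
  the order is immaterial.\<close>

lemma tensor_op_exists:
  assumes "finite J" "\<And>i. i \<in> J \<Longrightarrow> S i \<in> B_of (H i)"
  shows "\<exists>T\<in>B_of K. \<forall>x\<in>E. T (e x) = e (apply_on J S x)"
  using assms
proof (induction J rule: finite_induct)
  case empty
  show ?case by (rule bexI[of _ "id_op K"]) (auto simp: apply_on_def)
next
  case (insert j J)
  then obtain T where T: "T \<in> B_of K" "\<And>x. x \<in> E \<Longrightarrow> T (e x) = e (apply_on J S x)" by auto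
  obtain R where R: "R \<in> B_of K" "\<And>x. x \<in> E \<Longrightarrow> R (e x) = e (x(j := S j (x j)))"
    using single_factor_bounded[of "S j" j] insert.prems by auto
  have "(apply_on J S x)(j := S j (apply_on J S x j)) = apply_on (insert j J) S x" for x
    using insert.hyps by (auto simp: apply_on_def)
  then show ?case
    using T R insert by (intro bexI[of _ "mult_op K R T"]) auto
qed

lemma tensor_op:
  assumes "finite J" "\<And>i. i \<in> J \<Longrightarrow> S i \<in> B_of (H i)"
  shows tensor_op_closed [simp]: "tens J S \<in> B_of K"
    and tensor_op_elem: "x \<in> E \<Longrightarrow> tens J S (e x) = e (apply_on J S x)"
proof -
  obtain T where T: "T \<in> B_of K" "\<And>x. x \<in> E \<Longrightarrow> T (e x) = e (apply_on J S x)"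
    using tensor_op_exists[OF assms] by blast
  have "tens J S = T"
    unfolding tensor_op_def
  proof (rule the_equality)
    fix R assume R: "R \<in> B_of K \<and> (\<forall>x\<in>E. R (e x) = e (\<lambda>i. if i \<in> J then S i (x i) else x i))"
    show "R = T"
      by (rule bounded_ops_dense_eqI[OF K.inner_product_space_axioms K.inner_product_space_axioms
            _ T(1) e_dense]) (use R T in \<open>auto simp: apply_on_def\<close>)
  qed (use T in \<open>auto simp: apply_on_def\<close>)
  then show "tens J S \<in> B_of K" "x \<in> E \<Longrightarrow> tens J S (e x) = e (apply_on J S x)"
    using T by auto
qed

section \<open>Products, adjoints and conjugations of elementary tensor operators\<close>

lemma op_dense_eqI:
  assumes "S \<in> B_of K" "T \<in> B_of K" "\<And>x. x \<in> E \<Longrightarrow> S (e x) = T (e x)"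
  shows "S = T"
  by (rule bounded_ops_dense_eqI[OF K.inner_product_space_axioms K.inner_product_space_axioms
        assms(1,2) e_dense]) (use assms in auto)

lemma inner_dense_eqI:
  assumes "v \<in> carrier K" "w \<in> carrier K" "\<And>x. x \<in> E \<Longrightarrow> vinner K v (e x) = vinner K w (e x)"
  shows "v = w"
  by (rule K.vdense_inner_eqI[OF e_dense _ assms(1,2)]) (use assms in auto)

lemma tensor_op_eqI:
  assumes "finite J" "\<And>i. i \<in> J \<Longrightarrow> S i \<in> B_of (H i)" "\<And>i. i \<in> J \<Longrightarrow> S' i \<in> B_of (H i)"
    and "\<And>i v. i \<in> J \<Longrightarrow> v \<in> carrier (H i) \<Longrightarrow> S i v = S' i v"
  shows "tens J S = tens J S'"
proof (rule op_dense_eqI)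
  fix x assume x: "x \<in> E"
  then have "apply_on J S x = apply_on J S' x" using assms(4) elem_seqsD by (auto simp: apply_on_def)
  then show "tens J S (e x) = tens J S' (e x)"
    using assms x by (simp add: tensor_op_elem)
qed (use assms in auto)

lemma tensor_op_mult:
  assumes "finite J" "\<And>i. i \<in> J \<Longrightarrow> S i \<in> B_of (H i)" "\<And>i. i \<in> J \<Longrightarrow> S' i \<in> B_of (H i)"
  shows "mult_op K (tens J S) (tens J S') = tens J (\<lambda>i. mult_op (H i) (S i) (S' i))"
proof (rule op_dense_eqI)
  fix x assume x: "x \<in> E"
  have "apply_on J S (apply_on J S' x) = apply_on J (\<lambda>i. mult_op (H i) (S i) (S' i)) x"
    using elem_seqsD[OF x] by (auto simp: apply_on_def)
  then show "mult_op K (tens J S) (tens J S') (e x)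
      = tens J (\<lambda>i. mult_op (H i) (S i) (S' i)) (e x)"
    using assms x by (simp add: tensor_op_elem)
qed (use assms in auto)

lemma tensor_op_adj:
  assumes J: "finite J" and S: "\<And>i. i \<in> J \<Longrightarrow> S i \<in> B_of (H i)"
  shows "adj_op K (tens J S) = tens J (\<lambda>i. adj_op (H i) (S i))"
proof (rule op_dense_eqI)
  have S': "\<And>i. i \<in> J \<Longrightarrow> adj_op (H i) (S i) \<in> B_of (H i)" using S by simp
  note T = tensor_op[OF J S] and T' = tensor_op[OF J S']
  fix x assume x: "x \<in> E"
  show "adj_op K (tens J S) (e x) = tens J (\<lambda>i. adj_op (H i) (S i)) (e x)"
  proof (rule inner_dense_eqI)
    fix y assume y: "y \<in> E"
    have c: "apply_on J S y \<in> E" "apply_on J (\<lambda>i. adj_op (H i) (S i)) x \<in> E" using J S x y by auto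
    \<comment> \<open>\<open>N\<close> also bounds \<open>J\<close>, so that the two modified
      sequences have tail \<open>\<phi>\<close> beyond \<open>N\<close>; inserting 0 covers the
      empty \<open>J\<close>.\<close>
    obtain N where N: "\<forall>i>N. x i = \<phi> i" "\<forall>i>N. y i = \<phi> i" "N \<ge> Max (insert 0 J)"
      using tail_pair[OF x y] by metis
    have J': "i \<notin> J" if "i > N" for i using N(3) J that Max_ge[of "insert 0 J" i] by fastforce
    have t: "\<forall>i>N. apply_on J S y i = \<phi> i" "\<forall>i>N. apply_on J (\<lambda>i. adj_op (H i) (S i)) x i = \<phi> i"
      using N J' by (auto simp: apply_on_def)
    have "vinner K (adj_op K (tens J S) (e x)) (e y) = vinner K (e x) (e (apply_on J S y))"
      using x y T by (simp add: K.inner_adj_left)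
    also have "\<dots> = vinner K (e (apply_on J (\<lambda>i. adj_op (H i) (S i)) x)) (e y)"
      unfolding e_inner[OF x c(1) N(1) t(1)] e_inner[OF c(2) y t(2) N(2)]
      using elem_seqsD[OF x] elem_seqsD[OF y] S
      by (intro prod.cong refl) (auto simp: apply_on_def H.inner_adj_left)
    finally show "vinner K (adj_op K (tens J S) (e x)) (e y)
        = vinner K (tens J (\<lambda>i. adj_op (H i) (S i)) (e x)) (e y)"
      using T' x by simp
  qed (use x T(1) T'(1) in \<open>simp_all add: K.op_closed\<close>)
qed (use assms in auto)

text \<open>Padding by identities; it brings operators with different index sets over a common
  one.\<close>

lemma tensor_op_mono:
  assumes "finite J'" "J \<subseteq> J'" "\<And>i. i \<in> J \<Longrightarrow> S i \<in> B_of (H i)"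
  shows "tens J S = tens J' (\<lambda>i. if i \<in> J then S i else id_op (H i))"
proof (rule op_dense_eqI)
  have J: "finite J" using assms finite_subset by blast
  show "tens J S \<in> B_of K" "tens J' (\<lambda>i. if i \<in> J then S i else id_op (H i)) \<in> B_of K"
    using assms J by auto
  fix x assume x: "x \<in> E"
  have "apply_on J S x = apply_on J' (\<lambda>i. if i \<in> J then S i else id_op (H i)) x"
    using elem_seqsD[OF x] assms(2) by (auto simp: apply_on_def fun_eq_iff)
  then show "tens J S (e x) = tens J' (\<lambda>i. if i \<in> J then S i else id_op (H i)) (e x)"
    using assms x J by (simp add: tensor_op_elem)
qed

lemma tensor_op_unitary:
  assumes J: "finite J" and U: "\<And>i. i \<in> J \<Longrightarrow> unitary_op (H i) (U i)"
  shows "unitary_op K (tens J U)"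
proof -
  have UB: "\<And>i. i \<in> J \<Longrightarrow> U i \<in> B_of (H i)" and UA: "\<And>i. i \<in> J \<Longrightarrow> adj_op (H i) (U i) \<in> B_of (H i)"
    using U by (auto simp: unitary_op_def)
  have adj: "adj_op K (tens J U) = tens J (\<lambda>i. adj_op (H i) (U i))"
    using J UB by (rule tensor_op_adj)
  have m1: "mult_op K (tens J (\<lambda>i. adj_op (H i) (U i))) (tens J U)
      = tens J (\<lambda>i. mult_op (H i) (adj_op (H i) (U i)) (U i))"
    using J UA UB by (rule tensor_op_mult)
  have m2: "mult_op K (tens J U) (tens J (\<lambda>i. adj_op (H i) (U i)))
      = tens J (\<lambda>i. mult_op (H i) (U i) (adj_op (H i) (U i)))"
    using J UB UA by (rule tensor_op_mult)
  have one: "id_op K = tens J (\<lambda>i. id_op (H i))"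
    using tensor_op_mono[OF J, of "{}"] tensor_op(1)[of "{}"]
    by (intro op_dense_eqI) (use J elem_seqsD in \<open>auto simp: tensor_op_elem apply_on_def fun_eq_iff cong: if_cong\<close>)
  show ?thesis
    unfolding unitary_op_def
  proof (intro conjI)
    show "mult_op K (adj_op K (tens J U)) (tens J U) = id_op K"
      unfolding adj m1 one
      by (rule tensor_op_eqI) (use J U UB in \<open>auto simp: unitary_op_def\<close>)
    show "mult_op K (tens J U) (adj_op K (tens J U)) = id_op K"
      unfolding adj m2 one
      by (rule tensor_op_eqI) (use J U UB in \<open>auto simp: unitary_op_def\<close>)
  qed (use J UB in auto)
qed

text \<open>Factors of \<open>U\<close> outside \<open>J\<close> cancel, so \<open>J'\<close> may be any larger finite set.\<close>

lemma tensor_op_Ad: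
  assumes J: "finite J'" "J \<subseteq> J'" and S: "\<And>i. i \<in> J \<Longrightarrow> S i \<in> B_of (H i)"
    and U: "\<And>i. unitary_op (H i) (U i)"
  shows "Ad_op K (tens J' U) (tens J S) = tens J (\<lambda>i. Ad_op (H i) (U i) (S i))"
proof -
  let ?S = "\<lambda>i. if i \<in> J then S i else id_op (H i)"
  have UB: "U i \<in> B_of (H i)" "adj_op (H i) (U i) \<in> B_of (H i)" for i
    using H.unitary_closed[OF U] by auto
  have SB: "?S i \<in> B_of (H i)" for i using S by simp
  have m: "tens J S = tens J' ?S" using J S by (rule tensor_op_mono)
  have "Ad_op K (tens J' U) (tens J S)
      = mult_op K (tens J' U) (mult_op K (tens J' ?S) (tens J' (\<lambda>i. adj_op (H i) (U i))))"
    unfolding m using J UB SB by (simp add: Ad_op_def tensor_op_adj)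
  also have "\<dots> = tens J' (\<lambda>i. mult_op (H i) (U i) (mult_op (H i) (?S i) (adj_op (H i) (U i))))"
    using J UB SB by (simp add: tensor_op_mult)
  also have "\<dots> = tens J' (\<lambda>i. if i \<in> J then Ad_op (H i) (U i) (S i) else id_op (H i))"
    by (rule tensor_op_eqI) (use J UB SB S U in \<open>auto simp: Ad_op_def H.unitary_adj_right\<close>)
  also have "\<dots> = tens J (\<lambda>i. Ad_op (H i) (U i) (S i))"
    by (rule tensor_op_mono[symmetric]) (use J S UB in auto)
  finally show ?thesis .
qed


section \<open>Irreducibility\<close>

abbreviation "\<Omega> \<equiv> e \<phi>"
abbreviation "ops \<equiv> tensor_ops H \<phi> (\<lambda>i. B_of (H i))"

lemma phi_elem [simp]: "\<phi> \<in> E"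
  by (simp add: elem_seqs_def)

lemma tensor_opsI: "finite J \<Longrightarrow> (\<And>i. i \<in> J \<Longrightarrow> S i \<in> B_of (H i)) \<Longrightarrow> tens J S \<in> ops"
  by (auto simp: tensor_ops_def)

lemma tensor_ops_closed: "ops \<subseteq> B_of K"
  by (auto simp: tensor_ops_def)

lemma Omega_inner [simp]: "vinner K \<Omega> \<Omega> = 1"
  using e_inner[of \<phi> \<phi> 0] by simp

lemma Omega_norm [simp]: "vnorm K \<Omega> = 1"
  by (simp add: vnorm_def)

text \<open>Cyclicity of \<open>\<Omega>\<close> with explicit operators: in each of finitely many
  factors a rank one operator takes the unit vector \<open>\<phi> i\<close> to
  \<open>x i\<close>.\<close>

lemma elem_from_Omega:
  assumes x: "x \<in> E" and t: "\<forall>i>n. x i = \<phi> i"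
  shows "tens {..n} (\<lambda>i. rank_one (H i) (x i) (\<phi> i)) \<Omega> = e x"
proof -
  have "apply_on {..n} (\<lambda>i. rank_one (H i) (x i) (\<phi> i)) \<phi> = x"
    using t elem_seqsD[OF x] by (auto simp: apply_on_def fun_eq_iff)
  then show ?thesis using elem_seqsD[OF x] by (simp add: tensor_op_elem)
qed

text \<open>The operator projects the factors up to \<open>n\<close> and leaves the others alone. As
  \<open>e x\<close> already has \<open>\<phi> i\<close> in all further factors, this amounts to
  projecting onto \<open>\<Omega>\<close>; for a vector with a different tail it need not.\<close>

lemma vacuum_projection:
  assumes x: "x \<in> E" and t: "\<forall>i>n. x i = \<phi> i"
  shows "tens {..n} (\<lambda>i. rank_one (H i) (\<phi> i) (\<phi> i)) (e x) = vscale K (vinner K (e x) \<Omega>) \<Omega>"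
proof (rule inner_dense_eqI)
  fix y assume y: "y \<in> E"
  let ?x = "apply_on {..n} (\<lambda>i. rank_one (H i) (\<phi> i) (\<phi> i)) x"
  obtain N where N: "N \<ge> n" "\<forall>i>N. x i = \<phi> i" "\<forall>i>N. y i = \<phi> i" using tail_pair[OF x y] by metis
  have x': "?x \<in> E" using x by simp
  have x't: "\<forall>i>N. ?x i = \<phi> i" using N by (auto simp: apply_on_def)
  have "vinner K (tens {..n} (\<lambda>i. rank_one (H i) (\<phi> i) (\<phi> i)) (e x)) (e y)
      = (\<Prod>i\<le>N. vinner (H i) (?x i) (y i))"
    using x x' y x't N by (simp add: tensor_op_elem e_inner)
  also have "\<dots> = (\<Prod>i\<le>N. vinner (H i) (x i) (\<phi> i) * vinner (H i) (\<phi> i) (y i))"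
    using elem_seqsD[OF x] elem_seqsD[OF y] t
    by (intro prod.cong refl) (auto simp: apply_on_def H.inner_scale)
  also have "\<dots> = vinner K (e x) \<Omega> * vinner K \<Omega> (e y)"
    using x y N by (simp add: e_inner prod.distrib)
  finally show "vinner K (tens {..n} (\<lambda>i. rank_one (H i) (\<phi> i) (\<phi> i)) (e x)) (e y)
      = vinner K (vscale K (vinner K (e x) \<Omega>) \<Omega>) (e y)"
    using x y by (simp add: K.inner_scale)
qed (use x in auto)

text \<open>Commuting with the projections above forces \<open>S \<Omega>\<close> to be a multiple
  of \<open>\<Omega>\<close>; this is tested against one elementary tensor at a time, with
  \<open>n\<close> depending on it. Commuting with the operators that take \<open>\<Omega>\<close>
  to \<open>e x\<close> then carries the factor \<open>c\<close> to every elementary tensor.\<close>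

theorem commutant_tensor_ops:
  assumes S: "S \<in> commutant K ops"
  obtains c where "S = scale_op K c (id_op K)"
proof -
  have SB: "S \<in> B_of K" using S by (simp add: commutant_def)
  have comm: "S (T v) = T (S v)" if "T \<in> ops" "v \<in> carrier K" for T v
  proof -
    have "mult_op K S T = mult_op K T S" using S that(1) by (simp add: commutant_def)
    from fun_cong[OF this, of v] show ?thesis using that(2) by simp
  qed
  define c where "c = vinner K (S \<Omega>) \<Omega>"
  have SO: "S \<Omega> = vscale K c \<Omega>"
  proof (rule inner_dense_eqI)
    fix x assume x: "x \<in> E"
    obtain n where n: "\<forall>i>n. x i = \<phi> i" using elem_seqs_tail[OF x] .
    let ?r = "\<lambda>i. rank_one (H i) (\<phi> i) (\<phi> i)"
    let ?P = "tens {..n} ?r"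
    have P: "?P \<in> ops" "?P \<in> B_of K" by (auto intro!: tensor_opsI)
    have adj: "adj_op K ?P = ?P" by (simp add: tensor_op_adj H.adj_rank_one)
    have PO: "?P \<Omega> = \<Omega>" using vacuum_projection[of \<phi> n] by simp
    have "vinner K (S \<Omega>) (e x) = vinner K (?P (S \<Omega>)) (e x)" using comm[OF P(1), of \<Omega>] PO by simp
    also have "\<dots> = vinner K (S \<Omega>) (?P (e x))"
      using K.inner_adj_left[OF P(2), of "S \<Omega>" "e x"] SB x unfolding adj by simp
    also have "\<dots> = vinner K (vscale K c \<Omega>) (e x)"
      using x SB vacuum_projection[OF x n] K.inner_cnj[of "e x" \<Omega>]
      by (simp add: K.inner_simps c_def)
    finally show "vinner K (S \<Omega>) (e x) = vinner K (vscale K c \<Omega>) (e x)" .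
  qed (use SB in auto)
  have "S = scale_op K c (id_op K)"
  proof (rule op_dense_eqI)
    fix x assume x: "x \<in> E"
    obtain n where n: "\<forall>i>n. x i = \<phi> i" using elem_seqs_tail[OF x] .
    let ?T = "tens {..n} (\<lambda>i. rank_one (H i) (x i) (\<phi> i))"
    have T: "?T \<in> ops" "?T \<in> B_of K" using elem_seqsD[OF x] by (auto intro!: tensor_opsI)
    have "S (e x) = ?T (S \<Omega>)" using comm[OF T(1), of \<Omega>] elem_from_Omega[OF x n] by simp
    also have "\<dots> = vscale K c (e x)" unfolding SO using T(2) elem_from_Omega[OF x n] by (simp add: K.op_scale)
    finally show "S (e x) = scale_op K c (id_op K) (e x)" using x by simp
  qed (use SB in auto)
  then show thesis by (rule that)
qed

text \<open>The commutant of any set containing \<open>ops\<close> consists of scalars, so its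
  bicommutant is everything; thus \<open>B_of K\<close> is the only von Neumann algebra in the
  intersection.\<close>

lemma vN_tensor_eq: "vN_tensor H \<phi> (\<lambda>i. B_of (H i)) = B_of K"
proof -
  have full: "commutant K (commutant K M) = B_of K" if "ops \<subseteq> M" for M
  proof
    show "B_of K \<subseteq> commutant K (commutant K M)"
    proof
      fix T assume T: "T \<in> B_of K"
      have "mult_op K T S = mult_op K S T" if "S \<in> commutant K M" for S
      proof -
        have "S \<in> commutant K ops" using that \<open>ops \<subseteq> M\<close> by (auto simp: commutant_def)
        then obtain c where "S = scale_op K c (id_op K)" by (rule commutant_tensor_ops)
        then show ?thesis using T by (intro K.op_eqI) (auto simp: K.op_scale)
      qed
      then show "T \<in> commutant K (commutant K M)" using T by (simp add: commutant_def)
    qed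
  qed (auto simp: commutant_def)
  have "von_neumann_algebra K (B_of K)"
    using full[OF tensor_ops_closed] K.star_algebra_B by (simp add: von_neumann_algebra_def)
  moreover have "M = B_of K" if "von_neumann_algebra K M" "ops \<subseteq> M" for M
    using that full[OF that(2)] by (simp add: von_neumann_algebra_def)
  ultimately have "{M. von_neumann_algebra K M \<and> ops \<subseteq> M} = {B_of K}"
    using tensor_ops_closed by blast
  then show ?thesis by (simp add: vN_tensor_def generated_vN_algebra_def)
qed

text \<open>
  Both automorphisms are spatial, and the two implementing unitaries differ by an operator in the
  commutant of the elementary tensor operators, that is, by a scalar.
\<close>

theorem star_auto_unique:
  assumes b: "\<beta> \<in> star_auto K (B_of K)" and b': "\<beta>' \<in> star_auto K (B_of K)"
    and eq: "\<And>T. T \<in> ops \<Longrightarrow> \<beta> T = \<beta>' T"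
  shows "\<beta> = \<beta>'"
proof -
  have O: "\<Omega> \<in> carrier K" by simp
  obtain W where W: "unitary_op K W" "\<And>T x. T \<in> B_of K \<Longrightarrow> x \<in> carrier K \<Longrightarrow> \<beta> T (W x) = W (T x)"
    using K.star_auto_spatial[OF b O] by auto
  obtain W' where W': "unitary_op K W'" "\<And>T x. T \<in> B_of K \<Longrightarrow> x \<in> carrier K \<Longrightarrow> \<beta>' T (W' x) = W' (T x)"
    using K.star_auto_spatial[OF b' O] by auto
  have B: "W \<in> B_of K" "W' \<in> B_of K" using W W' K.unitary_closed by auto
  define R where "R = mult_op K (adj_op K W') W"
  have R: "R \<in> B_of K" using B by (simp add: R_def)
  have WR: "W' (R x) = W x" if "x \<in> carrier K" for x
    using that B K.unitary_adj_right[OF W'(1)] by (simp add: R_def)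
  have "R \<in> commutant K ops"
    unfolding commutant_def
  proof (intro CollectI conjI R ballI)
    fix T assume T: "T \<in> ops"
    then have TB: "T \<in> B_of K" using tensor_ops_closed by blast
    show "mult_op K R T = mult_op K T R"
    proof (rule K.op_eqI)
      fix x assume x: "x \<in> carrier K"
      have "W' (R (T x)) = W (T x)" using WR TB x by simp
      also have "\<dots> = \<beta>' T (W' (R x))" using W(2)[OF TB x] eq[OF T] WR[OF x] by simp
      also have "\<dots> = W' (T (R x))" using W'(2)[OF TB] R x by simp
      finally have "adj_op K W' (W' (R (T x))) = adj_op K W' (W' (T (R x)))" by simp
      then show "mult_op K R T x = mult_op K T R x"
        using K.unitary_adj_left[OF W'(1)] R TB x by simp
    qed (use R TB in auto)
  qed
  then obtain c where c: "R = scale_op K c (id_op K)" by (rule commutant_tensor_ops)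
  have Wc: "W x = vscale K c (W' x)" if "x \<in> carrier K" for x
    using WR[OF that] that B by (simp add: c K.op_scale)
  have "\<beta> T = \<beta>' T" if T: "T \<in> B_of K" for T
  proof (rule K.op_eqI)
    fix y assume y: "y \<in> carrier K"
    define x where "x = adj_op K W y"
    have x: "x \<in> carrier K" "W x = y" using y B K.unitary_adj_right[OF W(1)] by (auto simp: x_def)
    \<comment> \<open>The scalar \<open>c\<close> is pulled out of \<open>W (T x)\<close> and pushed
      back into \<open>W x\<close> through the linear operator \<open>\<beta>' T\<close>.\<close>
    have "\<beta> T (W x) = vscale K c (\<beta>' T (W' x))"
      using W(2)[OF T x(1)] W'(2)[OF T x(1)] Wc[of "T x"] T x(1) by simp
    also have "\<dots> = \<beta>' T (W x)"
      using Wc[OF x(1)] x(1) B star_autoD(1)[OF b' T] by (simp add: K.op_scale)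
    finally show "\<beta> T y = \<beta>' T y" by (simp add: x)
  qed (use T star_autoD(1)[OF b] star_autoD(1)[OF b'] in auto)
  then show ?thesis
    using star_autoD(4)[OF b] star_autoD(4)[OF b'] by (meson extensionalityI)
qed

end


section \<open>Homomorphisms on generated star-algebras\<close>

text \<open>In contrast to \<open>star_auto\<close>, the values lie in \<open>B_of H\<close> and no
  bijection of \<open>A\<close> is asked: an automorphism of \<open>B_of K\<close>, restricted to
  the algebraic tensor product, has to be compared with an automorphism of the latter.\<close>

definition star_hom :: "'a cspace \<Rightarrow> ('a \<Rightarrow> 'a) set \<Rightarrow> (('a \<Rightarrow> 'a) \<Rightarrow> 'a \<Rightarrow> 'a) \<Rightarrow> bool" where
  "star_hom H A \<beta> \<longleftrightarrow> (\<forall>S\<in>A. \<beta> S \<in> B_of H) \<and>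
     (\<forall>S\<in>A. \<forall>T\<in>A. \<beta> (add_op H S T) = add_op H (\<beta> S) (\<beta> T)) \<and>
     (\<forall>S\<in>A. \<forall>T\<in>A. \<beta> (mult_op H S T) = mult_op H (\<beta> S) (\<beta> T)) \<and>
     (\<forall>c. \<forall>T\<in>A. \<beta> (scale_op H c T) = scale_op H c (\<beta> T)) \<and>
     (\<forall>T\<in>A. \<beta> (adj_op H T) = adj_op H (\<beta> T))"

lemma star_auto_hom: "A \<subseteq> B_of H \<Longrightarrow> \<beta> \<in> star_auto H A \<Longrightarrow> star_hom H A \<beta>"
  using star_autoD(1)[of \<beta> H A] unfolding star_hom_def star_auto_def by blast

lemma star_hom_subset: "star_hom H B \<beta> \<Longrightarrow> A \<subseteq> B \<Longrightarrow> star_hom H A \<beta>"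
  unfolding star_hom_def by blast

context hilbert_space
begin

lemma scale_op_zero: "T \<in> B_of H \<Longrightarrow> scale_op H 0 T = (\<lambda>x\<in>carrier H. vzero H)"
  by (rule op_eqI) auto

lemma generated_star_algebra:
  assumes "X \<subseteq> B_of H"
  shows "star_algebra H (generated_star_algebra H X)" "X \<subseteq> generated_star_algebra H X"
    "generated_star_algebra H X \<subseteq> B_of H"
    "star_algebra H A \<Longrightarrow> X \<subseteq> A \<Longrightarrow> generated_star_algebra H X \<subseteq> A"
proof -
  show B: "generated_star_algebra H X \<subseteq> B_of H"
    using assms star_algebra_B by (auto simp: generated_star_algebra_def)
  show "X \<subseteq> generated_star_algebra H X" by (auto simp: generated_star_algebra_def)
  show "star_algebra H A \<Longrightarrow> X \<subseteq> A \<Longrightarrow> generated_star_algebra H X \<subseteq> A"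
    by (auto simp: generated_star_algebra_def)
  show "star_algebra H (generated_star_algebra H X)"
    unfolding star_algebra_def
    by (intro conjI B) (auto simp: generated_star_algebra_def star_algebra_def)
qed

text \<open>The operators on which both maps agree form a star-algebra that contains
  \<open>X\<close>, hence all of the generated one.\<close>

lemma star_hom_eq_on_generated:
  assumes X: "X \<subseteq> B_of H"
    and b: "star_hom H (generated_star_algebra H X) \<beta>" and c: "star_hom H (generated_star_algebra H X) \<gamma>"
    and eq: "\<And>T. T \<in> X \<Longrightarrow> \<beta> T = \<gamma> T" and T: "T \<in> generated_star_algebra H X"
  shows "\<beta> T = \<gamma> T"
proof -
  let ?A = "generated_star_algebra H X"
  note A = generated_star_algebra[OF X]
  \<comment> \<open>The zero operator is \<open>0\<close> times an operator, hence fixed by every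
    homomorphism; the set of agreement must contain it.\<close>
  have z: "\<delta> (\<lambda>x\<in>carrier H. vzero H) = (\<lambda>x\<in>carrier H. vzero H)" if "star_hom H ?A \<delta>" for \<delta>
  proof -
    have "(\<lambda>x\<in>carrier H. vzero H) \<in> ?A" using A(1) by (simp add: star_algebra_def)
    then show ?thesis
      using that scale_op_zero[of "\<lambda>x\<in>carrier H. vzero H"] scale_op_zero[of "\<delta> (\<lambda>x\<in>carrier H. vzero H)"]
      unfolding star_hom_def by (metis zero_op_closed)
  qed
  have "star_algebra H {T\<in>?A. \<beta> T = \<gamma> T}"
    using A(1) A(3) b c z[OF b] z[OF c] unfolding star_algebra_def star_hom_def by auto
  then show ?thesis using A(4)[of "{T\<in>?A. \<beta> T = \<gamma> T}"] A(2) eq T by blast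
qed

lemma Ad_op_hom: "unitary_op H U \<Longrightarrow> star_hom H (B_of H) (Ad_op H U)"
  by (rule star_auto_hom[OF order_refl Ad_op_star_auto])

lemma star_auto_compose:
  assumes b: "\<beta> \<in> star_auto H A" and c: "\<gamma> \<in> star_auto H A" and A: "star_algebra H A"
  shows "compose A \<beta> \<gamma> \<in> star_auto H A"
proof -
  have "compose A \<beta> \<gamma> \<in> Bij A" using b c compose_Bij by (auto simp: star_auto_def)
  then show ?thesis
    using A star_autoD[OF b] star_autoD[OF c] unfolding star_auto_def star_algebra_def
    by (auto simp: compose_eq)
qed


section \<open>Strong limits of unitaries\<close>

text \<open>Isometries are uniformly bounded, so splitting the error into three parts carries the
  Cauchy property from a total family to every vector; linearity and inner products pass to the
  limit.\<close>

lemma strong_limit_isometry: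
  assumes W: "\<And>n. isometry_op H H (W n)" and d: "vdense H e X"
    and e: "\<And>x. x \<in> X \<Longrightarrow> e x \<in> carrier H"
    and c: "\<And>x. x \<in> X \<Longrightarrow> (\<lambda>n. W n (e x)) \<in> cauchy_seqs H"
  shows "\<exists>V. isometry_op H H V \<and> (\<forall>v\<in>carrier H. vlim H (\<lambda>n. W n v) (V v))"
proof -
  have WB: "W n \<in> B_of H" for n by (rule isometry_opD(1)[OF W])
  note iso = isometry_op_vdist[OF inner_product_space_axioms W]
  have lin: "(\<lambda>n. W n (lincomb H e l)) \<in> cauchy_seqs H" if "snd ` set l \<subseteq> X" for l
    using that
  proof (induction l)
    case Nil
    have "W n (vzero H) = vzero H" for n
      using bounded_ops_zero[OF inner_product_space_axioms inner_product_space_axioms WB] .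
    then show ?case by (simp add: cauchy_const)
  next
    case (Cons p l)
    then have l: "lincomb H e l \<in> carrier H" "e (snd p) \<in> carrier H" "snd p \<in> X"
      using e by (auto intro: lincomb_closed[where X = X])
    have "W n (lincomb H e (p # l)) = vadd H (vscale H (fst p) (W n (e (snd p)))) (W n (lincomb H e l))" for n
      using l WB by (simp add: op_add op_scale)
    then show ?case
      using cauchy_add[OF cauchy_scale[OF c[OF l(3)], of "fst p"]] Cons by simp
  qed
  have cauchy: "(\<lambda>n. W n v) \<in> cauchy_seqs H" if v: "v \<in> carrier H" for v
  proof (rule cauchyI)
    fix r :: real assume "r > 0"
    then have r3: "r / 3 > 0" by simp
    obtain l where l: "snd ` set l \<subseteq> X" "vdist H v (lincomb H e l) < r / 3"
      using d v r3 unfolding vdense_def by blast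
    let ?l = "lincomb H e l"
    have lc: "?l \<in> carrier H" using l(1) e by (intro lincomb_closed[where X = X])
    obtain N where N: "\<And>m n. m \<ge> N \<Longrightarrow> n \<ge> N \<Longrightarrow> vdist H (W m ?l) (W n ?l) < r / 3"
      using lin[OF l(1)] r3 unfolding cauchy_seqs_def by blast
    have "vdist H (W m v) (W n v) < r" if "m \<ge> N" "n \<ge> m" for m n
    proof -
      have "vdist H (W m v) (W n v) \<le> vdist H (W m v) (W m ?l) + (vdist H (W m ?l) (W n ?l) + vdist H (W n ?l) (W n v))"
        using vdist_triangle[of "W m v" "W m ?l" "W n v"] vdist_triangle[of "W m ?l" "W n ?l" "W n v"] WB lc v
        by force
      also have "\<dots> < r / 3 + (r / 3 + r / 3)"
        using N[of m n] that l(2) lc v vdist_commute[OF v lc] by (intro add_strict_mono) (simp_all add: iso)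
      finally show ?thesis by simp
    qed
    then show "\<exists>N. \<forall>m\<ge>N. \<forall>n\<ge>m. vdist H (W m v) (W n v) < r" by blast
  qed (use WB v in simp)
  then have "\<forall>v\<in>carrier H. \<exists>w\<in>carrier H. vlim H (\<lambda>n. W n v) w"
    using complete unfolding vlim_def by blast
  then obtain V' where V': "\<And>v. v \<in> carrier H \<Longrightarrow> V' v \<in> carrier H"
    "\<And>v. v \<in> carrier H \<Longrightarrow> vlim H (\<lambda>n. W n v) (V' v)" by metis
  define V where "V = restrict V' (carrier H)"
  have V: "V v \<in> carrier H" "vlim H (\<lambda>n. W n v) (V v)" if "v \<in> carrier H" for v
    using V' that by (auto simp: V_def)
  have "isometry_op H H V"
  proof (rule isometry_opI[OF inner_product_space_axioms])
    fix v w assume c: "v \<in> carrier H" "w \<in> carrier H"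
    show "V (vadd H v w) = vadd H (V v) (V w)"
    proof (rule vlim_unique)
      show "vlim H (\<lambda>n. W n (vadd H v w)) (V (vadd H v w))" using c by (intro V) simp
      show "vlim H (\<lambda>n. W n (vadd H v w)) (vadd H (V v) (V w))"
        using vlim_add[OF V(2)[OF c(1)] V(2)[OF c(2)]] c WB V by (simp add: op_add)
    qed (use c V WB in auto)
    have "(\<lambda>n. vinner H (W n v) (W n w)) \<longlonglongrightarrow> vinner H (V v) (V w)"
      using c V WB by (intro vlim_inner) auto
    then show "vinner H (V v) (V w) = vinner H v w"
      using c by (simp add: isometry_opD(2)[OF W] LIMSEQ_const_iff)
  next
    fix a v assume c: "v \<in> carrier H"
    show "V (vscale H a v) = vscale H a (V v)"
    proof (rule vlim_unique)
      show "vlim H (\<lambda>n. W n (vscale H a v)) (V (vscale H a v))" using c by (intro V) simp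
      show "vlim H (\<lambda>n. W n (vscale H a v)) (vscale H a (V v))"
        using vlim_scale[OF V(2)[OF c(1)]] c WB V by (simp add: op_scale)
    qed (use c V WB in auto)
  qed (use V in \<open>auto simp: V_def\<close>)
  then show ?thesis using V by blast
qed

text \<open>A strong limit of unitaries is in general only an isometry. Strong convergence of the
  adjoints supplies surjectivity, because their limit \<open>V'\<close> is a right inverse of
  \<open>V\<close>.\<close>

theorem strong_limit_unitary:
  assumes W: "\<And>n. unitary_op H (W n)" and d: "vdense H e X"
    and e: "\<And>x. x \<in> X \<Longrightarrow> e x \<in> carrier H"
    and c: "\<And>x. x \<in> X \<Longrightarrow> (\<lambda>n. W n (e x)) \<in> cauchy_seqs H"
    and c': "\<And>x. x \<in> X \<Longrightarrow> (\<lambda>n. adj_op H (W n) (e x)) \<in> cauchy_seqs H"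
  shows "\<exists>V. unitary_op H V \<and> (\<forall>v\<in>carrier H. vlim H (\<lambda>n. W n v) (V v))"
proof -
  have WB: "W n \<in> B_of H" for n by (rule unitary_closed[OF W])
  obtain V where V: "isometry_op H H V" "\<And>v. v \<in> carrier H \<Longrightarrow> vlim H (\<lambda>n. W n v) (V v)"
    using strong_limit_isometry[OF unitary_isometry[OF W] d e c] by blast
  obtain V' where V': "isometry_op H H V'" "\<And>v. v \<in> carrier H \<Longrightarrow> vlim H (\<lambda>n. adj_op H (W n) v) (V' v)"
    using strong_limit_isometry[OF unitary_isometry[OF unitary_adj[OF W]] d e c'] by blast
  have B: "V \<in> B_of H" "V' \<in> B_of H" using isometry_opD(1)[OF V(1)] isometry_opD(1)[OF V'(1)] by blast+
  have "unitary_op H V"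
  proof (rule unitaryI[OF V(1)])
    fix y assume y: "y \<in> carrier H"
    \<comment> \<open>\<open>W n\<close> is isometric, so the distance from
      \<open>W n (V' y)\<close> to \<open>y\<close> equals that from \<open>V' y\<close> to
      \<open>adj_op H (W n) y\<close>, which tends to zero.\<close>
    have 1: "vlim H (\<lambda>n. W n (V' y)) y"
    proof (rule vlim_squeeze)
      show "(\<lambda>n. vdist H (adj_op H (W n) y) (V' y)) \<longlonglongrightarrow> 0" using V'(2)[OF y] by (simp add: vlim_def)
      have *: "vdist H (W n (V' y)) (W n (adj_op H (W n) y)) = vdist H (V' y) (adj_op H (W n) y)" for n
        by (rule isometry_op_vdist[OF inner_product_space_axioms unitary_isometry[OF W]])
          (use y WB B in auto)
      show "vdist H (W n (V' y)) y \<le> vdist H (adj_op H (W n) y) (V' y)" for n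
        using *[of n] unitary_adj_right[OF W y] vdist_commute[of "V' y" "adj_op H (W n) y"] y WB B by simp
    qed (use y WB B in auto)
    have 2: "vlim H (\<lambda>n. W n (V' y)) (V (V' y))" using V(2) B y by simp
    have "V (V' y) = y"
      by (rule vlim_unique[OF 2 1]) (use WB B y in auto)
    then show "\<exists>x\<in>carrier H. V x = y" using B y by auto
  qed
  then show ?thesis using V(2) by blast
qed

text \<open>The freedom by which the overlaps are made nonnegative without affecting the
  action.\<close>

lemma unitary_phase:
  assumes U: "unitary_op H U" and c: "cmod c = 1"
  shows "unitary_op H (scale_op H c U)" "T \<in> B_of H \<Longrightarrow> Ad_op H (scale_op H c U) T = Ad_op H U T"
proof -
  have UB: "U \<in> B_of H" by (rule unitary_closed[OF U])
  have cc: "c * cnj c = 1" using complex_norm_square[of c] c by simp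
  have adj: "adj_op H (scale_op H c U) = scale_op H (cnj c) (adj_op H U)"
    by (rule adj_opI) (use UB in \<open>auto simp: inner_simps inner_adj_right\<close>)
  show "unitary_op H (scale_op H c U)"
    unfolding unitary_op_def adj using UB cc unitary_adj_left[OF U] unitary_adj_right[OF U]
    by (auto intro!: op_eqI simp: op_scale mult.commute)
  show "Ad_op H (scale_op H c U) T = Ad_op H U T" if T: "T \<in> B_of H"
    by (rule op_eqI) (use T UB cc in \<open>auto simp: Ad_op_apply adj op_scale mult.commute\<close>)
qed

text \<open>Hence the action takes the projection onto \<open>\<phi> i\<close> to the projection
  onto \<open>U i (\<phi> i)\<close>; the lower bound for the products of the overlaps rests on
  this.\<close>

lemma Ad_rank_one:
  assumes U: "unitary_op H U" and x: "x \<in> carrier H" "y \<in> carrier H"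
  shows "Ad_op H U (rank_one H x y) = rank_one H (U x) (U y)"
proof (rule op_eqI)
  note UB = unitary_closed[OF U]
  fix v assume "v \<in> carrier H"
  then show "Ad_op H U (rank_one H x y) v = rank_one H (U x) (U y) v"
    using x UB by (simp add: Ad_op_apply op_scale inner_adj_left)
qed (use x unitary_closed[OF U] in auto)

end


section \<open>The action on the algebraic tensor product\<close>

context tensor_factors
begin

abbreviation "Alg \<equiv> alg_tensor H \<phi> (\<lambda>i. B_of (H i))"

lemma Alg:
  shows Alg_star: "star_algebra K Alg" and Alg_incl: "ops \<subseteq> Alg" and Alg_closed: "Alg \<subseteq> B_of K"
    and Alg_least: "star_algebra K A \<Longrightarrow> ops \<subseteq> A \<Longrightarrow> Alg \<subseteq> A"
  using K.generated_star_algebra[OF tensor_ops_closed] by (auto simp: alg_tensor_def)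

lemma Alg_op_closed:
  "S \<in> Alg \<Longrightarrow> T \<in> Alg \<Longrightarrow> add_op K S T \<in> Alg"
  "S \<in> Alg \<Longrightarrow> T \<in> Alg \<Longrightarrow> mult_op K S T \<in> Alg"
  "T \<in> Alg \<Longrightarrow> scale_op K c T \<in> Alg" "T \<in> Alg \<Longrightarrow> adj_op K T \<in> Alg"
  using Alg_star unfolding star_algebra_def by blast+

text \<open>Conjugation by the finite product of \<open>U 0, ..., U n\<close> becomes constant on
  each element of \<open>Alg\<close> once \<open>n\<close> is large. Its eventual value defines the
  product action without any convergence of the unitaries themselves.\<close>

definition eventually_Ad :: "(nat \<Rightarrow> 'a \<Rightarrow> 'a) \<Rightarrow> ('a inf_tensor \<Rightarrow> 'a inf_tensor) \<Rightarrow> ('a inf_tensor \<Rightarrow> 'a inf_tensor) \<Rightarrow> bool" where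
  "eventually_Ad U T S \<longleftrightarrow> (\<forall>\<^sub>F n in sequentially. Ad_op K (tens {..n} U) T = S)"

lemma eventually_Ad_unique: "eventually_Ad U T S \<Longrightarrow> eventually_Ad U T S' \<Longrightarrow> S = S'"
proof -
  assume "eventually_Ad U T S" "eventually_Ad U T S'"
  then have "\<forall>\<^sub>F n in sequentially. S = S'" unfolding eventually_Ad_def by eventually_elim simp
  then show "S = S'" by simp
qed

text \<open>Stated for a binary \<open>f\<close>; unary operations are covered by ignoring the
  second argument.\<close>

lemma eventually_Ad_map2:
  assumes "eventually_Ad U T S" "eventually_Ad U T' S'"
    and "\<And>n. Ad_op K (tens {..n} U) (f T T')
      = f (Ad_op K (tens {..n} U) T) (Ad_op K (tens {..n} U) T')"
  shows "eventually_Ad U (f T T') (f S S')"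
  using eventually_conj[OF assms(1,2)[unfolded eventually_Ad_def]] unfolding eventually_Ad_def
  by (rule eventually_mono) (simp add: assms(3))

lemma eventually_Ad_simps:
  assumes U: "\<And>i. unitary_op (H i) (U i)" and B: "T \<in> B_of K" "T' \<in> B_of K"
    and ev: "eventually_Ad U T S" "eventually_Ad U T' S'"
  shows "eventually_Ad U (add_op K T T') (add_op K S S')" "eventually_Ad U (mult_op K T T') (mult_op K S S')"
    "eventually_Ad U (scale_op K c T) (scale_op K c S)" "eventually_Ad U (adj_op K T) (adj_op K S)"
proof -
  have "unitary_op K (tens {..n} U)" for n using U by (intro tensor_op_unitary) auto
  note h = K.Ad_op_hom[OF this, unfolded star_hom_def]
  show "eventually_Ad U (add_op K T T') (add_op K S S')" "eventually_Ad U (mult_op K T T') (mult_op K S S')"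
    using h B by (auto intro!: eventually_Ad_map2[OF ev])
  show "eventually_Ad U (scale_op K c T) (scale_op K c S)" "eventually_Ad U (adj_op K T) (adj_op K S)"
    using h B by (auto intro!: eventually_Ad_map2[OF ev(1) ev(1), where f = "\<lambda>T _. scale_op K c T"]
        eventually_Ad_map2[OF ev(1) ev(1), where f = "\<lambda>T _. adj_op K T"])
qed

lemma eventually_Ad_tensor_op:
  assumes U: "\<And>i. unitary_op (H i) (U i)" and J: "finite J" and S: "\<And>i. i \<in> J \<Longrightarrow> S i \<in> B_of (H i)"
  shows "eventually_Ad U (tens J S) (tens J (\<lambda>i. Ad_op (H i) (U i) (S i)))"
proof -
  obtain N where N: "J \<subseteq> {..N}" using J finite_nat_iff_bounded_le by blast
  have "Ad_op K (tens {..n} U) (tens J S) = tens J (\<lambda>i. Ad_op (H i) (U i) (S i))"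
    if "n \<ge> N" for n
    by (rule tensor_op_Ad) (use N that S U in auto)
  then show ?thesis unfolding eventually_Ad_def by (auto simp: eventually_sequentially)
qed

text \<open>On generators the conjugations are constant as soon as \<open>n\<close> exceeds the
  index set, and the algebraic operations preserve this. So the operators with an eventual value in
  \<open>Alg\<close> form a star-algebra containing \<open>ops\<close>.\<close>

lemma eventually_Ad_exists:
  assumes U: "\<And>i. unitary_op (H i) (U i)" and T: "T \<in> Alg"
  shows "\<exists>S\<in>Alg. eventually_Ad U T S"
proof -
  let ?A = "{T \<in> B_of K. \<exists>S\<in>Alg. eventually_Ad U T S}"
  note ev = eventually_Ad_simps[OF U]
  have UB: "U i \<in> B_of (H i)" for i using U by (rule H.unitary_closed)
  have "ops \<subseteq> ?A"
  proof
    fix R assume R: "R \<in> ops"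
    then obtain J S where JS: "finite J" "\<And>i. i \<in> J \<Longrightarrow> S i \<in> B_of (H i)" "R = tens J S"
      unfolding tensor_ops_def by blast
    have "tens J (\<lambda>i. Ad_op (H i) (U i) (S i)) \<in> Alg"
      using JS UB Alg_incl by (auto intro!: subsetD[OF Alg_incl] tensor_opsI)
    then show "R \<in> ?A" using eventually_Ad_tensor_op[OF U JS(1,2)] JS R tensor_ops_closed by blast
  qed
  moreover have "star_algebra K ?A"
    unfolding star_algebra_def
  proof (intro conjI ballI allI)
    \<comment> \<open>Zero is reached as \<open>0\<close> times some member of \<open>?A\<close>;
      the tensor operator with empty index set provides one.\<close>
    obtain T S where T: "T \<in> ?A" "S \<in> Alg" "eventually_Ad U T S" "T \<in> B_of K"
      using \<open>ops \<subseteq> ?A\<close> tensor_opsI[of "{}"] by blast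
    have "eventually_Ad U (scale_op K 0 T) (scale_op K 0 S)" using ev(3)[OF T(4,4,3,3)] .
    moreover have "S \<in> B_of K" using T(2) Alg_closed by blast
    ultimately have "eventually_Ad U (\<lambda>x\<in>carrier K. vzero K) (scale_op K 0 S)"
      using T(4) by (simp only: K.scale_op_zero)
    then show "(\<lambda>x\<in>carrier K. vzero K) \<in> ?A" using Alg_op_closed(3)[OF T(2)] K.zero_op_closed by blast
  next
    fix T T' assume T: "T \<in> ?A" "T' \<in> ?A"
    then obtain S S' where S: "S \<in> Alg" "S' \<in> Alg" "eventually_Ad U T S" "eventually_Ad U T' S'" by blast
    have B: "T \<in> B_of K" "T' \<in> B_of K" using T by auto
    show "add_op K T T' \<in> ?A"
      using ev(1)[OF B S(3,4)] Alg_op_closed(1)[OF S(1,2)] K.add_op_closed[OF B] by blast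
    show "mult_op K T T' \<in> ?A"
      using ev(2)[OF B S(3,4)] Alg_op_closed(2)[OF S(1,2)] K.mult_op_closed[OF B] by blast
  next
    fix c T assume T: "T \<in> ?A"
    then obtain S where S: "S \<in> Alg" "eventually_Ad U T S" by blast
    have B: "T \<in> B_of K" using T by auto
    show "scale_op K c T \<in> ?A"
      using ev(3)[OF B B S(2,2)] Alg_op_closed(3)[OF S(1)] K.scale_op_closed[OF B] by blast
  next
    fix T assume T: "T \<in> ?A"
    then obtain S where S: "S \<in> Alg" "eventually_Ad U T S" by blast
    have B: "T \<in> B_of K" using T by auto
    show "adj_op K T \<in> ?A"
      using ev(4)[OF B B S(2,2)] Alg_op_closed(4)[OF S(1)] K.adj_op_closed[OF B] by blast
  qed blast
  ultimately show ?thesis using Alg_least T by blast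
qed

lemma alg_action_exists:
  assumes U: "\<And>i. unitary_op (H i) (U i)"
  shows "\<exists>\<beta>\<in>star_auto K Alg. \<forall>J S. finite J \<and> (\<forall>i\<in>J. S i \<in> B_of (H i)) \<longrightarrow>
    \<beta> (tens J S) = tens J (\<lambda>i. Ad_op (H i) (U i) (S i))"
proof -
  \<comment> \<open>Parametrised by the family of unitaries, because the inverse of
    \<open>lim U\<close> is \<open>lim\<close> for the family of adjoints.\<close>
  define lim where "lim U = (\<lambda>T\<in>Alg. SOME S. S \<in> Alg \<and> eventually_Ad U T S)" for U
  have lim: "lim U T \<in> Alg" "eventually_Ad U T (lim U T)"
    if "\<And>i. unitary_op (H i) (U i)" "T \<in> Alg" for U T
    using someI_ex[OF eventually_Ad_exists[OF that, unfolded Bex_def]] that(2) by (auto simp: lim_def)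
  have lim_eq: "lim U T = S" if "\<And>i. unitary_op (H i) (U i)" "T \<in> Alg" "eventually_Ad U T S" for U T S
    using eventually_Ad_unique[OF lim(2)[OF that(1,2)] that(3)] .
  let ?U' = "\<lambda>i. adj_op (H i) (U i)"
  have U': "\<And>i. unitary_op (H i) (?U' i)" using U H.unitary_adj by blast
  have UB: "U i \<in> B_of (H i)" for i using U by (rule H.unitary_closed)
  have AB: "T \<in> Alg \<Longrightarrow> T \<in> B_of K" for T using Alg_closed by blast
  have inv: "lim V' (lim V T) = T" if V: "\<And>i. unitary_op (H i) (V i)" and V': "\<And>i. unitary_op (H i) (V' i)"
    and adj: "\<And>n. tens {..n} V' = adj_op K (tens {..n} V)" and T: "T \<in> Alg" for V V' T
  proof (rule lim_eq[OF V'])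
    show "lim V T \<in> Alg" using lim V T by blast
    have u: "unitary_op K (tens {..n} V)" for n using V by (intro tensor_op_unitary) auto
    show "eventually_Ad V' (lim V T) T"
      using lim(2)[OF V T] unfolding eventually_Ad_def
      by (rule eventually_mono) (metis adj K.Ad_op_inverse[OF u AB[OF T]])
  qed
  have adj: "tens {..n} ?U' = adj_op K (tens {..n} U)" for n
    using UB by (simp add: tensor_op_adj)
  have adj': "tens {..n} U = adj_op K (tens {..n} ?U')" for n
    unfolding adj using UB by simp
  have bij: "bij_betw (lim U) Alg Alg"
    by (rule bij_betw_byWitness[where f' = "lim ?U'"])
      (use inv[OF U U' adj] inv[OF U' U adj'] lim(1)[OF U] lim(1)[OF U'] in auto)
  have "lim U \<in> star_auto K Alg"
    unfolding star_auto_def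
  proof (intro CollectI conjI ballI allI)
    show "lim U \<in> Bij Alg" using bij by (simp add: Bij_def lim_def)
    fix T T' assume T: "T \<in> Alg" "T' \<in> Alg"
    note ev = eventually_Ad_simps[OF U AB[OF T(1)] AB[OF T(2)] lim(2)[OF U T(1)] lim(2)[OF U T(2)]]
    show "lim U (add_op K T T') = add_op K (lim U T) (lim U T')"
      by (rule lim_eq[OF U Alg_op_closed(1)[OF T] ev(1)])
    show "lim U (mult_op K T T') = mult_op K (lim U T) (lim U T')"
      by (rule lim_eq[OF U Alg_op_closed(2)[OF T] ev(2)])
  next
    fix c T assume T: "T \<in> Alg"
    note ev = eventually_Ad_simps[OF U AB[OF T] AB[OF T] lim(2)[OF U T] lim(2)[OF U T]]
    show "lim U (scale_op K c T) = scale_op K c (lim U T)"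
      by (rule lim_eq[OF U Alg_op_closed(3)[OF T] ev(3)])
  next
    fix T assume T: "T \<in> Alg"
    note ev = eventually_Ad_simps[OF U AB[OF T] AB[OF T] lim(2)[OF U T] lim(2)[OF U T]]
    show "lim U (adj_op K T) = adj_op K (lim U T)"
      by (rule lim_eq[OF U Alg_op_closed(4)[OF T] ev(4)])
  qed
  moreover have "lim U (tens J S) = tens J (\<lambda>i. Ad_op (H i) (U i) (S i))"
    if "finite J" "\<forall>i\<in>J. S i \<in> B_of (H i)" for J S
  proof (rule lim_eq[OF U])
    show "tens J S \<in> Alg" using that by (intro subsetD[OF Alg_incl] tensor_opsI) auto
    show "eventually_Ad U (tens J S) (tens J (\<lambda>i. Ad_op (H i) (U i) (S i)))"
      using that by (intro eventually_Ad_tensor_op U) auto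
  qed
  ultimately show ?thesis by blast
qed

text \<open>Homomorphisms on \<open>Alg\<close> are determined by their values on the generators, so
  the definite description in \<open>alg_tensor_action\<close> picks out the automorphism just
  constructed.\<close>

lemma alg_tensor_action:
  assumes U: "\<And>i. unitary_op (H i) (U i)" and a: "\<And>i. \<alpha> i g = Ad_op (H i) (U i)"
  shows alg_tensor_action_auto: "alg_tensor_action H \<phi> (\<lambda>i. B_of (H i)) \<alpha> g \<in> star_auto K Alg"
    and alg_tensor_action_op: "finite J \<Longrightarrow> (\<And>i. i \<in> J \<Longrightarrow> S i \<in> B_of (H i)) \<Longrightarrow>
      alg_tensor_action H \<phi> (\<lambda>i. B_of (H i)) \<alpha> g (tens J S)
        = tens J (\<lambda>i. Ad_op (H i) (U i) (S i))"
proof -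
  let ?P = "\<lambda>\<beta>. \<beta> \<in> star_auto K Alg \<and> (\<forall>J S. finite J \<and> (\<forall>i\<in>J. S i \<in> B_of (H i)) \<longrightarrow>
    \<beta> (tens J S) = tens J (\<lambda>i. \<alpha> i g (S i)))"
  obtain \<beta> where b: "?P \<beta>" using alg_action_exists[where U = U, OF U] unfolding a by blast
  have "alg_tensor_action H \<phi> (\<lambda>i. B_of (H i)) \<alpha> g = \<beta>"
    unfolding alg_tensor_action_def
  proof (rule the_equality[where P = ?P, OF b])
    fix \<gamma> assume c: "?P \<gamma>"
    have "\<gamma> T = \<beta> T" if "T \<in> Alg" for T
    proof (rule K.star_hom_eq_on_generated[where \<beta> = \<gamma> and \<gamma> = \<beta> and T = T, OF tensor_ops_closed])
      show "star_hom K (generated_star_algebra K ops) \<gamma>" "star_hom K (generated_star_algebra K ops) \<beta>"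
        using star_auto_hom[OF Alg_closed] b c by (auto simp: alg_tensor_def)
      show "T \<in> generated_star_algebra K ops" using that by (simp add: alg_tensor_def)
      fix R assume "R \<in> ops"
      then obtain J S where JS: "finite J" "\<forall>i\<in>J. S i \<in> B_of (H i)" "R = tens J S"
        unfolding tensor_ops_def by blast
      then show "\<gamma> R = \<beta> R" using b c by metis
    qed
    moreover have "\<gamma> \<in> extensional Alg" "\<beta> \<in> extensional Alg" 
      using b c star_autoD(4)[of \<gamma> K Alg] star_autoD(4)[of \<beta> K Alg] by simp_all
    ultimately show "\<gamma> = \<beta>" by (meson extensionalityI)
  qed
  then show "alg_tensor_action H \<phi> (\<lambda>i. B_of (H i)) \<alpha> g \<in> star_auto K Alg"
    "finite J \<Longrightarrow> (\<And>i. i \<in> J \<Longrightarrow> S i \<in> B_of (H i)) \<Longrightarrow>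
      alg_tensor_action H \<phi> (\<lambda>i. B_of (H i)) \<alpha> g (tens J S)
        = tens J (\<lambda>i. Ad_op (H i) (U i) (S i))"
    using b a by auto
qed


section \<open>Implementation on the infinite tensor product\<close>

lemma overlap_le_1:
  assumes "unitary_op (H i) U"
  shows "cmod (vinner (H i) (U (\<phi> i)) (\<phi> i)) \<le> 1"
  using H.Cauchy_Schwarz[of "U (\<phi> i)" i "\<phi> i"] H.unitary_norm[OF assms] H.unitary_closed[OF assms] by simp

text \<open>Between the stages \<open>n\<close> and \<open>m\<close> only the factors in
  \<open>{n<..m}\<close> differ, and each contributes its overlap \<open>a i\<close> to the inner
  product of the two vectors. The squared distance is thus the squared norm of \<open>e x\<close>
  times \<open>2 * (1 - P)\<close>, where \<open>P\<close> is the product of these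
  \<open>a i\<close>, and \<open>1 - P\<close> is at most the sum of the \<open>1 - a i\<close>.
  Phases in the overlaps would enter the distance, hence the assumption that they are nonnegative
  reals.\<close>

lemma tensor_unitaries_cauchy:
  assumes V: "\<And>i. unitary_op (H i) (V i)"
    and a: "\<And>i. vinner (H i) (V i (\<phi> i)) (\<phi> i) = complex_of_real (a i)" "\<And>i. 0 \<le> a i"
    and sum: "summable (\<lambda>i. 1 - a i)" and x: "x \<in> E"
  shows "(\<lambda>n. tens {..n} V (e x)) \<in> cauchy_seqs K"
proof (rule K.cauchyI)
  have VB: "V i \<in> B_of (H i)" for i using V by (rule H.unitary_closed)
  let ?W = "\<lambda>n. tens {..n} V"
  have u: "unitary_op K (?W n)" for n using V by (intro tensor_op_unitary) auto
  show "?W n (e x) \<in> carrier K" for n using x VB by simp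
  have a1: "a i \<le> 1" for i using overlap_le_1[OF V[of i]] a(2)[of i] unfolding a(1) by simp
  obtain N where N: "\<forall>i>N. x i = \<phi> i" using elem_seqs_tail[OF x] .
  have dist: "(vdist K (?W m (e x)) (?W n (e x)))\<^sup>2 \<le> 2 * (vnorm K (e x))\<^sup>2 * (\<Sum>i\<in>{n<..m}. 1 - a i)"
    if "n \<ge> N" "m \<ge> n" for m n
  proof -
    let ?x = "\<lambda>n. apply_on {..n} V x"
    have t: "\<forall>i>m. ?x m i = \<phi> i" "\<forall>i>m. ?x n i = \<phi> i" "\<forall>i>m. x i = \<phi> i"
      using N that by (auto simp: apply_on_def)
    have split: "(\<Prod>i\<le>m. f i) = (\<Prod>i\<le>n. f i) * (\<Prod>i\<in>{n<..m}. f i)" for f :: "nat \<Rightarrow> complex"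
      using that by (subst prod.union_disjoint[symmetric]) (auto intro!: prod.cong)
    have "vinner K (?W m (e x)) (?W n (e x)) = (\<Prod>i\<le>m. vinner (H i) (?x m i) (?x n i))"
      using x VB t by (simp add: tensor_op_elem e_inner)
    also have "\<dots> = (\<Prod>i\<le>n. vinner (H i) (x i) (x i)) * (\<Prod>i\<in>{n<..m}. complex_of_real (a i))"
      unfolding split using that N elem_seqsD[OF x] a(1) H.unitary_inner[OF V]
      by (intro arg_cong2[where f = "(*)"] prod.cong) (auto simp: apply_on_def)
    also have "(\<Prod>i\<le>n. vinner (H i) (x i) (x i)) = vinner K (e x) (e x)"
      using x N that by (intro e_inner[symmetric]) auto
    finally have inn: "vinner K (?W m (e x)) (?W n (e x)) = complex_of_real ((vnorm K (e x))\<^sup>2 * (\<Prod>i\<in>{n<..m}. a i))"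
      using x by (simp add: K.inner_self)
    have re: "Re (vinner K (?W m (e x)) (?W n (e x))) = (vnorm K (e x))\<^sup>2 * (\<Prod>i\<in>{n<..m}. a i)"
      unfolding inn by (rule Re_complex_of_real)
    have "1 - (\<Sum>i\<in>{n<..m}. 1 - a i) \<le> (\<Prod>i\<in>{n<..m}. 1 - (1 - a i))"
      by (rule Weierstrass_prod_ineq) (use a a1 in auto)
    then have p: "1 - (\<Prod>i\<in>{n<..m}. a i) \<le> (\<Sum>i\<in>{n<..m}. 1 - a i)" by simp
    have "(vdist K (?W m (e x)) (?W n (e x)))\<^sup>2 = 2 * (vnorm K (e x))\<^sup>2 * (1 - (\<Prod>i\<in>{n<..m}. a i))"
      using x VB K.unitary_norm[OF u] by (simp add: K.vdist_sq re algebra_simps)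
    also have "\<dots> \<le> 2 * (vnorm K (e x))\<^sup>2 * (\<Sum>i\<in>{n<..m}. 1 - a i)"
      using p by (intro mult_left_mono) auto
    finally show ?thesis .
  qed
  fix r :: real assume r: "r > 0"
  \<comment> \<open>The added 1 makes \<open>C\<close> positive whatever the norm of
    \<open>e x\<close> is.\<close>
  define C where "C = 2 * (vnorm K (e x))\<^sup>2 + 1"
  have C: "C > 0" by (simp add: C_def add_nonneg_pos)
  obtain M where M: "\<And>m n. m \<ge> M \<Longrightarrow> norm (\<Sum>i\<in>{m..<n}. 1 - a i) < r\<^sup>2 / C"
    using sum r C unfolding summable_Cauchy by (metis divide_pos_pos zero_less_power)
  have "vdist K (?W n (e x)) (?W m (e x)) < r" if "n \<ge> max N M" "m \<ge> n" for m n
  proof (rule power2_less_imp_less)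
    let ?s = "\<Sum>i\<in>{n<..m}. 1 - a i"
    have s: "?s \<ge> 0" using a1 by (intro sum_nonneg) auto
    have "{n<..m} = {Suc n..<Suc m}" by auto
    then have "?s < r\<^sup>2 / C" using M[of "Suc n" "Suc m"] that s by simp
    have c: "?W k (e x) \<in> carrier K" for k using x VB by simp
    have "(vdist K (?W n (e x)) (?W m (e x)))\<^sup>2 \<le> 2 * (vnorm K (e x))\<^sup>2 * ?s"
      using dist[of n m] that K.vdist_commute[OF c c, of n m] by simp
    also have "\<dots> \<le> C * ?s" using s by (intro mult_right_mono) (auto simp: C_def)
    also have "\<dots> < r\<^sup>2" using \<open>?s < r\<^sup>2 / C\<close> C by (simp add: field_simps)
    finally show "(vdist K (?W n (e x)) (?W m (e x)))\<^sup>2 < r\<^sup>2" .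
  qed (use r in simp)
  then show "\<exists>N. \<forall>n\<ge>N. \<forall>m\<ge>n. vdist K (?W n (e x)) (?W m (e x)) < r" by blast
qed

text \<open>
  The phases of the \<open>U i\<close> do not affect \<open>Ad\<close> and are chosen such that all overlaps
  \<open>\<langle>U i \<phi>\<^sub>i, \<phi>\<^sub>i\<rangle>\<close> become nonnegative; then the finite tensor products converge strongly.
\<close>

theorem tensor_unitary_exists:
  assumes U: "\<And>i. unitary_op (H i) (U i)"
    and sum: "summable (\<lambda>i. 1 - cmod (vinner (H i) (U i (\<phi> i)) (\<phi> i)))"
  shows "\<exists>W. unitary_op K W \<and> (\<forall>J S. finite J \<longrightarrow> (\<forall>i\<in>J. S i \<in> B_of (H i)) \<longrightarrow>
    Ad_op K W (tens J S) = tens J (\<lambda>i. Ad_op (H i) (U i) (S i)))"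
proof -
  define z where "z i = vinner (H i) (U i (\<phi> i)) (\<phi> i)" for i
  \<comment> \<open>At a zero overlap \<open>sgn\<close> vanishes, so the phase defaults to 1 in
    order to stay unimodular.\<close>
  define c where "c i = (if z i = 0 then 1 else cnj (sgn (z i)))" for i
  define V where "V i = scale_op (H i) (c i) (U i)" for i
  have UB: "U i \<in> B_of (H i)" for i using U by (rule H.unitary_closed)
  have c1: "cmod (c i) = 1" for i by (simp add: c_def norm_sgn)
  have cz: "c i * z i = complex_of_real (cmod (z i))" for i
  proof (cases "z i = 0")
    case False
    have "c i * z i = (z i * cnj (z i)) / complex_of_real (cmod (z i))"
      using False by (simp add: c_def sgn_eq mult.commute)
    also have "\<dots> = complex_of_real (cmod (z i))"
      using False unfolding complex_norm_square[symmetric] by (simp add: power2_eq_square)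
    finally show ?thesis .
  qed simp
  have V: "unitary_op (H i) (V i)" for i unfolding V_def by (rule H.unitary_phase(1)[OF U c1])
  have VB: "V i \<in> B_of (H i)" for i using V by (rule H.unitary_closed)
  have V': "unitary_op (H i) (adj_op (H i) (V i))" for i using V by (rule H.unitary_adj)
  have ov: "vinner (H i) (V i (\<phi> i)) (\<phi> i) = complex_of_real (cmod (z i))" for i
    using UB by (simp add: V_def H.inner_scale cz flip: z_def)
  \<comment> \<open>The overlap of the adjoint is the complex conjugate, hence the same real number.
    The convergence lemma thus applies to the adjoints too, as the unitary strong limit
    requires.\<close>
  have ov': "vinner (H i) (adj_op (H i) (V i) (\<phi> i)) (\<phi> i) = complex_of_real (cmod (z i))" for i
    using VB H.inner_cnj[of "V i (\<phi> i)" i "\<phi> i"] ov by (simp add: H.inner_adj_left)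
  have sumz: "summable (\<lambda>i. 1 - cmod (z i))" using sum by (simp add: z_def)
  let ?W = "\<lambda>n. tens {..n} V"
  have u: "unitary_op K (?W n)" for n using V by (intro tensor_op_unitary) auto
  have adj: "adj_op K (?W n) = tens {..n} (\<lambda>i. adj_op (H i) (V i))" for n
    using VB by (simp add: tensor_op_adj)
  obtain W where W: "unitary_op K W" "\<And>v. v \<in> carrier K \<Longrightarrow> vlim K (\<lambda>n. ?W n v) (W v)"
    using K.strong_limit_unitary[where W = ?W, OF u e_dense e_closed
        tensor_unitaries_cauchy[OF V ov norm_ge_zero sumz]
        tensor_unitaries_cauchy[OF V' ov' norm_ge_zero sumz, folded adj]] by blast
  have WB: "W \<in> B_of K" using W(1) by (rule K.unitary_closed)
  have "Ad_op K W (tens J S) = tens J (\<lambda>i. Ad_op (H i) (U i) (S i))"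
    if J: "finite J" and S: "\<And>i. i \<in> J \<Longrightarrow> S i \<in> B_of (H i)" for J S
  proof -
    define T where "T = tens J S"
    define T' where "T' = tens J (\<lambda>i. Ad_op (H i) (U i) (S i))"
    have T: "T \<in> B_of K" "T' \<in> B_of K" using J S UB by (auto simp: T_def T'_def)
    have "tens J (\<lambda>i. Ad_op (H i) (V i) (S i)) = T'"
      unfolding T'_def by (rule tensor_op_eqI)
        (use J S UB VB H.unitary_phase(2)[OF U c1] in \<open>auto simp: V_def\<close>)
    then obtain N where N: "\<And>n. n \<ge> N \<Longrightarrow> Ad_op K (?W n) T = T'"
      using eventually_Ad_tensor_op[where U = V and S = S, OF V J S]
      by (auto simp: eventually_Ad_def eventually_sequentially T_def)
    have WT: "W (T v) = T' (W v)" if v: "v \<in> carrier K" for v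
    proof (rule K.vlim_unique)
      \<comment> \<open>Dropping the first \<open>N\<close> terms makes the conjugation identity
        valid along the whole sequence.\<close>
      let ?s = "\<lambda>n. ?W (n + N) (T v)"
      have ign: "vlim K (\<lambda>n. ?W (n + N) w) (W w)" if "w \<in> carrier K" for w
        using LIMSEQ_ignore_initial_segment[OF W(2)[OF that, unfolded vlim_def]] by (simp add: vlim_def)
      show "vlim K ?s (W (T v))" using ign T v by simp
      have "?s n = T' (?W (n + N) v)" for n
      proof -
        have "T' (?W (n + N) v) = Ad_op K (?W (n + N)) T (?W (n + N) v)" using N[of "n + N"] by simp
        also have "\<dots> = ?s n"
          using T v VB K.unitary_closed[OF u] K.unitary_adj_left[OF u] by (simp add: K.Ad_op_apply)
        finally show ?thesis ..
      qed
      then show "vlim K ?s (T' (W v))"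
        using K.op_vlim[OF T(2) ign[OF v]] K.unitary_closed[OF u] WB v by simp
    qed (use T v VB WB in auto)
    have "Ad_op K W T = T'"
    proof (rule K.op_eqI)
      fix y assume y: "y \<in> carrier K"
      then show "Ad_op K W T y = T' y"
        using WT[of "adj_op K W y"] T WB K.unitary_adj_right[OF W(1) y] by (simp add: K.Ad_op_apply)
    qed (use T WB in auto)
    then show ?thesis by (simp add: T_def T'_def)
  qed
  then show ?thesis using W(1) by blast
qed

text \<open>
  \<open>W \<Omega>\<close> is fixed by the projections onto \<open>U i \<phi>\<^sub>i\<close> in any finite set of factors. Pairing it with
  an elementary tensor bounds the products of the overlaps from below.
\<close>

theorem overlaps_summable:
  assumes U: "\<And>i. unitary_op (H i) (U i)" and W: "unitary_op K W"
    and WT: "\<And>J S v. finite J \<Longrightarrow> (\<And>i. i \<in> J \<Longrightarrow> S i \<in> B_of (H i)) \<Longrightarrow> v \<in> carrier K \<Longrightarrow>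
      tens J (\<lambda>i. Ad_op (H i) (U i) (S i)) (W v) = W (tens J S v)"
  shows "summable (\<lambda>i. 1 - cmod (vinner (H i) (U i (\<phi> i)) (\<phi> i)))"
proof -
  define a where "a i = cmod (vinner (H i) (U i (\<phi> i)) (\<phi> i))" for i
  have UB: "U i \<in> B_of (H i)" for i using U by (rule H.unitary_closed)
  have a: "0 \<le> a i" "a i \<le> 1" for i using overlap_le_1[OF U] by (auto simp: a_def)
  define \<eta> where "\<eta> = W \<Omega>"
  have \<eta>: "\<eta> \<in> carrier K" "vnorm K \<eta> = 1"
    using K.unitary_closed[OF W] K.unitary_norm[OF W] by (auto simp: \<eta>_def)
  \<comment> \<open>Elementary tensors are total, so the unit vector \<open>\<eta>\<close> cannot be
    orthogonal to all of them.\<close>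
  obtain x where x: "x \<in> E" "vinner K \<eta> (e x) \<noteq> 0"
  proof (rule ccontr)
    assume "\<not> thesis"
    then have "\<eta> = vzero K" using that \<eta> by (intro inner_dense_eqI) auto
    then show False using \<eta>(2) by simp
  qed
  obtain N where N: "\<forall>i>N. x i = \<phi> i" using elem_seqs_tail[OF x(1)] .
  define c where "c = cmod (vinner K \<eta> (e x))"
  define B where "B = vnorm K (e x)"
  have c: "c > 0" using x(2) by (simp add: c_def)
  \<comment> \<open>\<open>?Q\<close> is self-adjoint and fixes \<open>\<eta>\<close>, so
    \<open>e x\<close> may be replaced by \<open>?Q (e x)\<close> in the pairing. In each factor of
    \<open>?J\<close> this replaces \<open>\<phi> i\<close> by its projection onto
    \<open>U i (\<phi> i)\<close>, of norm \<open>a i\<close>, and Cauchy-Schwarz gives the bound.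
    The factors up to \<open>N\<close> are left out because nothing is known about \<open>x\<close>
    there.\<close>
  have bound: "c \<le> B * (\<Prod>i\<in>{N<..m}. a i)" if m: "m \<ge> N" for m
  proof -
    let ?J = "{N<..m}"
    let ?P = "tens ?J (\<lambda>i. rank_one (H i) (\<phi> i) (\<phi> i))"
    let ?r = "\<lambda>i. rank_one (H i) (U i (\<phi> i)) (U i (\<phi> i))"
    let ?Q = "tens ?J ?r"
    let ?x = "apply_on ?J ?r x"
    have r: "?r i \<in> B_of (H i)" for i using UB by simp
    have Q: "?Q \<in> B_of K" "adj_op K ?Q = ?Q"
      using r UB by (simp_all add: tensor_op_adj H.adj_rank_one)
    have "apply_on ?J (\<lambda>i. rank_one (H i) (\<phi> i) (\<phi> i)) \<phi> = \<phi>" by (auto simp: apply_on_def)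
    then have "?P \<Omega> = \<Omega>" by (simp add: tensor_op_elem)
    moreover have "?Q \<eta> = W (?P \<Omega>)"
      using WT[of ?J "\<lambda>i. rank_one (H i) (\<phi> i) (\<phi> i)" \<Omega>] by (simp add: H.Ad_rank_one[OF U] \<eta>_def)
    ultimately have "?Q \<eta> = \<eta>" by (simp add: \<eta>_def)
    have x': "?x \<in> E" using x(1) r by simp
    have t: "\<forall>i>m. ?x i = \<phi> i" "\<forall>i>m. x i = \<phi> i" using N m by (auto simp: apply_on_def)
    have sp: "(\<Prod>i\<le>m. f i) = (\<Prod>i\<le>N. f i) * (\<Prod>i\<in>?J. f i)" for f :: "nat \<Rightarrow> complex"
      using m by (subst prod.union_disjoint[symmetric]) (auto intro!: prod.cong)
    have "vinner K (e ?x) (e ?x) = (\<Prod>i\<le>N. vinner (H i) (x i) (x i)) * (\<Prod>i\<in>?J. complex_of_real ((a i)\<^sup>2))"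
      unfolding e_inner[OF x' x' t(1) t(1)] sp
    proof (intro arg_cong2[where f = "(*)"] prod.cong refl)
      fix i assume i: "i \<in> ?J"
      have "vinner (H i) (\<phi> i) (U i (\<phi> i)) * cnj (vinner (H i) (\<phi> i) (U i (\<phi> i))) = complex_of_real ((a i)\<^sup>2)"
        using complex_norm_square[of "vinner (H i) (\<phi> i) (U i (\<phi> i))"] H.inner_cnj[of "U i (\<phi> i)" i "\<phi> i"] UB
        by (simp add: a_def)
      then show "vinner (H i) (?x i) (?x i) = complex_of_real ((a i)\<^sup>2)"
        using i N UB H.unitary_inner[OF U] by (simp add: apply_on_def H.inner_simps mult.commute)
    qed (auto simp: apply_on_def)
    also have "(\<Prod>i\<le>N. vinner (H i) (x i) (x i)) = vinner K (e x) (e x)"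
      using e_inner[OF x(1) x(1) N N] by simp
    finally have "(vnorm K (e ?x))\<^sup>2 = (B * (\<Prod>i\<in>?J. a i))\<^sup>2"
      using x(1) x' unfolding K.inner_self[OF e_closed[OF x']] K.inner_self[OF e_closed[OF x(1)]]
        of_real_prod[symmetric] of_real_mult[symmetric] of_real_eq_iff
      by (simp add: B_def power_mult_distrib prod_power_distrib)
    then have nx: "vnorm K (e ?x) = B * (\<Prod>i\<in>?J. a i)"
      by (rule power2_eq_imp_eq) (use x(1) x' a in \<open>auto simp: B_def intro!: mult_nonneg_nonneg prod_nonneg\<close>)
    have "vinner K \<eta> (e x) = vinner K \<eta> (?Q (e x))"
      using K.inner_adj_left[OF Q(1) \<eta>(1) e_closed[OF x(1)]] \<open>?Q \<eta> = \<eta>\<close> by (simp add: Q(2))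
    also have "?Q (e x) = e ?x" using x(1) r by (simp add: tensor_op_elem)
    finally show ?thesis
      using K.Cauchy_Schwarz[OF \<eta>(1) e_closed[OF x']] \<eta>(2) nx by (simp add: c_def)
  qed
  \<comment> \<open>At \<open>m = N\<close> the product is empty and the bound reads
    \<open>c <= B\<close>.\<close>
  have B: "B > 0" using bound[of N] c by simp
  have sum: "(\<Sum>i\<in>{N<..m}. 1 - a i) \<le> ln (B / c)" if m: "m \<ge> N" for m
  proof -
    have "c / B \<le> (\<Prod>i\<in>{N<..m}. a i)" using bound[OF m] B by (simp add: field_simps)
    \<comment> \<open>The inequality \<open>a <= exp (- (1 - a))\<close> turns a lower bound on
      products into an upper bound on sums.\<close>
    also have "\<dots> \<le> (\<Prod>i\<in>{N<..m}. exp (- (1 - a i)))"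
      using a exp_ge_add_one_self[of "a _ - 1"] by (intro prod_mono) (auto simp: add.commute)
    also have "\<dots> = exp (- (\<Sum>i\<in>{N<..m}. 1 - a i))" by (simp add: exp_sum flip: sum_negf)
    finally have "ln (c / B) \<le> ln (exp (- (\<Sum>i\<in>{N<..m}. 1 - a i)))"
      using c B by (subst ln_le_cancel_iff) simp_all
    then show ?thesis using c B by (simp add: ln_div)
  qed
  \<comment> \<open>The first \<open>N + 1\<close> overlaps, which may even vanish, do not affect
    summability.\<close>
  have "summable (\<lambda>i. 1 - a (i + Suc N))"
  proof (rule summableI_nonneg_bounded)
    fix n
    have "(\<Sum>i<n. 1 - a (i + Suc N)) = (\<Sum>i\<in>{N<..N + n}. 1 - a i)"
      by (rule sum.reindex_bij_witness[of _ "\<lambda>i. i - Suc N" "\<lambda>i. i + Suc N"]) auto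
    then show "(\<Sum>i<n. 1 - a (i + Suc N)) \<le> ln (B / c)" using sum[of "N + n"] by simp
  qed (use a in simp)
  then have "summable (\<lambda>i. 1 - a i)" by (subst (asm) summable_iff_shift)
  then show ?thesis by (simp add: a_def)
qed

end


section \<open>Extension of the product action\<close>

text \<open>\<open>hom\<close> asks for values in the carrier and for multiplicativity, and the
  product in \<open>BijGroup\<close> is composition restricted to \<open>A\<close>.\<close>

lemma algebra_action_iff:
  "algebra_action G H A \<gamma> \<longleftrightarrow> (\<forall>g\<in>carrier G. \<gamma> g \<in> star_auto H A) \<and>
     (\<forall>g\<in>carrier G. \<forall>h\<in>carrier G. \<gamma> (g \<otimes>\<^bsub>G\<^esub> h) = compose A (\<gamma> g) (\<gamma> h))"
proof -
  have "\<beta> \<in> Bij A" if "\<beta> \<in> star_auto H A" for \<beta> using that by (simp add: star_auto_def)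
  then show ?thesis
    by (auto simp: algebra_action_def hom_def star_AutoGroup_def BijGroup_def Pi_iff)
qed

theorem theorem5p2:
  fixes G :: "('g, 'm) monoid_scheme"
    and H :: "nat \<Rightarrow> 'a cspace"
    and \<phi> :: "nat \<Rightarrow> 'a"
    and \<alpha> :: "nat \<Rightarrow> 'g \<Rightarrow> ('a \<Rightarrow> 'a) \<Rightarrow> 'a \<Rightarrow> 'a"
    and U :: "nat \<Rightarrow> 'g \<Rightarrow> 'a \<Rightarrow> 'a"
  assumes "group G" and "carrier G \<noteq> {\<one>\<^bsub>G\<^esub>}"
    and "\<And>i. hilbert_space (H i)"
    and "\<And>i. \<phi> i \<in> carrier (H i)" and "\<And>i. vnorm (H i) (\<phi> i) = 1"
    and "\<And>i. algebra_action G (H i) (B_of (H i)) (\<alpha> i)"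
    and "\<And>i g. g \<in> carrier G \<Longrightarrow> unitary_op (H i) (U i g)"
    and "\<And>i g. g \<in> carrier G \<Longrightarrow> \<alpha> i g = Ad_op (H i) (U i g)"
  shows "((\<exists>\<gamma>. extends_tensor_action G H \<phi> (\<lambda>i. B_of (H i)) \<alpha> \<gamma>) \<longleftrightarrow>
          (\<forall>g\<in>carrier G. summable (\<lambda>i. 1 - cmod (vinner (H i) (U i g (\<phi> i)) (\<phi> i))))) \<and>
         (\<forall>\<gamma> \<gamma>'. extends_tensor_action G H \<phi> (\<lambda>i. B_of (H i)) \<alpha> \<gamma> \<and>
                 extends_tensor_action G H \<phi> (\<lambda>i. B_of (H i)) \<alpha> \<gamma>' \<longrightarrow>
                 (\<forall>g\<in>carrier G. \<gamma> g = \<gamma>' g))"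
proof -
  interpret tensor_factors H \<phi> by (rule tensor_factors.intro) (fact assms)+
  interpret G: group G by (rule assms(1))
  let ?ext = "extends_tensor_action G H \<phi> (\<lambda>i. B_of (H i)) \<alpha>"
  note U = assms(7) and a = assms(8)
  have extD: "\<gamma> g \<in> star_auto K (B_of K)"
    "finite J \<Longrightarrow> (\<And>i. i \<in> J \<Longrightarrow> S i \<in> B_of (H i)) \<Longrightarrow>
      \<gamma> g (tens J S) = tens J (\<lambda>i. Ad_op (H i) (U i g) (S i))"
    if "?ext \<gamma>" "g \<in> carrier G" for \<gamma> g J S
  proof -
    show "\<gamma> g \<in> star_auto K (B_of K)"
      using that by (simp add: extends_tensor_action_def algebra_action_iff vN_tensor_eq)
    assume JS: "finite J" "\<And>i. i \<in> J \<Longrightarrow> S i \<in> B_of (H i)"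
    then have "tens J S \<in> Alg" using Alg_incl tensor_opsI by blast
    then show "\<gamma> g (tens J S) = tens J (\<lambda>i. Ad_op (H i) (U i g) (S i))"
      using that alg_tensor_action_op[where U = "\<lambda>i. U i g" and \<alpha> = \<alpha> and g = g and J = J and S = S,
          OF U[OF that(2)] a[OF that(2)] JS]
      by (simp add: extends_tensor_action_def)
  qed
  have unique: "\<gamma> g = \<gamma>' g" if "?ext \<gamma>" "?ext \<gamma>'" "g \<in> carrier G" for \<gamma> \<gamma>' g
  proof (rule star_auto_unique)
    fix T assume "T \<in> ops"
    then obtain J S where "finite J" "\<And>i. i \<in> J \<Longrightarrow> S i \<in> B_of (H i)" "T = tens J S"
      unfolding tensor_ops_def by blast
    then show "\<gamma> g T = \<gamma>' g T" using extD(2) that by simp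
  qed (use extD(1) that in auto)
  \<comment> \<open>Spatiality supplies the unitary \<open>W\<close>, so no normality of the given
    automorphism is presupposed.\<close>
  have summable: "summable (\<lambda>i. 1 - cmod (vinner (H i) (U i g (\<phi> i)) (\<phi> i)))" if \<gamma>: "?ext \<gamma>" and g: "g \<in> carrier G" for \<gamma> g
  proof -
    obtain W where W: "unitary_op K W" "\<And>T x. T \<in> B_of K \<Longrightarrow> x \<in> carrier K \<Longrightarrow> \<gamma> g T (W x) = W (T x)"
      using K.star_auto_spatial[OF extD(1)[OF \<gamma> g], of \<Omega>] by auto
    show ?thesis
    proof (rule overlaps_summable[where U = "\<lambda>i. U i g", OF U[OF g] W(1)])
      fix J S v assume J: "finite J" and S: "\<And>i. i \<in> J \<Longrightarrow> S i \<in> B_of (H i)" and v: "v \<in> carrier K"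
      show "tens J (\<lambda>i. Ad_op (H i) (U i g) (S i)) (W v) = W (tens J S v)"
        using W(2)[OF tensor_op_closed[OF J S] v] extD(2)[OF \<gamma> g J S] by simp
    qed
  qed
  have exists: "\<exists>\<gamma>. ?ext \<gamma>"
    if sum: "\<forall>g\<in>carrier G. summable (\<lambda>i. 1 - cmod (vinner (H i) (U i g (\<phi> i)) (\<phi> i)))"
  proof -
    let ?imp = "\<lambda>g W. unitary_op K W \<and> (\<forall>J S. finite J \<longrightarrow> (\<forall>i\<in>J. S i \<in> B_of (H i)) \<longrightarrow>
        Ad_op K W (tens J S) = tens J (\<lambda>i. Ad_op (H i) (U i g) (S i)))"
    have "\<exists>W. ?imp g W" if g: "g \<in> carrier G" for g
      using tensor_unitary_exists[where U = "\<lambda>i. U i g", OF U[OF g] bspec[OF sum g]] .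
    then have "\<forall>g\<in>carrier G. \<exists>W. ?imp g W" by blast
    from bchoice[OF this] obtain W where W': "\<forall>g\<in>carrier G. ?imp g (W g)" by blast
    have W: "\<And>g. g \<in> carrier G \<Longrightarrow> unitary_op K (W g)"
      "\<And>g J S. g \<in> carrier G \<Longrightarrow> finite J \<Longrightarrow> \<forall>i\<in>J. S i \<in> B_of (H i) \<Longrightarrow>
        Ad_op K (W g) (tens J S) = tens J (\<lambda>i. \<alpha> i g (S i))"
      using W' a by simp_all
    define \<gamma> where "\<gamma> g = Ad_op K (W g)" for g
    have auto: "\<gamma> g \<in> star_auto K (B_of K)" if "g \<in> carrier G" for g
      unfolding \<gamma>_def by (rule K.Ad_op_star_auto[OF W(1)[OF that]])
    have aB: "\<alpha> i g S \<in> B_of (H i)" if "g \<in> carrier G" "S \<in> B_of (H i)" for i g S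
      using that assms(6)[of i] star_autoD(1)[of "\<alpha> i g" "H i" "B_of (H i)" S]
      unfolding algebra_action_iff by blast
    \<comment> \<open>The unitaries \<open>W g\<close> are chosen separately for each
      \<open>g\<close> and matter only up to phases, so they need not multiply like the group
      elements. The group law is checked on elementary tensor operators, where it is that of the
      \<open>\<alpha> i\<close>, and it extends by uniqueness of automorphisms.\<close>
    have mult: "\<gamma> (g \<otimes>\<^bsub>G\<^esub> h) = compose (B_of K) (\<gamma> g) (\<gamma> h)" if g: "g \<in> carrier G" and h: "h \<in> carrier G" for g h
    proof (rule star_auto_unique)
      show "\<gamma> (g \<otimes>\<^bsub>G\<^esub> h) \<in> star_auto K (B_of K)" using g h by (intro auto) simp
      show "compose (B_of K) (\<gamma> g) (\<gamma> h) \<in> star_auto K (B_of K)"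
        using g h by (intro K.star_auto_compose auto K.star_algebra_B)
      fix T assume "T \<in> ops"
      then obtain J S where JS: "finite J" "\<forall>i\<in>J. S i \<in> B_of (H i)" "T = tens J S"
        unfolding tensor_ops_def by blast
      have TB: "T \<in> B_of K" using JS by simp
      have eq: "\<alpha> i (g \<otimes>\<^bsub>G\<^esub> h) (S i) = \<alpha> i g (\<alpha> i h (S i))" if "i \<in> J" for i
        using assms(6)[of i] g h JS(2) that by (simp add: algebra_action_iff compose_eq)
      have "\<gamma> (g \<otimes>\<^bsub>G\<^esub> h) T = tens J (\<lambda>i. \<alpha> i (g \<otimes>\<^bsub>G\<^esub> h) (S i))"
        unfolding \<gamma>_def JS(3) using g h JS by (intro W) auto
      also have "\<dots> = tens J (\<lambda>i. \<alpha> i g (\<alpha> i h (S i)))"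
        by (rule tensor_op_eqI) (use JS g h aB eq in auto)
      also have "\<dots> = \<gamma> g (\<gamma> h T)"
        unfolding \<gamma>_def JS(3) using g h JS aB by (simp add: W(2))
      finally show "\<gamma> (g \<otimes>\<^bsub>G\<^esub> h) T = compose (B_of K) (\<gamma> g) (\<gamma> h) T" using TB by (simp add: compose_eq)
    qed
    \<comment> \<open>The left-hand side comes from an automorphism of \<open>B_of K\<close>, the
      right-hand side from one of \<open>Alg\<close>. Both are homomorphisms from \<open>Alg\<close>
      into \<open>B_of K\<close> and are compared on generators.\<close>
    have "\<gamma> g T = alg_tensor_action H \<phi> (\<lambda>i. B_of (H i)) \<alpha> g T" if g: "g \<in> carrier G" and T: "T \<in> Alg" for g T
    proof (rule K.star_hom_eq_on_generated[where \<beta> = "\<gamma> g" and T = T, OF tensor_ops_closed])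
      show "star_hom K (generated_star_algebra K ops) (\<gamma> g)"
        using star_hom_subset[OF star_auto_hom[OF order_refl auto[OF g]] Alg_closed] by (simp add: alg_tensor_def)
      show "star_hom K (generated_star_algebra K ops) (alg_tensor_action H \<phi> (\<lambda>i. B_of (H i)) \<alpha> g)"
        using star_auto_hom[OF Alg_closed alg_tensor_action_auto[where U = "\<lambda>i. U i g" and \<alpha> = \<alpha> and g = g,
              OF U[OF g] a[OF g]]] by (simp add: alg_tensor_def)
      show "T \<in> generated_star_algebra K ops" using T by (simp add: alg_tensor_def)
      fix R assume "R \<in> ops"
      then obtain J S where JS: "finite J" "\<forall>i\<in>J. S i \<in> B_of (H i)" "R = tens J S"
        unfolding tensor_ops_def by blast
      show "\<gamma> g R = alg_tensor_action H \<phi> (\<lambda>i. B_of (H i)) \<alpha> g R"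
        using W(2)[OF g JS(1,2)] alg_tensor_action_op[where U = "\<lambda>i. U i g" and \<alpha> = \<alpha> and g = g and S = S,
            OF U[OF g] a[OF g] JS(1)] JS a[OF g]
        by (simp add: \<gamma>_def)
    qed
    then have "?ext \<gamma>"
      unfolding extends_tensor_action_def algebra_action_iff vN_tensor_eq using auto mult by blast
    then show ?thesis by blast
  qed
  show ?thesis
  proof (intro conjI iffI ballI allI impI)
    show "summable (\<lambda>i. 1 - cmod (vinner (H i) (U i g (\<phi> i)) (\<phi> i)))"
      if "\<exists>\<gamma>. ?ext \<gamma>" "g \<in> carrier G" for g
      using that(1) summable[OF _ that(2)] by (elim exE)
    show "\<gamma> g = \<gamma>' g" if "?ext \<gamma> \<and> ?ext \<gamma>'" "g \<in> carrier G" for \<gamma> \<gamma>' g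
      using that(1) unique[OF _ _ that(2)] by (elim conjE)
  qed (rule exists)
qed


end
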